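(* The set $$\{p\in\mathbb{T}:\ A^+p\ \text{is not fiberwise divergent}\}$$ is hyperplane absolute winning (HAW) on $\mathbb{T}$. In particular, it has full Hausdorff dimension in $\mathbb{T}$.
   Context: Let $X_3=\mathrm{SL}_3(\mathbb{R})/\mathrm{SL}_3(\mathbb{Z})$. For $(x,y)\in\mathbb{R}^2$ put $$p_{x,y}=\begin{pmatrix}1&0&x\\0&1&y\\0&0&1\end{pmatrix}\cdot\mathrm{SL}_3(\mathbb{Z})\in X_3,$$ and let $\mathbb{T}=\{p_{x,y}:(x,y)\in\mathbb{R}^2\}\subset X_3$, a two-dimensional subtorus, with $(x,y)\mapsto p_{x,y}$ a local diffeomorphism from $\mathbb{R}^2$ onto $\mathbb{T}$. Let $A^+=\{\mathrm{diag}(e^s,e^t,e^{-(s+t)}):s,t\ge0\}$, acting on $X_3$ by left translation, and for $T\ge0$ let $L_T^+=\{\mathrm{diag}(e^s,e^t,e^{-(s+t)}):s,t\ge0,\ s+t=T\}$. For $p\in X_3$, the orbit $A^+p$ is fiberwise divergent if for every compact $K\subset X_3$ there exists $T_0>0$ such that $L_T^+p\not\subseteq K$ for all $T>T_0$. Hyperplane absolute winning (HAW). Let $U\subset\mathbb{R}^d$ be open, $S\subset\mathbb{R}^d$, $\beta\in(0,1/3)$. For an affine hyperplane $L\subset\mathbb{R}^d$ and $r>0$ put $L^{(r)}=\{z\in\mathbb{R}^d:\mathrm{dist}(z,L)\le r\}$. Bob first chooses a closed ball $B_0\subset U$ of radius $\rho_0>0$. After Bob chooses a closed ball $B_n$ of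 radius $\rho_n$, Alice chooses $L_n^{(r_n)}$ with $r_n\le\beta\rho_n$, and then Bob chooses a closed ball $B_{n+1}\subset B_n\setminus L_n^{(r_n)}$ of radius $\rho_{n+1}\ge\beta\rho_n$. Alice wins by default if at any time Bob has no legal move, or if $\rho_n\not\to0$; otherwise Alice wins iff $\bigcap_nB_n\cap S\ne\varnothing$. $S$ is HAW on $U$ if for every $\beta\in(0,1/3)$ Alice has a winning strategy. A subset $S$ of a $d$-dimensional $C^1$ manifold $M$ with $C^1$ atlas $\{(U_\alpha,\varphi_\alpha)\}$ is HAW on $M$ if $\varphi_\alpha(S\cap U_\alpha)$ is HAW on $\varphi_\alpha(U_\alpha)$ for each $\alpha$ (this is independent of the atlas). *)

theory Defs
  imports "HOL-Analysis.Analysis"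
begin

section \<open>The hyperplane absolute game\<close>

definition affine_hyperplane :: "'a::euclidean_space set \<Rightarrow> bool" where
  "affine_hyperplane L \<longleftrightarrow> (\<exists>a b. a \<noteq> 0 \<and> L = {z. a \<bullet> z = b})"

definition hyperplane_nbhd :: "'a::euclidean_space set \<Rightarrow> real \<Rightarrow> 'a set" where
  "hyperplane_nbhd L r = {z. infdist z L \<le> r}"

text \<open>
  A closed ball is represented by the pair of its centre and its radius, and a position in which
  Alice is to move by the nonempty list of the balls chosen by Bob so far, oldest first.
  A strategy of Alice maps such a position to a pair \<open>(L, r)\<close>, which stands for the neighbourhood
  \<open>hyperplane_nbhd L r\<close>.
\<close>

type_synonym 'a haw_strategy = "('a \<times> real) list \<Rightarrow> 'a set \<times> real"

definition alice_move :: "real \<Rightarrow> real \<Rightarrow> 'a::euclidean_space set \<times> real \<Rightarrow> bool" where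
  "alice_move \<beta> \<rho> m \<longleftrightarrow> affine_hyperplane (fst m) \<and> 0 < snd m \<and> snd m \<le> \<beta> * \<rho>"

definition bob_play ::
  "real \<Rightarrow> 'a::euclidean_space set \<Rightarrow> 'a haw_strategy \<Rightarrow> (nat \<Rightarrow> 'a \<times> real) \<Rightarrow> bool" where
  "bob_play \<beta> U \<sigma> B \<longleftrightarrow>
     0 < snd (B 0) \<and> cball (fst (B 0)) (snd (B 0)) \<subseteq> U \<and>
     (\<forall>n. \<beta> * snd (B n) \<le> snd (B (Suc n)) \<and>
          cball (fst (B (Suc n))) (snd (B (Suc n))) \<subseteq>
            cball (fst (B n)) (snd (B n)) -
            (case \<sigma> (map B [0..<Suc n]) of (L, r) \<Rightarrow> hyperplane_nbhd L r))"

text \<open>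
  A run in which Bob gets stuck, or in which the radii do not tend to zero, is won by Alice;
  hence only infinite runs with radii tending to zero impose a condition.
\<close>

definition alice_winning_strategy ::
  "real \<Rightarrow> 'a::euclidean_space set \<Rightarrow> 'a set \<Rightarrow> 'a haw_strategy \<Rightarrow> bool" where
  "alice_winning_strategy \<beta> U S \<sigma> \<longleftrightarrow>
     (\<forall>h c \<rho>. 0 < \<rho> \<longrightarrow> alice_move \<beta> \<rho> (\<sigma> (h @ [(c, \<rho>)]))) \<and>
     (\<forall>B. bob_play \<beta> U \<sigma> B \<and> (\<lambda>n. snd (B n)) \<longlonglongrightarrow> 0 \<longrightarrow>
          (\<Inter>n. cball (fst (B n)) (snd (B n))) \<inter> S \<noteq> {})"

definition HAW_on :: "'a::euclidean_space set \<Rightarrow> 'a set \<Rightarrow> bool" where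
  "HAW_on U S \<longleftrightarrow> (\<forall>\<beta>. 0 < \<beta> \<and> \<beta> < 1/3 \<longrightarrow> (\<exists>\<sigma>. alice_winning_strategy \<beta> U S \<sigma>))"


section \<open>Continuously differentiable manifolds\<close>

definition C1_map_on ::
  "'a::real_normed_vector set \<Rightarrow> ('a \<Rightarrow> 'b::real_normed_vector) \<Rightarrow> bool" where
  "C1_map_on W f \<longleftrightarrow>
     (\<exists>f'. continuous_on W f' \<and> (\<forall>x\<in>W. (f has_derivative blinfun_apply (f' x)) (at x)))"

text \<open>Since \<open>\<phi>\<close> is injective on \<open>U\<close>, the function \<open>inv_into U \<phi>\<close> is the inverse of the chart.\<close>

definition C1_atlas :: "'p topology \<Rightarrow> ('p set \<times> ('p \<Rightarrow> 'e::euclidean_space)) set \<Rightarrow> bool" where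
  "C1_atlas X \<A> \<longleftrightarrow>
     topspace X = (\<Union>(U, \<phi>)\<in>\<A>. U) \<and>
     (\<forall>(U, \<phi>)\<in>\<A>. openin X U \<and> open (\<phi> ` U) \<and>
        homeomorphic_map (subtopology X U) (top_of_set (\<phi> ` U)) \<phi>) \<and>
     (\<forall>(U, \<phi>)\<in>\<A>. \<forall>(V, \<psi>)\<in>\<A>. C1_map_on (\<phi> ` (U \<inter> V)) (\<psi> \<circ> inv_into U \<phi>))"

definition HAW_on_manifold ::
  "'p topology \<Rightarrow> ('p set \<times> ('p \<Rightarrow> 'e::euclidean_space)) set \<Rightarrow> 'p set \<Rightarrow> bool" where
  "HAW_on_manifold X \<A> S \<longleftrightarrow>
     C1_atlas X \<A> \<and> S \<subseteq> topspace X \<and> (\<forall>(U, \<phi>)\<in>\<A>. HAW_on (\<phi> ` U) (\<phi> ` (S \<inter> U)))"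


section \<open>Hausdorff dimension in a metric space with carrier \<open>M\<close> and distance \<open>d\<close>\<close>

definition ediam :: "('p \<Rightarrow> 'p \<Rightarrow> real) \<Rightarrow> 'p set \<Rightarrow> ennreal" where
  "ediam d C = (SUP x\<in>C. SUP y\<in>C. ennreal (d x y))"

definition hausdorff_premeasure ::
  "'p set \<Rightarrow> ('p \<Rightarrow> 'p \<Rightarrow> real) \<Rightarrow> real \<Rightarrow> real \<Rightarrow> 'p set \<Rightarrow> ennreal" where
  "hausdorff_premeasure M d s \<delta> S =
     (INF C \<in> {C :: nat \<Rightarrow> 'p set. (\<forall>i. C i \<subseteq> M \<and> ediam d (C i) \<le> ennreal \<delta>) \<and> S \<subseteq> (\<Union>i. C i)}.
        \<Sum>i. ennreal (enn2real (ediam d (C i)) powr s))"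

definition hausdorff_measure ::
  "'p set \<Rightarrow> ('p \<Rightarrow> 'p \<Rightarrow> real) \<Rightarrow> real \<Rightarrow> 'p set \<Rightarrow> ennreal" where
  "hausdorff_measure M d s S = (SUP \<delta>\<in>{0<..}. hausdorff_premeasure M d s \<delta> S)"

text \<open>Only exponents \<open>s > 0\<close> are used, so that the value of \<open>0 powr 0\<close> plays no role.\<close>

definition hausdorff_dim :: "'p set \<Rightarrow> ('p \<Rightarrow> 'p \<Rightarrow> real) \<Rightarrow> 'p set \<Rightarrow> ennreal" where
  "hausdorff_dim M d S = (INF s\<in>{s. 0 < s \<and> hausdorff_measure M d s S = 0}. ennreal s)"


section \<open>The space of unimodular lattices\<close>

definition SL3_R :: "(real^3^3) set" where
  "SL3_R = {g. det g = 1}"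

definition SL3_Z :: "(real^3^3) set" where
  "SL3_Z = {g. det g = 1 \<and> (\<forall>i j. g $ i $ j \<in> \<int>)}"

definition translate :: "real^3^3 \<Rightarrow> (real^3^3) set \<Rightarrow> (real^3^3) set" where
  "translate a P = (\<lambda>g. a ** g) ` P"

definition coset :: "real^3^3 \<Rightarrow> (real^3^3) set" where
  "coset g = translate g SL3_Z"

definition X3 :: "(real^3^3) set set" where
  "X3 = coset ` SL3_R"

definition X3_topology :: "(real^3^3) set topology" where
  "X3_topology =
     topology (\<lambda>W. W \<subseteq> X3 \<and> openin (top_of_set SL3_R) {g \<in> SL3_R. coset g \<in> W})"

lemma openin_X3_topology:
  "openin X3_topology W \<longleftrightarrow>
     W \<subseteq> X3 \<and> openin (top_of_set SL3_R) {g \<in> SL3_R. coset g \<in> W}"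
proof -
  have "istopology (\<lambda>W. W \<subseteq> X3 \<and> openin (top_of_set SL3_R) {g \<in> SL3_R. coset g \<in> W})"
    unfolding istopology_def
  proof (intro conjI allI impI)
    fix S T
    assume "S \<subseteq> X3 \<and> openin (top_of_set SL3_R) {g \<in> SL3_R. coset g \<in> S}"
      and "T \<subseteq> X3 \<and> openin (top_of_set SL3_R) {g \<in> SL3_R. coset g \<in> T}"
    moreover have "{g \<in> SL3_R. coset g \<in> S \<inter> T} =
      {g \<in> SL3_R. coset g \<in> S} \<inter> {g \<in> SL3_R. coset g \<in> T}" by auto
    ultimately show "S \<inter> T \<subseteq> X3" "openin (top_of_set SL3_R) {g \<in> SL3_R. coset g \<in> S \<inter> T}"
      by auto
  next
    fix K
    assume K: "\<forall>S\<in>K. S \<subseteq> X3 \<and> openin (top_of_set SL3_R) {g \<in> SL3_R. coset g \<in> S}"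
    have "{g \<in> SL3_R. coset g \<in> \<Union>K} = (\<Union>S\<in>K. {g \<in> SL3_R. coset g \<in> S})" by blast
    moreover have "openin (top_of_set SL3_R) (\<Union>S\<in>K. {g \<in> SL3_R. coset g \<in> S})"
      by (rule openin_Union) (use K in blast)
    ultimately show "openin (top_of_set SL3_R) {g \<in> SL3_R. coset g \<in> \<Union>K}"
      by (simp only:)
    show "\<Union>K \<subseteq> X3" using K by auto
  qed
  then show ?thesis
    unfolding X3_topology_def by (simp add: topology_inverse')
qed

lemma topspace_X3_topology [simp]: "topspace X3_topology = X3"
proof
  show "topspace X3_topology \<subseteq> X3"
    using openin_X3_topology[of "topspace X3_topology"] by simp
  have "{g \<in> SL3_R. coset g \<in> X3} = SL3_R"
    by (auto simp: X3_def)
  then have "openin X3_topology X3"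
    by (simp add: openin_X3_topology)
  then show "X3 \<subseteq> topspace X3_topology"
    by (rule openin_subset)
qed

lemma quotient_map_coset: "quotient_map (top_of_set SL3_R) X3_topology coset"
  unfolding quotient_map_def by (auto simp: openin_X3_topology X3_def)


section \<open>Fiberwise divergence\<close>

definition diag_flow :: "real \<Rightarrow> real \<Rightarrow> real^3^3" where
  "diag_flow s t =
     vector [vector [exp s, 0, 0], vector [0, exp t, 0], vector [0, 0, exp (- (s + t))]]"

definition L_plus :: "real \<Rightarrow> (real^3^3) set" where
  "L_plus T = {diag_flow s t |s t. 0 \<le> s \<and> 0 \<le> t \<and> s + t = T}"

definition fiberwise_divergent :: "(real^3^3) set \<Rightarrow> bool" where
  "fiberwise_divergent p \<longleftrightarrow>
     (\<forall>K. compactin X3_topology K \<longrightarrow>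
        (\<exists>T0>0. \<forall>T>T0. \<not> (\<lambda>a. translate a p) ` L_plus T \<subseteq> K))"


section \<open>The torus of upper triangular unipotent lattices\<close>

definition unipotent :: "real \<times> real \<Rightarrow> real^3^3" where
  "unipotent z = vector [vector [1, 0, fst z], vector [0, 1, snd z], vector [0, 0, 1]]"

definition torus_point :: "real \<times> real \<Rightarrow> (real^3^3) set" where
  "torus_point z = coset (unipotent z)"

definition torus :: "(real^3^3) set set" where
  "torus = range torus_point"

text \<open>The charts are the local inverses of the local diffeomorphism \<open>torus_point\<close>.\<close>

definition torus_atlas ::
  "((real^3^3) set set \<times> ((real^3^3) set \<Rightarrow> real \<times> real)) set" where
  "torus_atlas = {(torus_point ` V, inv_into V torus_point) |V. open V \<and> inj_on torus_point V}"

text \<open>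
  The flat metric: the distance between the fibres of \<open>torus_point\<close>, which are the cosets of the
  lattice of integer points. On the compact torus it is bi-Lipschitz equivalent to the distance of
  any Riemannian metric, so the Hausdorff dimension of a subset does not depend on this choice.
\<close>

definition torus_dist :: "(real^3^3) set \<Rightarrow> (real^3^3) set \<Rightarrow> real" where
  "torus_dist p q = setdist (torus_point -` {p}) (torus_point -` {q})"


section \<open>The torus is a continuously differentiable manifold and a metric space\<close>

text \<open>
  The final theorems of this section show that \<open>torus_atlas\<close> is an atlas for the subspace topology
  that the torus inherits from \<open>X3_topology\<close>, and that \<open>torus_dist\<close> induces this topology.
\<close>

definition int_lattice :: "(real \<times> real) set" where
  "int_lattice = \<int> \<times> \<int>"

lemma int_lattice_closed_ops:
  "0 \<in> int_lattice" "n \<in> int_lattice \<Longrightarrow> - n \<in> int_lattice"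
  "m \<in> int_lattice \<Longrightarrow> n \<in> int_lattice \<Longrightarrow> m + n \<in> int_lattice"
  "m \<in> int_lattice \<Longrightarrow> n \<in> int_lattice \<Longrightarrow> m - n \<in> int_lattice"
  by (auto simp: int_lattice_def zero_prod_def mem_Times_iff)

lemma unipotent_entries:
  "unipotent z $ 1 $ 1 = 1" "unipotent z $ 1 $ 2 = 0" "unipotent z $ 1 $ 3 = fst z"
  "unipotent z $ 2 $ 1 = 0" "unipotent z $ 2 $ 2 = 1" "unipotent z $ 2 $ 3 = snd z"
  "unipotent z $ 3 $ 1 = 0" "unipotent z $ 3 $ 2 = 0" "unipotent z $ 3 $ 3 = 1"
  by (simp_all add: unipotent_def)

lemma unipotent_add: "unipotent z ** unipotent w = unipotent (z + w)"
  by (simp add: vec_eq_iff forall_3 matrix_matrix_mult_def sum_3 unipotent_entries)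

lemma unipotent_0: "unipotent 0 = mat 1"
  by (simp add: vec_eq_iff forall_3 mat_def unipotent_entries)

lemma det_unipotent: "det (unipotent z) = 1"
  by (simp add: det_3 unipotent_entries)

lemma unipotent_in_SL3_Z: "unipotent z \<in> SL3_Z \<longleftrightarrow> z \<in> int_lattice"
  by (auto simp: SL3_Z_def det_unipotent forall_3 unipotent_entries int_lattice_def mem_Times_iff)

lemma mat_1_in_SL3_Z: "mat 1 \<in> SL3_Z"
  by (simp add: SL3_Z_def) (simp add: mat_def)

lemma SL3_Z_mult: "g \<in> SL3_Z \<Longrightarrow> h \<in> SL3_Z \<Longrightarrow> g ** h \<in> SL3_Z"
  by (simp add: SL3_Z_def det_mul) (auto simp: matrix_matrix_mult_def intro!: Ints_sum)

lemma SL3_Z_inverse: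
  assumes "g \<in> SL3_Z" obtains h where "h \<in> SL3_Z" "g ** h = mat 1" "h ** g = mat 1"
proof -
  have d: "det g = 1" and int: "\<And>i j. g $ i $ j \<in> \<int>" using assms by (auto simp: SL3_Z_def)
  have "invertible g" using d by (simp add: invertible_det_nz)
  then obtain h where gh: "g ** h = mat 1" "h ** g = mat 1" unfolding invertible_def by blast
  have "h $ i $ j \<in> \<int>" for i j
  proof -
    have "g *v column j h = axis j 1"
      using gh(1) by (simp add: matrix_vector_mult_def column_def vec_eq_iff matrix_matrix_mult_def mat_def axis_def)
    then have "column j h = (\<chi> k. det (\<chi> a b. if b = k then axis j 1 $ a else g $ a $ b) / det g)"
      using cramer[of g] d by simp
    then have "h $ i $ j = det (\<chi> a b. if b = i then axis j 1 $ a else g $ a $ b)"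
      using d by (simp add: column_def vec_eq_iff)
    also have "\<dots> \<in> \<int>"
      using int by (auto simp: det_3 axis_def intro!: Ints_add Ints_diff Ints_mult)
    finally show ?thesis .
  qed
  moreover have "det h = 1" using gh(1) d by (metis det_I det_mul mult_1)
  ultimately have "h \<in> SL3_Z" by (simp add: SL3_Z_def)
  with gh show ?thesis using that by blast
qed

lemma coset_eq_iff: "coset g = coset h \<longleftrightarrow> (\<exists>\<gamma>\<in>SL3_Z. g = h ** \<gamma>)"
proof
  assume "coset g = coset h"
  moreover have "g \<in> coset g"
    unfolding coset_def translate_def using mat_1_in_SL3_Z by (metis imageI matrix_mul_rid)
  ultimately show "\<exists>\<gamma>\<in>SL3_Z. g = h ** \<gamma>" by (auto simp: coset_def translate_def)
next
  assume "\<exists>\<gamma>\<in>SL3_Z. g = h ** \<gamma>"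
  then obtain \<gamma> where \<gamma>: "\<gamma> \<in> SL3_Z" "g = h ** \<gamma>" by blast
  obtain \<delta> where \<delta>: "\<delta> \<in> SL3_Z" "\<gamma> ** \<delta> = mat 1" using SL3_Z_inverse[OF \<gamma>(1)] by metis
  show "coset g = coset h"
  proof
    show "coset g \<subseteq> coset h"
      using \<gamma> by (auto simp: coset_def translate_def SL3_Z_mult matrix_mul_assoc[symmetric])
    show "coset h \<subseteq> coset g"
    proof
      fix x assume "x \<in> coset h"
      then obtain a where a: "a \<in> SL3_Z" "x = h ** a" by (auto simp: coset_def translate_def)
      have "x = g ** (\<delta> ** a)"
        unfolding a(2) \<gamma>(2) by (metis \<delta>(2) matrix_mul_assoc matrix_mul_rid)
      then show "x \<in> coset g"
        using \<delta>(1) a(1) SL3_Z_mult by (auto simp: coset_def translate_def)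
    qed
  qed
qed

lemma torus_point_eq_iff: "torus_point z = torus_point w \<longleftrightarrow> z - w \<in> int_lattice"
proof
  assume "torus_point z = torus_point w"
  then obtain \<gamma> where \<gamma>: "\<gamma> \<in> SL3_Z" "unipotent z = unipotent w ** \<gamma>"
    by (auto simp: torus_point_def coset_eq_iff)
  have "unipotent (z - w) = unipotent (-w) ** (unipotent w ** \<gamma>)"
    unfolding \<gamma>(2)[symmetric] unipotent_add by simp
  also have "\<dots> = \<gamma>" by (simp add: matrix_mul_assoc unipotent_add unipotent_0)
  finally show "z - w \<in> int_lattice" using \<gamma>(1) unipotent_in_SL3_Z by metis
next
  assume "z - w \<in> int_lattice"
  then have "unipotent (z - w) \<in> SL3_Z" by (simp add: unipotent_in_SL3_Z)
  moreover have "unipotent z = unipotent w ** unipotent (z - w)" by (simp add: unipotent_add)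
  ultimately show "torus_point z = torus_point w"
    unfolding torus_point_def coset_eq_iff by blast
qed

lemma torus_subset_X3: "torus \<subseteq> X3"
  by (auto simp: torus_def torus_point_def X3_def SL3_R_def det_unipotent)

lemma continuous_on_matrix_mult:
  fixes f :: "'a::topological_space \<Rightarrow> real^3^3"
  assumes "continuous_on S f" "continuous_on S g"
  shows "continuous_on S (\<lambda>x. f x ** g x :: real^3^3)"
  unfolding matrix_matrix_mult_def using assms by (intro continuous_intros)

lemma continuous_on_unipotent: "continuous_on S unipotent"
proof -
  have e: "unipotent = (\<lambda>z. \<chi> i j. if i = 1 \<and> j = 3 then fst z else if i = 2 \<and> j = 3 then snd z
             else if i = j then 1 else 0)"
    by (simp add: fun_eq_iff vec_eq_iff forall_3 unipotent_entries)
  have *: "continuous_on S (\<lambda>z::real\<times>real. if P then f z else g z)"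
    if "continuous_on S f" "continuous_on S g" for P and f g :: "real\<times>real \<Rightarrow> real"
    using that by (cases P) simp_all
  show ?thesis unfolding e by (intro continuous_intros *)
qed

lemma closed_SL3_Z: "closed SL3_Z"
proof -
  have "closed ((\<Inter>i. \<Inter>j. (\<lambda>g::real^3^3. g $ i $ j) -` \<int>) \<inter> det -` {1})"
    by (intro closed_Int closed_INT ballI closed_vimage continuous_intros closed_Ints)
       (auto simp: det_3 intro!: continuous_intros)
  moreover have "SL3_Z = (\<Inter>i. \<Inter>j. (\<lambda>g::real^3^3. g $ i $ j) -` \<int>) \<inter> det -` {1}"
    by (auto simp: SL3_Z_def)
  ultimately show ?thesis by simp
qed

lemma closed_unipotent_mult_SL3_Z:
  assumes "compact C" shows "closed {unipotent z ** \<gamma> |z \<gamma>. z \<in> C \<and> \<gamma> \<in> SL3_Z}"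
  unfolding closed_sequential_limits
proof (intro allI impI, elim conjE)
  fix x l
  assume x: "\<forall>n. x n \<in> {unipotent z ** \<gamma> |z \<gamma>. z \<in> C \<and> \<gamma> \<in> SL3_Z}" and l: "x \<longlonglongrightarrow> l"
  then have "\<forall>n. \<exists>z \<gamma>. x n = unipotent z ** \<gamma> \<and> z \<in> C \<and> \<gamma> \<in> SL3_Z" by auto
  then obtain z \<gamma> where z: "\<And>n. x n = unipotent (z n) ** \<gamma> n" "\<And>n. z n \<in> C" "\<And>n. \<gamma> n \<in> SL3_Z"
    by metis
  obtain a r where a: "a \<in> C" "strict_mono r" "(z \<circ> r) \<longlonglongrightarrow> a"
    using assms z(2) unfolding compact_def by metis
  have xr: "(x \<circ> r) \<longlonglongrightarrow> l" using l a(2) by (rule LIMSEQ_subseq_LIMSEQ)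
  have \<gamma>: "\<gamma> n = unipotent (- z n) ** x n" for n
    by (simp add: z(1) matrix_mul_assoc unipotent_add unipotent_0)
  let ?f = "\<lambda>x. unipotent (- fst x) ** (snd x :: real^3^3)"
  have "continuous_on UNIV ?f"
    by (intro continuous_on_matrix_mult continuous_on_compose2[OF continuous_on_unipotent[of UNIV]]
        continuous_intros) auto
  then have "isCont ?f (a, l)" using continuous_on_eq_continuous_at[OF open_UNIV] by blast
  from isCont_tendsto_compose[OF this tendsto_Pair[OF a(3) xr]]
  have "(\<lambda>n. unipotent (- z (r n)) ** x (r n)) \<longlonglongrightarrow> unipotent (- a) ** l"
    by simp
  then have "(\<lambda>n. \<gamma> (r n)) \<longlonglongrightarrow> unipotent (- a) ** l" by (simp add: \<gamma>)
  then have "unipotent (- a) ** l \<in> SL3_Z"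
    by (rule closed_sequentially[OF closed_SL3_Z z(3)])
  moreover have "l = unipotent a ** (unipotent (- a) ** l)"
    by (simp add: matrix_mul_assoc unipotent_add unipotent_0)
  ultimately show "l \<in> {unipotent z ** \<gamma> |z \<gamma>. z \<in> C \<and> \<gamma> \<in> SL3_Z}" using a(1) by blast
qed

lemma openin_torus_iff:
  assumes "W \<subseteq> torus"
  shows "openin (subtopology X3_topology torus) W \<longleftrightarrow> open (torus_point -` W)"
proof
  assume "openin (subtopology X3_topology torus) W"
  then obtain W' where W': "openin X3_topology W'" "W = W' \<inter> torus"
    by (auto simp: openin_subtopology)
  then have "openin (top_of_set SL3_R) {g \<in> SL3_R. coset g \<in> W'}" by (simp add: openin_X3_topology)
  then obtain O' where O': "open O'" "{g \<in> SL3_R. coset g \<in> W'} = SL3_R \<inter> O'"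
    by (auto simp: openin_open)
  have "torus_point -` W = unipotent -` O'"
  proof -
    have "torus_point z \<in> W \<longleftrightarrow> unipotent z \<in> O'" for z
    proof -
      have "unipotent z \<in> SL3_R" by (simp add: SL3_R_def det_unipotent)
      then show ?thesis using O'(2) W'(2) by (auto simp: torus_def torus_point_def)
    qed
    then show ?thesis by auto
  qed
  then show "open (torus_point -` W)" using O'(1) continuous_on_unipotent by (metis open_vimage)
next
  assume o: "open (torus_point -` W)"
  define C where "C = (- (torus_point -` W)) \<inter> cbox (0, 0) (1, 1)"
  have cC: "compact C" unfolding C_def using o by (intro closed_Int_compact) auto
  define F where "F = {unipotent z ** \<gamma> |z \<gamma>. z \<in> C \<and> \<gamma> \<in> SL3_Z}"
  have cF: "closed F" unfolding F_def by (rule closed_unipotent_mult_SL3_Z[OF cC])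
  define W' where "W' = X3 - (torus - W)"
  have "{g \<in> SL3_R. coset g \<in> W'} = SL3_R \<inter> - F"
  proof -
    have "coset g \<in> torus - W \<longleftrightarrow> g \<in> F" for g
    proof
      assume "coset g \<in> torus - W"
      then obtain z where z: "coset g = torus_point z" "torus_point z \<notin> W" by (auto simp: torus_def)
      define w where "w = (frac (fst z), frac (snd z))"
      have "z - w \<in> int_lattice"
        by (cases z) (simp add: w_def int_lattice_def frac_def)
      then have tw: "torus_point z = torus_point w" by (simp add: torus_point_eq_iff)
      have "w \<in> C" using z(2) tw
        by (auto simp: C_def w_def cbox_Pair_eq frac_ge_0 less_imp_le[OF frac_lt_1])
      moreover obtain \<gamma> where "\<gamma> \<in> SL3_Z" "g = unipotent w ** \<gamma>"
        using z(1) tw coset_eq_iff[of g "unipotent w"] by (auto simp: torus_point_def)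
      ultimately show "g \<in> F" unfolding F_def by blast
    next
      assume "g \<in> F"
      then obtain z \<gamma> where "g = unipotent z ** \<gamma>" "z \<in> C" "\<gamma> \<in> SL3_Z" by (auto simp: F_def)
      then have "coset g = torus_point z" "torus_point z \<notin> W"
        by (auto simp: torus_point_def coset_eq_iff C_def)
      then show "coset g \<in> torus - W" by (simp add: torus_def)
    qed
    then show ?thesis by (auto simp: W'_def X3_def)
  qed
  then have "openin (top_of_set SL3_R) {g \<in> SL3_R. coset g \<in> W'}"
    using cF by (metis openin_open_Int open_Compl)
  then have "openin X3_topology W'" by (simp add: openin_X3_topology W'_def)
  moreover have "W = W' \<inter> torus" using assms torus_subset_X3 by (auto simp: W'_def)
  ultimately show "openin (subtopology X3_topology torus) W" by (auto simp: openin_subtopology)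
qed

lemma topspace_torus: "topspace (subtopology X3_topology torus) = torus"
  using torus_subset_X3 by auto

lemma open_saturation:
  assumes "open V" shows "open (torus_point -` (torus_point ` V))"
proof -
  have "torus_point -` (torus_point ` V) = (\<Union>n\<in>int_lattice. (+) n ` V)"
  proof -
    have "torus_point z \<in> torus_point ` V \<longleftrightarrow> (\<exists>n\<in>int_lattice. z \<in> (+) n ` V)" for z
    proof
      assume "torus_point z \<in> torus_point ` V"
      then obtain v where "v \<in> V" "z - v \<in> int_lattice" by (auto simp: torus_point_eq_iff)
      then show "\<exists>n\<in>int_lattice. z \<in> (+) n ` V" by (intro bexI[of _ "z - v"] image_eqI[of _ _ v]) simp_all
    next
      assume "\<exists>n\<in>int_lattice. z \<in> (+) n ` V"
      then obtain n v where "n \<in> int_lattice" "v \<in> V" "z = n + v" by auto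
      then have "torus_point z = torus_point v" by (simp add: torus_point_eq_iff)
      then show "torus_point z \<in> torus_point ` V" using \<open>v \<in> V\<close> by simp
    qed
    then show ?thesis by (intro set_eqI) (simp only: vimage_eq UN_iff)
  qed
  moreover have "open ((+) n ` V)" for n using assms by (rule open_translation)
  ultimately show ?thesis by (simp add: open_UN)
qed

lemma openin_torus_image: "open V \<Longrightarrow> openin (subtopology X3_topology torus) (torus_point ` V)"
  by (subst openin_torus_iff) (auto simp: torus_def open_saturation)

lemma torus_chart_homeomorphic:
  assumes "open V" "inj_on torus_point V"
  shows "homeomorphic_map (subtopology (subtopology X3_topology torus) (torus_point ` V))
           (top_of_set V) (inv_into V torus_point)"
proof -
  let ?X = "subtopology (subtopology X3_topology torus) (torus_point ` V)"
  have top: "topspace ?X = torus_point ` V"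
    using openin_subset[OF openin_torus_image[OF assms(1)]] by auto
  have ctop: "continuous_map (top_of_set V) (subtopology X3_topology torus) torus_point"
    unfolding continuous_map_def
  proof (intro conjI allI impI)
    show "torus_point \<in> topspace (top_of_set V) \<rightarrow> topspace (subtopology X3_topology torus)"
      unfolding topspace_torus by (auto simp: torus_def)
    fix U assume U: "openin (subtopology X3_topology torus) U"
    then have "U \<subseteq> torus" using openin_subset topspace_torus by metis
    with U have "open (torus_point -` U)" by (simp add: openin_torus_iff)
    moreover have "{x \<in> topspace (top_of_set V). torus_point x \<in> U} = V \<inter> torus_point -` U" by auto
    ultimately show "openin (top_of_set V) {x \<in> topspace (top_of_set V). torus_point x \<in> U}"
      by (simp add: openin_open_Int)
  qed
  have "homeomorphic_map (top_of_set V) ?X torus_point"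
  proof (rule bijective_open_imp_homeomorphic_map)
    show "continuous_map (top_of_set V) ?X torus_point"
      using ctop by (simp add: continuous_map_in_subtopology)
    show "open_map (top_of_set V) ?X torus_point"
      unfolding open_map_def
    proof (intro allI impI)
      fix U assume "openin (top_of_set V) U"
      then have "open U" "U \<subseteq> V" using assms(1) by (auto simp: openin_open_eq)
      then show "openin ?X (torus_point ` U)"
        using openin_torus_image by (simp add: openin_open_subtopology[OF openin_torus_image[OF assms(1)]] image_mono)
    qed
  qed (use top assms(2) in auto)
  moreover have "homeomorphic_maps (top_of_set V) ?X torus_point (inv_into V torus_point)"
  proof -
    obtain g where g: "homeomorphic_maps (top_of_set V) ?X torus_point g"
      using \<open>homeomorphic_map (top_of_set V) ?X torus_point\<close> homeomorphic_map_maps by blast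
    then have "g y = inv_into V torus_point y" if "y \<in> topspace ?X" for y
      using that assms(2) unfolding top homeomorphic_maps_def by (auto simp: inv_into_f_f)
    from homeomorphic_maps_eq[OF g _ this] show ?thesis by simp
  qed
  ultimately show ?thesis using homeomorphic_maps_map by blast
qed

lemma C1_atlas_torus: "C1_atlas (subtopology X3_topology torus) torus_atlas"
proof -
  have im: "inv_into V torus_point ` (torus_point ` V) = V" if "inj_on torus_point V" for V
    using that by (force simp: inv_into_f_f)
  have cover: "\<exists>V. open V \<and> inj_on torus_point V \<and> z \<in> V" for z
  proof (intro exI[of _ "ball z (1/2)"] conjI)
    show "inj_on torus_point (ball z (1/2))"
    proof (rule inj_onI)
      fix u v assume uv: "u \<in> ball z (1/2)" "v \<in> ball z (1/2)" "torus_point u = torus_point v"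
      have "dist u v < 1" using uv dist_triangle_half_r[of z u 1 v] by auto
      then have n: "norm (u - v) < 1" by (simp add: dist_norm)
      have "u - v \<in> int_lattice" using uv(3) by (simp add: torus_point_eq_iff)
      then have i: "fst (u - v) \<in> \<int>" "snd (u - v) \<in> \<int>" by (auto simp: int_lattice_def mem_Times_iff)
      have "\<bar>fst (u - v)\<bar> < 1" "\<bar>snd (u - v)\<bar> < 1"
        using n norm_fst_le[of "fst (u - v)" "snd (u - v)"] norm_snd_le[of "snd (u - v)" "fst (u - v)"]
        by (simp_all only: prod.collapse real_norm_def)
      with i have "fst (u - v) = 0" "snd (u - v) = 0" using Ints_nonzero_abs_less1 by blast+
      then show "u = v" by (simp add: prod_eq_iff)
    qed
  qed auto
  have trans: "C1_map_on (inv_into V torus_point ` (torus_point ` V \<inter> torus_point ` V'))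
       (inv_into V' torus_point \<circ> inv_into (torus_point ` V) (inv_into V torus_point))"
    if V: "open V" "inj_on torus_point V" and V': "open V'" "inj_on torus_point V'" for V V'
  proof -
    let ?D = "inv_into V torus_point ` (torus_point ` V \<inter> torus_point ` V')"
    let ?f = "inv_into V' torus_point \<circ> inv_into (torus_point ` V) (inv_into V torus_point)"
    have inj: "inj_on (inv_into V torus_point) (torus_point ` V)" by (simp add: inj_on_inv_into)
    have fV: "?f z = inv_into V' torus_point (torus_point z)" if "z \<in> V" for z
      using that V(2) inv_into_f_f[OF inj, of "torus_point z"] by (simp add: inv_into_f_f)
    have D: "z \<in> V" "torus_point z \<in> torus_point ` V'" if zD: "z \<in> ?D" for z
    proof -
      obtain q where q: "z = inv_into V torus_point q" "q \<in> torus_point ` V \<inter> torus_point ` V'"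
        using zD by (rule imageE)
      then have q': "q \<in> torus_point ` V" "q \<in> torus_point ` V'" by simp_all
      show "z \<in> V" unfolding q(1) using q'(1) by (rule inv_into_into)
      show "torus_point z \<in> torus_point ` V'" unfolding q(1) f_inv_into_f[OF q'(1)] by (rule q'(2))
    qed
    have "(?f has_derivative blinfun_apply id_blinfun) (at z)" if "z \<in> ?D" for z
    proof -
      define n where "n = ?f z - z"
      have fz: "?f z \<in> V'" "torus_point (?f z) = torus_point z"
        unfolding fV[OF D(1)[OF that]]
        by (rule inv_into_into[OF D(2)[OF that]], rule f_inv_into_f[OF D(2)[OF that]])
      then have n: "n \<in> int_lattice" by (simp add: n_def torus_point_eq_iff)
      define O' where "O' = V \<inter> (\<lambda>w. w + n) -` V'"
      have oO: "open O'" unfolding O'_def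
        using V(1) V'(1) by (intro open_Int open_vimage continuous_intros)
      have zO: "z \<in> O'" using D[OF that] fz(1) by (simp add: O'_def n_def)
      have eq: "w + n = ?f w" if "w \<in> O'" for w
      proof -
        have "w \<in> V" "w + n \<in> V'" using that by (auto simp: O'_def)
        have "torus_point w = torus_point (w + n)"
          using n int_lattice_closed_ops(2) by (simp add: torus_point_eq_iff)
        then show ?thesis using fV[OF \<open>w \<in> V\<close>] inv_into_f_f[OF V'(2) \<open>w + n \<in> V'\<close>] by simp
      qed
      have "((\<lambda>w. w + n) has_derivative blinfun_apply id_blinfun) (at z)"
        by (auto intro!: derivative_eq_intros)
      then show ?thesis
        by (rule has_derivative_transform_within_open[OF _ oO zO eq])
    qed
    then show ?thesis unfolding C1_map_on_def by (intro exI[of _ "\<lambda>_. id_blinfun"]) auto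
  qed
  have a: "topspace (subtopology X3_topology torus) = (\<Union>(U, \<phi>)\<in>torus_atlas. U)"
  proof -
    have "(\<Union>(U, \<phi>)\<in>torus_atlas. U) = torus"
    proof
      show "(\<Union>(U, \<phi>)\<in>torus_atlas. U) \<subseteq> torus" by (auto simp: torus_atlas_def torus_def)
      show "torus \<subseteq> (\<Union>(U, \<phi>)\<in>torus_atlas. U)"
      proof
        fix p assume "p \<in> torus"
        then obtain z where z: "p = torus_point z" by (auto simp: torus_def)
        obtain V where V: "open V" "inj_on torus_point V" "z \<in> V" using cover by blast
        have "(torus_point ` V, inv_into V torus_point) \<in> torus_atlas"
          unfolding torus_atlas_def using V(1,2) by blast
        then show "p \<in> (\<Union>(U, \<phi>)\<in>torus_atlas. U)"
          by (rule UN_I) (simp add: z V(3))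
      qed
    qed
    then show ?thesis using topspace_torus by simp
  qed
  have b: "openin (subtopology X3_topology torus) U \<and> open (\<phi> ` U) \<and>
      homeomorphic_map (subtopology (subtopology X3_topology torus) U) (top_of_set (\<phi> ` U)) \<phi>"
    if U: "(U, \<phi>) \<in> torus_atlas" for U \<phi>
  proof -
    obtain V where V: "U = torus_point ` V" "\<phi> = inv_into V torus_point" "open V" "inj_on torus_point V"
      using U by (auto simp: torus_atlas_def)
    show ?thesis unfolding V(1,2) im[OF V(4)]
      using openin_torus_image torus_chart_homeomorphic V(3,4) by blast
  qed
  have c: "C1_map_on (\<phi> ` (U \<inter> U')) (\<psi> \<circ> inv_into U \<phi>)"
    if "(U, \<phi>) \<in> torus_atlas" "(U', \<psi>) \<in> torus_atlas" for U \<phi> U' \<psi>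
    using that trans by (auto simp: torus_atlas_def)
  show ?thesis unfolding C1_atlas_def
  proof (intro conjI)
    show "topspace (subtopology X3_topology torus) = (\<Union>(U, \<phi>)\<in>torus_atlas. U)" by (rule a)
  next
    show "\<forall>(U, \<phi>)\<in>torus_atlas. openin (subtopology X3_topology torus) U \<and> open (\<phi> ` U) \<and>
        homeomorphic_map (subtopology (subtopology X3_topology torus) U) (top_of_set (\<phi> ` U)) \<phi>"
      by (intro ballI case_prodI2) (simp only: b)
  next
    show "\<forall>(U, \<phi>)\<in>torus_atlas. \<forall>(V, \<psi>)\<in>torus_atlas.
        C1_map_on (\<phi> ` (U \<inter> V)) (\<psi> \<circ> inv_into U \<phi>)"
      by (intro ballI case_prodI2) (simp only: c)
  qed
qed


lemma torus_dist_le: "torus_dist (torus_point z) (torus_point w) \<le> dist z w"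
  unfolding torus_dist_def by (rule setdist_le_dist) auto

lemma torus_dist_less:
  assumes "torus_dist (torus_point z) (torus_point w) < e"
  obtains w' where "torus_point w' = torus_point w" "dist z w' < e"
proof -
  have "\<exists>u\<in>torus_point -` {torus_point z}. \<exists>v\<in>torus_point -` {torus_point w}. dist u v < e"
  proof (rule ccontr)
    assume "\<not> ?thesis"
    then have "e \<le> setdist (torus_point -` {torus_point z}) (torus_point -` {torus_point w})"
      by (intro le_setdistI) (auto simp: not_less)
    with assms show False by (simp add: torus_dist_def)
  qed
  then obtain u v where uv: "torus_point u = torus_point z" "torus_point v = torus_point w" "dist u v < e"
    by auto
  have "v + (z - u) - w = (v - w) - (u - z)" by simp
  also have "\<dots> \<in> int_lattice"
    using uv(1,2) unfolding torus_point_eq_iff by (rule int_lattice_closed_ops(4)[rotated])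
  finally have "torus_point (v + (z - u)) = torus_point w" by (simp only: torus_point_eq_iff)
  moreover have "dist z (v + (z - u)) = dist u v" by (simp add: dist_norm)
  ultimately show ?thesis using that uv(3) by metis
qed

lemma closed_torus_fibre: "closed (torus_point -` {torus_point w})"
proof -
  have "closed ((\<lambda>z. z - w) -` int_lattice)"
    unfolding int_lattice_def by (intro closed_vimage closed_Times closed_Ints continuous_intros)
  moreover have "torus_point -` {torus_point w} = (\<lambda>z. z - w) -` int_lattice"
    by (intro set_eqI) (simp add: torus_point_eq_iff)
  ultimately show ?thesis by simp
qed

lemma Metric_space_torus: "Metric_space torus torus_dist"
proof
  show "0 \<le> torus_dist p q" for p q unfolding torus_dist_def by (rule setdist_pos_le)
  show "torus_dist p q = torus_dist q p" for p q unfolding torus_dist_def by (rule setdist_sym)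
  show "torus_dist p q = 0 \<longleftrightarrow> p = q" if pq: "p \<in> torus" "q \<in> torus" for p q
  proof -
    obtain z w where zw: "p = torus_point z" "q = torus_point w" using pq by (auto simp: torus_def)
    show ?thesis
    proof
      assume 0: "torus_dist p q = 0"
      have "\<exists>w'\<in>torus_point -` {torus_point w}. dist w' z < e" if "e > 0" for e
      proof -
        have "torus_dist (torus_point z) (torus_point w) < e" using 0 that zw by simp
        then obtain w' where "torus_point w' = torus_point w" "dist z w' < e" by (rule torus_dist_less)
        then show ?thesis by (intro bexI[of _ w']) (simp_all add: dist_commute)
      qed
      then have "z \<in> torus_point -` {torus_point w}"
        using closed_approachable[OF closed_torus_fibre] by blast
      then show "p = q" by (simp add: zw)
    next
      assume "p = q"
      then show "torus_dist p q = 0"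
        using torus_dist_le[of z z] setdist_pos_le zw by (auto simp: torus_dist_def intro!: antisym)
    qed
  qed
  show "torus_dist p r \<le> torus_dist p q + torus_dist q r"
    if "p \<in> torus" "q \<in> torus" "r \<in> torus" for p q r
  proof (rule field_le_epsilon)
    fix e :: real assume e: "0 < e"
    obtain x y z where xyz: "p = torus_point x" "q = torus_point y" "r = torus_point z"
      using \<open>p \<in> torus\<close> \<open>q \<in> torus\<close> \<open>r \<in> torus\<close> by (auto simp: torus_def)
    obtain y' where y': "torus_point y' = torus_point y" "dist x y' < torus_dist p q + e / 2"
      using torus_dist_less[of x y "torus_dist p q + e / 2"] e xyz by auto
    obtain z' where z': "torus_point z' = torus_point z" "dist y' z' < torus_dist q r + e / 2"
      using torus_dist_less[of y' z "torus_dist q r + e / 2"] e xyz y'(1) by auto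
    have "torus_dist p r \<le> dist x z'" using torus_dist_le[of x z'] xyz z'(1) by simp
    also have "\<dots> \<le> dist x y' + dist y' z'" by (rule dist_triangle)
    finally show "torus_dist p r \<le> torus_dist p q + torus_dist q r + e" using y'(2) z'(2) by linarith
  qed
qed

lemma mtopology_torus: "Metric_space.mtopology torus torus_dist = subtopology X3_topology torus"
proof -
  interpret Metric_space torus torus_dist by (rule Metric_space_torus)
  have "openin mtopology W \<longleftrightarrow> openin (subtopology X3_topology torus) W" if W: "W \<subseteq> torus" for W
  proof -
    have mb: "mball (torus_point z) r \<subseteq> W \<longleftrightarrow> ball z r \<subseteq> torus_point -` W" for z r
    proof
      assume m: "mball (torus_point z) r \<subseteq> W"
      show "ball z r \<subseteq> torus_point -` W"
      proof
        fix w assume "w \<in> ball z r"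
        then have "torus_point w \<in> mball (torus_point z) r"
          using torus_dist_le[of z w] unfolding mball_def by (simp add: torus_def)
        then show "w \<in> torus_point -` W" using m by auto
      qed
    next
      assume b: "ball z r \<subseteq> torus_point -` W"
      show "mball (torus_point z) r \<subseteq> W"
      proof
        fix q assume "q \<in> mball (torus_point z) r"
        then have "q \<in> torus" "torus_dist (torus_point z) q < r" by (simp_all add: mball_def)
        then obtain w where w: "q = torus_point w" "torus_dist (torus_point z) (torus_point w) < r"
          unfolding torus_def by blast
        obtain w' where "torus_point w' = torus_point w" "dist z w' < r"
          using w(2) by (rule torus_dist_less)
        then show "q \<in> W" using b w(1) by (metis mem_ball subsetD vimageD)
      qed
    qed
    have "openin mtopology W \<longleftrightarrow> (\<forall>z. torus_point z \<in> W \<longrightarrow> (\<exists>r>0. mball (torus_point z) r \<subseteq> W))"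
      unfolding openin_mtopology
    proof
      assume "W \<subseteq> torus \<and> (\<forall>x. x \<in> W \<longrightarrow> (\<exists>r>0. mball x r \<subseteq> W))"
      then show "\<forall>z. torus_point z \<in> W \<longrightarrow> (\<exists>r>0. mball (torus_point z) r \<subseteq> W)" by simp
    next
      assume r: "\<forall>z. torus_point z \<in> W \<longrightarrow> (\<exists>r>0. mball (torus_point z) r \<subseteq> W)"
      have "\<exists>r>0. mball x r \<subseteq> W" if x: "x \<in> W" for x
      proof -
        have "x \<in> range torus_point" using x W unfolding torus_def by (rule subsetD[rotated])
        then obtain z where z: "x = torus_point z" by (rule rangeE)
        show ?thesis using r x unfolding z by (simp only:)
      qed
      then show "W \<subseteq> torus \<and> (\<forall>x. x \<in> W \<longrightarrow> (\<exists>r>0. mball x r \<subseteq> W))" using W by simp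
    qed
    also have "\<dots> \<longleftrightarrow> open (torus_point -` W)"
      unfolding mb open_contains_ball Ball_def by (simp only: vimage_eq)
    finally show ?thesis using openin_torus_iff[OF W] by simp
  qed
  then show ?thesis
    by (metis openin_subset topology_eq topspace_mtopology topspace_torus)
qed

end

theory Submission
  imports Defs
begin

text \<open>
  Put \<open>Q = exp T\<close>. By Mahler's criterion the fibre of the orbit of \<open>torus_point (x, y)\<close> over \<open>T\<close> stays in a
  fixed compact set unless, for some \<open>a, b \<ge> 1\<close> with \<open>a b = Q\<close>, there is a rational point \<open>(p/q, r/q)\<close>
  with \<open>q < \<epsilon> Q\<close>, \<open>\<bar>q x - p\<bar> < \<epsilon>/a\<close> and \<open>\<bar>q y - r\<bar> < \<epsilon>/b\<close>. Hence it suffices that Alice avoids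
  these boxes for a sequence of values \<open>Q\<close> tending to infinity, with the same \<open>\<epsilon>\<close>.

  The pigeonhole principle puts such a rational point on a line \<open>A X + B Y + C = 0\<close> with \<open>\<bar>A\<bar> \<le> \<mu> a\<close> and
  \<open>\<bar>B\<bar> \<le> \<mu> b\<close>, where \<open>\<mu>\<^sup>2 Q\<close> is about \<open>q\<close>. Group the boxes by the dyadic sizes of \<open>q\<close> and of
  \<open>max \<bar>A\<bar> \<bar>B\<bar>\<close>. In a ball of radius \<open>\<tau>\<close>, a small multiple of \<open>1 / (q max \<bar>A\<bar> \<bar>B\<bar>)\<close>, all the points of
  one group lie on a single line, so their boxes lie in a strip whose width is at most a multiple of
  \<open>\<epsilon> \<mu> \<tau>\<close>. Since \<open>\<mu>\<close> decays geometrically as \<open>q\<close> decreases, the sum of the powers (width)\<open>\<^sup>\<gamma>\<close> over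
  all groups of scale comparable to \<open>\<tau>\<close> is at most a small multiple of \<open>\<tau>\<^sup>\<gamma>\<close>.

  Alice keeps the sum of (width)\<open>\<^sup>\<gamma>\<close> over the active strips that meet Bob's ball below a small multiple of
  (radius)\<open>\<^sup>\<gamma>\<close>: some strip, removed with its \<open>\<beta>\<close>-neighbourhood, forces Bob to lose a fixed proportion
  of this sum, which for small \<open>\<gamma>\<close> outweighs the decrease of the radius. When the radius has become
  small enough, no strip for the current \<open>Q\<close> is left, and she passes to a much larger \<open>Q\<close>.
\<close>

section \<open>The potential of a family of obstacles\<close>

lemma affine_hyperplane_closed: "affine_hyperplane L \<Longrightarrow> closed L"
  by (auto simp: affine_hyperplane_def closed_hyperplane)

lemma affine_hyperplane_nonempty: "affine_hyperplane L \<Longrightarrow> L \<noteq> {}"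
proof -
  assume "affine_hyperplane L"
  then obtain a b where "a \<noteq> 0" "L = {z. a \<bullet> z = b}" by (auto simp: affine_hyperplane_def)
  then have "(b / (a \<bullet> a)) *\<^sub>R a \<in> L" by simp
  then show ?thesis by blast
qed

lemma ex_affine_hyperplane: "\<exists>L::'a::euclidean_space set. affine_hyperplane L"
proof -
  obtain a :: 'a where "a \<in> Basis" using nonempty_Basis by blast
  then have "a \<noteq> 0" by auto
  then show ?thesis unfolding affine_hyperplane_def by blast
qed

lemma cball_disjoint_hyperplane_nbhd:
  fixes L :: "'a::euclidean_space set"
  assumes "affine_hyperplane L" "0 \<le> s" "0 \<le> r"
  shows "cball c s \<inter> hyperplane_nbhd L r = {} \<longleftrightarrow> s + r < infdist c L"
proof
  have ne: "L \<noteq> {}" and cl: "closed L"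
    using assms(1) affine_hyperplane_nonempty affine_hyperplane_closed by auto
  assume dis: "cball c s \<inter> hyperplane_nbhd L r = {}"
  show "s + r < infdist c L"
  proof (rule ccontr)
    assume neg: "\<not> s + r < infdist c L"
    obtain l where l: "l \<in> L" "infdist c L = dist c l"
      using infdist_attains_inf[OF cl ne] by metis
    define d where "d = dist c l"
    \<comment> \<open>The point at distance \<open>min d s\<close> from \<open>c\<close> on the
      segment towards \<open>l\<close>, a nearest point of \<open>L\<close>: it lies in the ball and
      is as near to \<open>L\<close> as the ball allows.\<close>
    define y where "y = (if d \<le> s then l else c + (s / d) *\<^sub>R (l - c))"
    have d0: "0 \<le> d" by (simp add: d_def)
    have nd: "norm (l - c) = d" by (simp add: d_def dist_norm norm_minus_commute)
    have "dist c y \<le> s"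
    proof (cases "d \<le> s")
      case True
      then show ?thesis by (simp add: y_def d_def)
    next
      case False
      then show ?thesis using assms(2) d0 nd by (simp add: y_def dist_norm)
    qed
    moreover have "dist y l \<le> r"
    proof (cases "d \<le> s")
      case False
      have "y - l = (s / d - 1) *\<^sub>R (l - c)" using False by (simp add: y_def algebra_simps)
      then have "dist y l = \<bar>s / d - 1\<bar> * d" using nd by (simp add: dist_norm)
      also have "\<dots> = d - s" using False assms(2) d0 by (auto simp: abs_if field_simps)
      finally show ?thesis using neg l d_def by linarith
    qed (use assms(3) y_def in auto)
    then have "infdist y L \<le> r" using infdist_le[OF l(1), of y] by linarith
    ultimately have "y \<in> cball c s \<inter> hyperplane_nbhd L r" by (simp add: hyperplane_nbhd_def)
    then show False using dis by blast
  qed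
next
  assume far: "s + r < infdist c L"
  have "\<not> infdist y L \<le> r" if "dist c y \<le> s" for y
    using infdist_triangle[of c L y] far that by linarith
  then show "cball c s \<inter> hyperplane_nbhd L r = {}"
    by (auto simp: hyperplane_nbhd_def)
qed

text \<open>If every hyperplane were a poor choice for Alice, then two poor choices of comparable weight
  would be refuted by nearly the same ball of Bob; the finitely many positions of such a ball, up to
  a small error, provide the number \<open>N\<close>.\<close>

lemma hyperplane_pigeonhole:
  fixes \<beta> :: real
  assumes "0 < \<beta>"
  shows "\<exists>N::nat. (1::nat) \<le> N \<and> (\<forall>(c::'a::euclidean_space) \<rho> (K::'k set) w L r.
      0 < \<rho> \<and> finite K \<and> K \<noteq> {} \<and>
      (\<forall>\<kappa>\<in>K. 0 \<le> w \<kappa> \<and> affine_hyperplane (L \<kappa>) \<and> 0 \<le> r \<kappa> \<and> r \<kappa> \<le> \<beta> / 2 * \<rho>) \<longrightarrow>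
      (\<exists>\<kappa>0\<in>K. \<forall>c' \<rho>'. 0 \<le> \<rho>' \<and> cball c' \<rho>' \<subseteq> cball c \<rho> - hyperplane_nbhd (L \<kappa>0) (\<beta> * \<rho>) \<longrightarrow>
         sum w K / N \<le> sum w {\<kappa>\<in>K. cball c' \<rho>' \<inter> hyperplane_nbhd (L \<kappa>) (r \<kappa>) = {}}))"
proof -
  \<comment> \<open>The centre (relative to \<open>c\<close>) and the radius of a subball of
    \<open>cball c \<rho>\<close>, divided by \<open>\<rho>\<close>, range over this compact set.
    The number \<open>N\<close> is the size of a net of mesh \<open>\<beta> / 8\<close> in it, hence
    independent of the family \<open>K\<close>.\<close>
  have "compact (cball (0::'a) 1 \<times> {0..1::real})" by (intro compact_Times) auto
  moreover have "0 < \<beta> / 8" using assms by simp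
  ultimately obtain F where F: "finite F" "cball (0::'a) 1 \<times> {0..1::real} \<subseteq> (\<Union>x\<in>F. ball x (\<beta> / 8))"
    unfolding compact_eq_totally_bounded by meson
  have "F \<noteq> {}" using F(2) by force
  then have N: "1 \<le> card F" using F(1) by (simp add: Suc_leI card_gt_0_iff)
  show ?thesis
  proof (intro exI[of _ "card F"] conjI N allI impI, rule ccontr)
    fix c :: 'a and \<rho> and K :: "'k set" and w :: "'k \<Rightarrow> real" and L :: "'k \<Rightarrow> 'a set" and r
    assume "0 < \<rho> \<and> finite K \<and> K \<noteq> {} \<and>
      (\<forall>\<kappa>\<in>K. 0 \<le> w \<kappa> \<and> affine_hyperplane (L \<kappa>) \<and> 0 \<le> r \<kappa> \<and> r \<kappa> \<le> \<beta> / 2 * \<rho>)"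
    then have \<rho>: "0 < \<rho>" and K: "finite K" "K \<noteq> {}"
      and hyp: "\<And>\<kappa>. \<kappa> \<in> K \<Longrightarrow> 0 \<le> w \<kappa> \<and> affine_hyperplane (L \<kappa>) \<and> 0 \<le> r \<kappa> \<and> r \<kappa> \<le> \<beta> / 2 * \<rho>"
      by auto
    let ?miss = "\<lambda>c' \<rho>'. {\<kappa>\<in>K. cball c' \<rho>' \<inter> hyperplane_nbhd (L \<kappa>) (r \<kappa>) = {}}"
    assume neg: "\<not> (\<exists>\<kappa>0\<in>K. \<forall>c' \<rho>'.
         0 \<le> \<rho>' \<and> cball c' \<rho>' \<subseteq> cball c \<rho> - hyperplane_nbhd (L \<kappa>0) (\<beta> * \<rho>) \<longrightarrow>
         sum w K / card F \<le> sum w (?miss c' \<rho>'))"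
    \<comment> \<open>Each hyperplane is refuted by a ball that respects it but misses too little
      weight.\<close>
    have ex: "\<forall>\<kappa>\<in>K. \<exists>p. 0 \<le> snd p \<and>
         cball (fst p) (snd p) \<subseteq> cball c \<rho> - hyperplane_nbhd (L \<kappa>) (\<beta> * \<rho>) \<and>
         sum w (?miss (fst p) (snd p)) < sum w K / card F"
    proof
      fix \<kappa> assume \<kappa>: "\<kappa> \<in> K"
      show "\<exists>p. 0 \<le> snd p \<and>
         cball (fst p) (snd p) \<subseteq> cball c \<rho> - hyperplane_nbhd (L \<kappa>) (\<beta> * \<rho>) \<and>
         sum w (?miss (fst p) (snd p)) < sum w K / card F"
      proof (rule ccontr)
        assume no: "\<not> ?thesis"
        have "\<forall>c' \<rho>'. 0 \<le> \<rho>' \<and> cball c' \<rho>' \<subseteq> cball c \<rho> - hyperplane_nbhd (L \<kappa>) (\<beta> * \<rho>) \<longrightarrow>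
            sum w K / card F \<le> sum w (?miss c' \<rho>')"
        proof (intro allI impI, rule ccontr)
          fix c' \<rho>'
          assume "0 \<le> \<rho>' \<and> cball c' \<rho>' \<subseteq> cball c \<rho> - hyperplane_nbhd (L \<kappa>) (\<beta> * \<rho>)"
            and "\<not> sum w K / card F \<le> sum w (?miss c' \<rho>')"
          then show False using no unfolding not_le by (auto dest: spec[of _ "(c', \<rho>')"])
        qed
        then show False using neg \<kappa> by blast
      qed
    qed
    obtain f where f: "\<forall>\<kappa>\<in>K. 0 \<le> snd (f \<kappa>) \<and>
         cball (fst (f \<kappa>)) (snd (f \<kappa>)) \<subseteq> cball c \<rho> - hyperplane_nbhd (L \<kappa>) (\<beta> * \<rho>) \<and>
         sum w (?miss (fst (f \<kappa>)) (snd (f \<kappa>))) < sum w K / card F"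
      using bchoice[OF ex] by (elim exE)
    define cc where "cc \<kappa> = fst (f \<kappa>)" for \<kappa>
    define rr where "rr \<kappa> = snd (f \<kappa>)" for \<kappa>
    have cr: "0 \<le> rr \<kappa>" "cball (cc \<kappa>) (rr \<kappa>) \<subseteq> cball c \<rho> - hyperplane_nbhd (L \<kappa>) (\<beta> * \<rho>)"
        "sum w (?miss (cc \<kappa>) (rr \<kappa>)) < sum w K / card F" if "\<kappa> \<in> K" for \<kappa>
      unfolding cc_def rr_def by (simp_all only: bspec[OF f that])
    define u where "u \<kappa> = ((1 / \<rho>) *\<^sub>R (cc \<kappa> - c), rr \<kappa> / \<rho>)" for \<kappa>
    have "\<exists>f\<in>F. dist f (u \<kappa>) < \<beta> / 8" if "\<kappa> \<in> K" for \<kappa>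
    proof -
      have sub: "cball (cc \<kappa>) (rr \<kappa>) \<subseteq> cball c \<rho>" using cr(2)[OF that] by blast
      then have "dist (cc \<kappa>) c + rr \<kappa> \<le> \<rho>"
        using cr(1)[OF that] by (simp add: cball_subset_cball_iff)
      moreover have "0 \<le> dist (cc \<kappa>) c" by simp
      ultimately have 1: "norm (cc \<kappa> - c) \<le> \<rho>" "rr \<kappa> \<le> \<rho>"
        using cr(1)[OF that] norm_ge_zero[of "cc \<kappa> - c"] unfolding dist_norm by linarith+
      have "norm ((1 / \<rho>) *\<^sub>R (cc \<kappa> - c)) \<le> 1" using 1 \<rho> by (simp add: divide_simps)
      then have "u \<kappa> \<in> cball 0 1 \<times> {0..1}"
        using 1(2) \<rho> cr(1)[OF that] by (auto simp: u_def)
      then show ?thesis using F(2) by (meson UN_E mem_ball subsetD)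
    qed
    then obtain g where g: "\<And>\<kappa>. \<kappa> \<in> K \<Longrightarrow> g \<kappa> \<in> F \<and> dist (g \<kappa>) (u \<kappa>) < \<beta> / 8" by metis
    have W: "0 < sum w K / card F"
    proof -
      obtain \<kappa> where "\<kappa> \<in> K" using K(2) by blast
      have "0 \<le> sum w (?miss (cc \<kappa>) (rr \<kappa>))" using hyp by (intro sum_nonneg) auto
      then show ?thesis using cr(3)[OF \<open>\<kappa> \<in> K\<close>] by linarith
    qed
    \<comment> \<open>Weighted pigeonhole over the net points to which the refuting balls are
      assigned.\<close>
    have "\<exists>f\<in>F. sum w K / card F \<le> sum w {\<kappa>\<in>K. g \<kappa> = f}"
    proof (rule ccontr)
      assume "\<not> ?thesis"
      then have "(\<Sum>f\<in>F. sum w {\<kappa>\<in>K. g \<kappa> = f}) < (\<Sum>f\<in>F. sum w K / card F)"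
        using F(1) \<open>F \<noteq> {}\<close> by (intro sum_strict_mono) (auto simp: not_le)
      also have "\<dots> = sum w K" using N by simp
      also have "(\<Sum>f\<in>F. sum w {\<kappa>\<in>K. g \<kappa> = f}) = sum w K"
        using g K(1) F(1) by (intro sum.group) auto
      finally show False by simp
    qed
    then obtain f where f: "sum w K / card F \<le> sum w {\<kappa>\<in>K. g \<kappa> = f}" by blast
    have "{\<kappa>\<in>K. g \<kappa> = f} \<noteq> {}" using f W by (metis not_le sum.empty)
    then obtain \<kappa>0 where \<kappa>0: "\<kappa>0 \<in> K" "g \<kappa>0 = f" by blast
    \<comment> \<open>The refuting ball of \<open>\<kappa>\<close> has distance more than
      \<open>\<beta> * \<rho>\<close> from \<open>L \<kappa>\<close>. Replacing it by that of
      \<open>\<kappa>0\<close> costs at most \<open>\<beta> * \<rho> / 4\<close> for the centre and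
      as much for the radius, and the remaining \<open>\<beta> / 2 * \<rho>\<close> is at least
      \<open>r \<kappa>\<close>. So the ball of \<open>\<kappa>0\<close> misses too much weight for
      a refutation.\<close>
    have "{\<kappa>\<in>K. g \<kappa> = f} \<subseteq> ?miss (cc \<kappa>0) (rr \<kappa>0)"
    proof (clarify)
      fix \<kappa> assume \<kappa>: "\<kappa> \<in> K" "f = g \<kappa>"
      have "cball (cc \<kappa>) (rr \<kappa>) \<inter> hyperplane_nbhd (L \<kappa>) (\<beta> * \<rho>) = {}"
        using cr(2)[OF \<kappa>(1)] by blast
      then have inf: "rr \<kappa> + \<beta> * \<rho> < infdist (cc \<kappa>) (L \<kappa>)"
        using cball_disjoint_hyperplane_nbhd cr(1)[OF \<kappa>(1)] hyp[OF \<kappa>(1)] assms \<rho> by (metis less_eq_real_def mult_pos_pos)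
      have uu: "dist (u \<kappa>) (u \<kappa>0) < \<beta> / 4"
        using dist_triangle3[of "u \<kappa>" "u \<kappa>0" f] g[OF \<kappa>(1)] g[OF \<kappa>0(1)] \<kappa> \<kappa>0 by auto
      have "dist (fst (u \<kappa>)) (fst (u \<kappa>0)) < \<beta> / 4" using dist_fst_le[of "u \<kappa>" "u \<kappa>0"] uu by linarith
      moreover have "fst (u \<kappa>) - fst (u \<kappa>0) = (1 / \<rho>) *\<^sub>R (cc \<kappa> - cc \<kappa>0)"
        by (simp add: u_def scaleR_diff_right)
      ultimately have "norm (cc \<kappa> - cc \<kappa>0) / \<rho> < \<beta> / 4"
        using \<rho> by (simp add: dist_norm)
      then have d1: "dist (cc \<kappa>) (cc \<kappa>0) < \<beta> * \<rho> / 4" using \<rho> by (simp add: field_simps dist_norm)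
      have "dist (snd (u \<kappa>)) (snd (u \<kappa>0)) < \<beta> / 4" using dist_snd_le[of "u \<kappa>" "u \<kappa>0"] uu by linarith
      moreover have "snd (u \<kappa>) - snd (u \<kappa>0) = (rr \<kappa> - rr \<kappa>0) / \<rho>"
        by (simp add: u_def diff_divide_distrib)
      ultimately have "\<bar>rr \<kappa> - rr \<kappa>0\<bar> / \<rho> < \<beta> / 4" using \<rho> by (simp add: dist_real_def)
      then have d2: "\<bar>rr \<kappa> - rr \<kappa>0\<bar> < \<beta> * \<rho> / 4" using \<rho> by (simp add: field_simps)
      have "infdist (cc \<kappa>) (L \<kappa>) \<le> infdist (cc \<kappa>0) (L \<kappa>) + dist (cc \<kappa>) (cc \<kappa>0)"
        by (rule infdist_triangle)
      then have "rr \<kappa>0 + r \<kappa> < infdist (cc \<kappa>0) (L \<kappa>)"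
        using inf d1 d2 hyp[OF \<kappa>(1)] by (auto simp: abs_if split: if_splits)
      then show "cball (cc \<kappa>0) (rr \<kappa>0) \<inter> hyperplane_nbhd (L \<kappa>) (r \<kappa>) = {}"
        using cball_disjoint_hyperplane_nbhd cr(1)[OF \<kappa>0(1)] hyp[OF \<kappa>(1)] by metis
    qed
    then have "sum w {\<kappa>\<in>K. g \<kappa> = f} \<le> sum w (?miss (cc \<kappa>0) (rr \<kappa>0))"
      using K(1) hyp by (intro sum_mono2) auto
    then show False using f cr(3)[OF \<kappa>0(1)] by linarith
  qed
qed

section \<open>The potential and its decrease in one round\<close>

text \<open>An obstacle becomes active only once the radius has dropped to its scale
  \<open>\<tau> \<kappa>\<close>, since only then is its trace on the ball known to lie in a single
  strip.\<close>

definition hit_obstacles ::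
  "('k \<Rightarrow> 'a::euclidean_space set) \<Rightarrow> ('k \<Rightarrow> real) \<Rightarrow> 'k set \<Rightarrow> 'a \<Rightarrow> real \<Rightarrow> 'k set" where
  "hit_obstacles Ob \<tau> K c \<rho> = {\<kappa>\<in>K. \<rho> \<le> \<tau> \<kappa> \<and> Ob \<kappa> \<inter> cball c \<rho> \<noteq> {}}"

definition potential ::
  "real \<Rightarrow> ('k \<Rightarrow> 'a::euclidean_space set) \<Rightarrow> ('k \<Rightarrow> real) \<Rightarrow> ('k \<Rightarrow> real) \<Rightarrow> 'k set \<Rightarrow> 'a \<Rightarrow> real \<Rightarrow> real"
  where "potential \<gamma> Ob \<tau> r K c \<rho> = (\<Sum>\<kappa>\<in>hit_obstacles Ob \<tau> K c \<rho>. r \<kappa> powr \<gamma>)"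

text \<open>An obstacle \<open>\<kappa>\<close> need only look like a thickened hyperplane inside balls of radius at most \<open>\<tau> \<kappa>\<close>.\<close>

definition obstacle_family ::
  "('k \<Rightarrow> 'a::euclidean_space set) \<Rightarrow> ('k \<Rightarrow> real) \<Rightarrow> ('k \<Rightarrow> real) \<Rightarrow> 'k set \<Rightarrow> bool" where
  "obstacle_family Ob \<tau> r K \<longleftrightarrow> finite K \<and>
     (\<forall>\<kappa>\<in>K. 0 < r \<kappa> \<and> 0 < \<tau> \<kappa> \<and>
        (\<forall>c \<rho>. 0 < \<rho> \<and> \<rho> \<le> \<tau> \<kappa> \<longrightarrow>
           (\<exists>L. affine_hyperplane L \<and> Ob \<kappa> \<inter> cball c \<rho> \<subseteq> hyperplane_nbhd L (r \<kappa>))))"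

lemma powr_le_cancel: "a powr g \<le> b powr g \<Longrightarrow> 0 < g \<Longrightarrow> 0 \<le> a \<Longrightarrow> 0 \<le> b \<Longrightarrow> a \<le> (b::real)"
  by (meson leD linorder_not_le powr_less_mono2)

text \<open>The assumed bound on the whole potential bounds each summand, so every active strip has
  half width at most \<open>\<beta> / 2 * \<rho>\<close>, as \<open>hyperplane_pigeonhole\<close>
  requires. The hyperplane found there makes Bob lose the proportion \<open>1 / N\<close> of the
  weight.\<close>

lemma potential_decrease:
  fixes \<beta> :: real
  assumes "0 < \<beta>"
  shows "\<exists>N::nat. (1::nat) \<le> N \<and> (\<forall>(Ob :: 'k \<Rightarrow> 'a::euclidean_space set) \<tau> r K c \<rho> \<gamma>.
      obstacle_family Ob \<tau> r K \<and> 0 < \<rho> \<and> 0 < \<gamma> \<and>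
        potential \<gamma> Ob \<tau> r K c \<rho> \<le> (\<beta> / 2 * \<rho>) powr \<gamma> \<longrightarrow>
      (\<exists>L. affine_hyperplane L \<and> (\<forall>c' \<rho>'. 0 < \<rho>' \<and>
         cball c' \<rho>' \<subseteq> cball c \<rho> - hyperplane_nbhd L (\<beta> * \<rho>) \<longrightarrow>
         (\<Sum>\<kappa> | \<kappa> \<in> hit_obstacles Ob \<tau> K c \<rho> \<and> Ob \<kappa> \<inter> cball c' \<rho>' \<noteq> {}. r \<kappa> powr \<gamma>)
           \<le> (1 - 1 / N) * potential \<gamma> Ob \<tau> r K c \<rho>)))"
proof -
  obtain N :: nat where N: "(1::nat) \<le> N" and pig: "\<forall>(c::'a::euclidean_space) \<rho> (K::'k set) w L r.
      0 < \<rho> \<and> finite K \<and> K \<noteq> {} \<and>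
      (\<forall>\<kappa>\<in>K. 0 \<le> w \<kappa> \<and> affine_hyperplane (L \<kappa>) \<and> 0 \<le> r \<kappa> \<and> r \<kappa> \<le> \<beta> / 2 * \<rho>) \<longrightarrow>
      (\<exists>\<kappa>0\<in>K. \<forall>c' \<rho>'. 0 \<le> \<rho>' \<and> cball c' \<rho>' \<subseteq> cball c \<rho> - hyperplane_nbhd (L \<kappa>0) (\<beta> * \<rho>) \<longrightarrow>
         sum w K / real N \<le> sum w {\<kappa>\<in>K. cball c' \<rho>' \<inter> hyperplane_nbhd (L \<kappa>) (r \<kappa>) = {}})"
    using hyperplane_pigeonhole[OF assms] by (elim exE conjE)
  show ?thesis
  proof (intro exI[of _ N] conjI N allI impI)
    fix Ob :: "'k \<Rightarrow> 'a set" and \<tau> r K c and \<rho> \<gamma> :: real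
    assume "obstacle_family Ob \<tau> r K \<and> 0 < \<rho> \<and> 0 < \<gamma> \<and>
        potential \<gamma> Ob \<tau> r K c \<rho> \<le> (\<beta> / 2 * \<rho>) powr \<gamma>"
    then have fam: "obstacle_family Ob \<tau> r K" and \<rho>: "0 < \<rho>" and \<gamma>: "0 < \<gamma>"
      and pot: "potential \<gamma> Ob \<tau> r K c \<rho> \<le> (\<beta> / 2 * \<rho>) powr \<gamma>" by auto
    let ?H = "hit_obstacles Ob \<tau> K c \<rho>"
    let ?w = "\<lambda>\<kappa>. r \<kappa> powr \<gamma>"
    have finH: "finite ?H" using fam by (auto simp: hit_obstacles_def obstacle_family_def)
    show "\<exists>L. affine_hyperplane L \<and> (\<forall>c' \<rho>'. 0 < \<rho>' \<and>
         cball c' \<rho>' \<subseteq> cball c \<rho> - hyperplane_nbhd L (\<beta> * \<rho>) \<longrightarrow>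
         (\<Sum>\<kappa> | \<kappa> \<in> ?H \<and> Ob \<kappa> \<inter> cball c' \<rho>' \<noteq> {}. ?w \<kappa>)
           \<le> (1 - 1 / N) * potential \<gamma> Ob \<tau> r K c \<rho>)"
    proof (cases "?H = {}")
      case True
      obtain L :: "'a set" where "affine_hyperplane L" using ex_affine_hyperplane by blast
      then show ?thesis by (intro exI[of _ L]) (simp add: True potential_def)
    next
      case False
      have "\<exists>L. affine_hyperplane L \<and> Ob \<kappa> \<inter> cball c \<rho> \<subseteq> hyperplane_nbhd L (r \<kappa>)" if "\<kappa> \<in> ?H" for \<kappa>
        using fam that \<rho> by (auto simp: hit_obstacles_def obstacle_family_def)
      then obtain L where L: "\<And>\<kappa>. \<kappa> \<in> ?H \<Longrightarrow> affine_hyperplane (L \<kappa>)"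
          "\<And>\<kappa>. \<kappa> \<in> ?H \<Longrightarrow> Ob \<kappa> \<inter> cball c \<rho> \<subseteq> hyperplane_nbhd (L \<kappa>) (r \<kappa>)"
        by metis
      have r: "0 \<le> r \<kappa>" "r \<kappa> \<le> \<beta> / 2 * \<rho>" if "\<kappa> \<in> ?H" for \<kappa>
      proof -
        show "0 \<le> r \<kappa>" using fam that by (auto simp: hit_obstacles_def obstacle_family_def)
        have "r \<kappa> powr \<gamma> \<le> potential \<gamma> Ob \<tau> r K c \<rho>"
          unfolding potential_def using that finH by (intro member_le_sum) auto
        then show "r \<kappa> \<le> \<beta> / 2 * \<rho>"
          using powr_le_cancel[of "r \<kappa>" \<gamma> "\<beta> / 2 * \<rho>"] pot \<gamma> \<rho> assms \<open>0 \<le> r \<kappa>\<close> by auto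
      qed
      have "\<exists>\<kappa>0\<in>?H. \<forall>c' \<rho>'. 0 \<le> \<rho>' \<and>
          cball c' \<rho>' \<subseteq> cball c \<rho> - hyperplane_nbhd (L \<kappa>0) (\<beta> * \<rho>) \<longrightarrow>
         sum ?w ?H / N \<le> sum ?w {\<kappa>\<in>?H. cball c' \<rho>' \<inter> hyperplane_nbhd (L \<kappa>) (r \<kappa>) = {}}"
        by (rule pig[rule_format]) (use \<rho> finH False L(1) r in auto)
      then obtain \<kappa>0 where \<kappa>0: "\<kappa>0 \<in> ?H" "\<And>c' \<rho>'. 0 \<le> \<rho>' \<and>
          cball c' \<rho>' \<subseteq> cball c \<rho> - hyperplane_nbhd (L \<kappa>0) (\<beta> * \<rho>) \<Longrightarrow>
         sum ?w ?H / N \<le> sum ?w {\<kappa>\<in>?H. cball c' \<rho>' \<inter> hyperplane_nbhd (L \<kappa>) (r \<kappa>) = {}}"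
        by (elim bexE) auto
      show ?thesis
      proof (intro exI[of _ "L \<kappa>0"] conjI allI impI L(1)[OF \<kappa>0(1)])
        fix c' \<rho>'
        assume a: "0 < \<rho>' \<and> cball c' \<rho>' \<subseteq> cball c \<rho> - hyperplane_nbhd (L \<kappa>0) (\<beta> * \<rho>)"
        let ?M = "{\<kappa>\<in>?H. cball c' \<rho>' \<inter> hyperplane_nbhd (L \<kappa>) (r \<kappa>) = {}}"
        have "{\<kappa>. \<kappa> \<in> ?H \<and> Ob \<kappa> \<inter> cball c' \<rho>' \<noteq> {}} \<subseteq> ?H - ?M"
          using L(2) a by blast
        then have "(\<Sum>\<kappa> | \<kappa> \<in> ?H \<and> Ob \<kappa> \<inter> cball c' \<rho>' \<noteq> {}. ?w \<kappa>) \<le> sum ?w (?H - ?M)"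
          using finH by (intro sum_mono2) auto
        also have "\<dots> = sum ?w ?H - sum ?w ?M"
          using finH by (intro sum_diff) auto
        also have "\<dots> \<le> sum ?w ?H - sum ?w ?H / N" using \<kappa>0(2)[of \<rho>' c'] a by auto
        finally show "(\<Sum>\<kappa> | \<kappa> \<in> ?H \<and> Ob \<kappa> \<inter> cball c' \<rho>' \<noteq> {}. ?w \<kappa>)
           \<le> (1 - 1 / N) * potential \<gamma> Ob \<tau> r K c \<rho>"
          by (simp add: potential_def left_diff_distrib)
      qed
    qed
  qed
qed

text \<open>Three effects are balanced: Bob loses the proportion \<open>1 / N\<close> of the
  potential, the admissible bound shrinks with the radius by a factor of at least
  \<open>\<beta> powr \<gamma>\<close>, and obstacles of scale between the two radii become active.
  The exponent \<open>\<gamma>\<close> is chosen so small that the first effect covers the other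
  two.\<close>

lemma potential_step:
  fixes \<beta> :: real
  assumes "0 < \<beta>" "\<beta> < 1"
  shows "\<exists>\<gamma>>0. \<exists>\<eta>>0. \<forall>(Ob :: 'k \<Rightarrow> 'a::euclidean_space set) \<tau> r K c \<rho>.
      obstacle_family Ob \<tau> r K \<and> 0 < \<rho> \<and>
        potential \<gamma> Ob \<tau> r K c \<rho> \<le> (\<beta> / 2 * \<rho>) powr \<gamma> \<and>
        (\<forall>x>0. (\<Sum>\<kappa> | \<kappa> \<in> K \<and> x \<le> \<tau> \<kappa> \<and> \<beta> * \<tau> \<kappa> \<le> x. r \<kappa> powr \<gamma>) \<le> \<eta> * x powr \<gamma>) \<longrightarrow>
      (\<exists>L. affine_hyperplane L \<and> (\<forall>c' \<rho>'. \<beta> * \<rho> \<le> \<rho>' \<and>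
         cball c' \<rho>' \<subseteq> cball c \<rho> - hyperplane_nbhd L (\<beta> * \<rho>) \<longrightarrow>
         potential \<gamma> Ob \<tau> r K c' \<rho>' \<le> (\<beta> / 2 * \<rho>') powr \<gamma>))"
proof -
  obtain N :: nat where N: "(1::nat) \<le> N" and dec: "\<forall>(Ob :: 'k \<Rightarrow> 'a set) \<tau> r K c \<rho> \<gamma>.
      obstacle_family Ob \<tau> r K \<and> 0 < \<rho> \<and> 0 < \<gamma> \<and>
        potential \<gamma> Ob \<tau> r K c \<rho> \<le> (\<beta> / 2 * \<rho>) powr \<gamma> \<longrightarrow>
      (\<exists>L. affine_hyperplane L \<and> (\<forall>c' \<rho>'. 0 < \<rho>' \<and>
         cball c' \<rho>' \<subseteq> cball c \<rho> - hyperplane_nbhd L (\<beta> * \<rho>) \<longrightarrow>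
         (\<Sum>\<kappa> | \<kappa> \<in> hit_obstacles Ob \<tau> K c \<rho> \<and> Ob \<kappa> \<inter> cball c' \<rho>' \<noteq> {}. r \<kappa> powr \<gamma>)
           \<le> (1 - 1 / real N) * potential \<gamma> Ob \<tau> r K c \<rho>))"
    using potential_decrease[OF assms(1)] by (elim exE conjE)
  \<comment> \<open>With \<open>\<beta> powr \<gamma> = \<theta>\<close> and
    \<open>1 - 1 / N \<le> \<theta> * \<theta>\<close>, one factor \<open>\<theta>\<close> pays for
    the smaller radius, and the other leaves the proportion \<open>1 - \<theta>\<close> for newly
    active obstacles; \<open>\<eta>\<close> is this allowance.\<close>
  define \<theta> where "\<theta> = 1 - 1 / (2 * real N)"
  define \<gamma> where "\<gamma> = ln \<theta> / ln \<beta>"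
  have \<theta>: "0 < \<theta>" "\<theta> < 1" "1 - 1 / real N \<le> \<theta> * \<theta>"
    using N by (auto simp: \<theta>_def field_simps)
  have \<gamma>: "0 < \<gamma>" using \<theta> assms by (simp add: \<gamma>_def divide_neg_neg)
  have b\<gamma>: "\<beta> powr \<gamma> = \<theta>" using assms \<theta> by (simp add: powr_def \<gamma>_def)
  define \<eta> where "\<eta> = (1 - \<theta>) * (\<beta> / 2) powr \<gamma>"
  have \<eta>: "0 < \<eta>" using \<theta> assms by (simp add: \<eta>_def)
  show ?thesis
  proof (rule exI[of _ \<gamma>], intro conjI \<gamma>, rule exI[of _ \<eta>], intro conjI \<eta> allI impI)
    fix Ob :: "'k \<Rightarrow> 'a set" and \<tau> r K c and \<rho> :: real
    assume "obstacle_family Ob \<tau> r K \<and> 0 < \<rho> \<and>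
        potential \<gamma> Ob \<tau> r K c \<rho> \<le> (\<beta> / 2 * \<rho>) powr \<gamma> \<and>
        (\<forall>x>0. (\<Sum>\<kappa> | \<kappa> \<in> K \<and> x \<le> \<tau> \<kappa> \<and> \<beta> * \<tau> \<kappa> \<le> x. r \<kappa> powr \<gamma>) \<le> \<eta> * x powr \<gamma>)"
    then have fam: "obstacle_family Ob \<tau> r K" and \<rho>: "0 < \<rho>"
      and pot: "potential \<gamma> Ob \<tau> r K c \<rho> \<le> (\<beta> / 2 * \<rho>) powr \<gamma>"
      and new: "\<And>x. 0 < x \<Longrightarrow> (\<Sum>\<kappa> | \<kappa> \<in> K \<and> x \<le> \<tau> \<kappa> \<and> \<beta> * \<tau> \<kappa> \<le> x. r \<kappa> powr \<gamma>) \<le> \<eta> * x powr \<gamma>"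
      by auto
    have finK: "finite K" using fam by (simp add: obstacle_family_def)
    let ?H = "hit_obstacles Ob \<tau> K"
    let ?w = "\<lambda>\<kappa>. r \<kappa> powr \<gamma>"
    obtain L where L: "affine_hyperplane L" "\<And>c' \<rho>'. 0 < \<rho>' \<Longrightarrow>
         cball c' \<rho>' \<subseteq> cball c \<rho> - hyperplane_nbhd L (\<beta> * \<rho>) \<Longrightarrow>
         (\<Sum>\<kappa> | \<kappa> \<in> ?H c \<rho> \<and> Ob \<kappa> \<inter> cball c' \<rho>' \<noteq> {}. ?w \<kappa>)
           \<le> (1 - 1 / N) * potential \<gamma> Ob \<tau> r K c \<rho>"
      using dec[rule_format, OF conjI[OF fam conjI[OF \<rho> conjI[OF \<gamma> pot]]]] by blast
    show "\<exists>L. affine_hyperplane L \<and> (\<forall>c' \<rho>'. \<beta> * \<rho> \<le> \<rho>' \<and>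
         cball c' \<rho>' \<subseteq> cball c \<rho> - hyperplane_nbhd L (\<beta> * \<rho>) \<longrightarrow>
         potential \<gamma> Ob \<tau> r K c' \<rho>' \<le> (\<beta> / 2 * \<rho>') powr \<gamma>)"
    proof (intro exI[of _ L] conjI allI impI L(1))
      fix c' \<rho>'
      assume a: "\<beta> * \<rho> \<le> \<rho>' \<and> cball c' \<rho>' \<subseteq> cball c \<rho> - hyperplane_nbhd L (\<beta> * \<rho>)"
      have "0 < \<beta> * \<rho>" using \<rho> assms by simp
      then have \<rho>': "0 < \<rho>'" using a by linarith
      let ?A = "{\<kappa>. \<kappa> \<in> ?H c \<rho> \<and> Ob \<kappa> \<inter> cball c' \<rho>' \<noteq> {}}"
      let ?B = "{\<kappa>. \<kappa> \<in> K \<and> \<rho>' \<le> \<tau> \<kappa> \<and> \<beta> * \<tau> \<kappa> \<le> \<rho>'}"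
      \<comment> \<open>\<open>?A\<close> are the obstacles active before that still meet the ball;
        those activated by the decrease of the radius have scale below \<open>\<rho>\<close>, and
        thus at most \<open>\<rho>' / \<beta>\<close>, and fall into \<open>?B\<close>.\<close>
      have "?H c' \<rho>' \<subseteq> ?A \<union> ?B"
      proof
        fix \<kappa> assume \<kappa>: "\<kappa> \<in> ?H c' \<rho>'"
        show "\<kappa> \<in> ?A \<union> ?B"
        proof (cases "\<rho> \<le> \<tau> \<kappa>")
          case True
          then show ?thesis using \<kappa> a by (auto simp: hit_obstacles_def)
        next
          case False
          then have "\<beta> * \<tau> \<kappa> \<le> \<beta> * \<rho>" using assms(1) by simp
          then show ?thesis using \<kappa> a by (auto simp: hit_obstacles_def)
        qed
      qed
      then have "potential \<gamma> Ob \<tau> r K c' \<rho>' \<le> sum ?w (?A \<union> ?B)"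
        unfolding potential_def using finK by (intro sum_mono2) (auto simp: hit_obstacles_def)
      also have "\<dots> \<le> sum ?w ?A + sum ?w ?B"
        using sum.union_inter[of ?A ?B ?w] finK sum_nonneg[of "?A \<inter> ?B" ?w] by (simp add: hit_obstacles_def)
      also have "\<dots> \<le> \<theta> * \<theta> * (\<beta> / 2 * \<rho>) powr \<gamma> + \<eta> * \<rho>' powr \<gamma>"
      proof -
        have "sum ?w ?A \<le> (1 - 1 / N) * potential \<gamma> Ob \<tau> r K c \<rho>" using L(2)[OF \<rho>'] a by blast
        also have "\<dots> \<le> (\<theta> * \<theta>) * (\<beta> / 2 * \<rho>) powr \<gamma>"
          using \<theta> pot N by (intro mult_mono) (auto simp: potential_def intro: sum_nonneg)
        finally show ?thesis using new[OF \<rho>'] by linarith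
      qed
      also have "\<theta> * \<theta> * (\<beta> / 2 * \<rho>) powr \<gamma> \<le> \<theta> * (\<beta> / 2 * \<rho>') powr \<gamma>"
      proof -
        have "\<theta> * (\<beta> / 2 * \<rho>) powr \<gamma> = (\<beta> / 2 * (\<beta> * \<rho>)) powr \<gamma>"
          using assms \<rho> b\<gamma> by (simp add: powr_mult powr_divide)
        also have "\<dots> \<le> (\<beta> / 2 * \<rho>') powr \<gamma>"
          using assms \<rho> \<gamma> a by (intro powr_mono2) (auto intro: mult_left_mono)
        finally show ?thesis using \<theta>(1) by simp
      qed
      also have "\<theta> * (\<beta> / 2 * \<rho>') powr \<gamma> + \<eta> * \<rho>' powr \<gamma> = (\<beta> / 2 * \<rho>') powr \<gamma>"
        using assms \<rho>' by (simp add: \<eta>_def powr_mult powr_divide field_simps)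
      finally show "potential \<gamma> Ob \<tau> r K c' \<rho>' \<le> (\<beta> / 2 * \<rho>') powr \<gamma>" by simp
    qed
  qed
qed

text \<open>In phase \<open>k\<close>, while the radius is in \<open>{R (Suc k)<..R k}\<close>, Alice avoids the family \<open>K k\<close>.
  Her strategy depends on the last ball of Bob only.\<close>

lemma phase_strategy:
  fixes Ob :: "nat \<Rightarrow> 'k \<Rightarrow> 'a::euclidean_space set" and \<beta> \<gamma> :: real
  assumes \<beta>: "0 < \<beta>" and \<gamma>: "0 < \<gamma>"
    and step: "\<And>k c \<rho>. 0 < \<rho> \<Longrightarrow>
      potential \<gamma> (Ob k) (\<tau> k) (r k) (K k) c \<rho> \<le> (\<beta> / 2 * \<rho>) powr \<gamma> \<Longrightarrow>
      \<exists>L. affine_hyperplane L \<and> (\<forall>c' \<rho>'. \<beta> * \<rho> \<le> \<rho>' \<and>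
         cball c' \<rho>' \<subseteq> cball c \<rho> - hyperplane_nbhd L (\<beta> * \<rho>) \<longrightarrow>
         potential \<gamma> (Ob k) (\<tau> k) (r k) (K k) c' \<rho>' \<le> (\<beta> / 2 * \<rho>') powr \<gamma>)"
    and finK: "\<And>k. finite (K k)"
    and R: "\<And>k. 0 < R k" "\<And>k. R (Suc k) \<le> R k"
    and start: "\<And>k c \<rho>. \<beta> * R k \<le> \<rho> \<Longrightarrow> \<rho> \<le> R k \<Longrightarrow>
      potential \<gamma> (Ob k) (\<tau> k) (r k) (K k) c \<rho> \<le> (\<beta> / 2 * \<rho>) powr \<gamma>"
    and stop: "\<And>k \<kappa>. \<kappa> \<in> K k \<Longrightarrow> R (Suc k) \<le> \<tau> k \<kappa> \<and> \<beta> / 2 * R (Suc k) < r k \<kappa>"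
  obtains \<sigma> :: "'a haw_strategy" where "\<And>h c \<rho>. 0 < \<rho> \<Longrightarrow> alice_move \<beta> \<rho> (\<sigma> (h @ [(c, \<rho>)]))"
    "\<And>U B z k \<kappa>. bob_play \<beta> U \<sigma> B \<Longrightarrow> (\<lambda>n. snd (B n)) \<longlonglongrightarrow> 0 \<Longrightarrow>
       (\<And>n. z \<in> cball (fst (B n)) (snd (B n))) \<Longrightarrow> R k < snd (B 0) \<Longrightarrow> \<kappa> \<in> K k \<Longrightarrow> z \<notin> Ob k \<kappa>"
proof -
  define pot where "pot k = potential \<gamma> (Ob k) (\<tau> k) (r k) (K k)" for k
  have step: "0 < \<rho> \<Longrightarrow> pot k c \<rho> \<le> (\<beta> / 2 * \<rho>) powr \<gamma> \<Longrightarrow>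
      \<exists>L. affine_hyperplane L \<and> (\<forall>c' \<rho>'. \<beta> * \<rho> \<le> \<rho>' \<and>
         cball c' \<rho>' \<subseteq> cball c \<rho> - hyperplane_nbhd L (\<beta> * \<rho>) \<longrightarrow>
         pot k c' \<rho>' \<le> (\<beta> / 2 * \<rho>') powr \<gamma>)" for k c \<rho>
    unfolding pot_def by (rule step)
  have start: "\<beta> * R k \<le> \<rho> \<Longrightarrow> \<rho> \<le> R k \<Longrightarrow> pot k c \<rho> \<le> (\<beta> / 2 * \<rho>) powr \<gamma>" for k c \<rho>
    unfolding pot_def by (rule start)
  \<comment> \<open>When the potential is too large, any hyperplane will do: the strategy must give
    a legal move in every position.\<close>
  define good where "good k c \<rho> L \<longleftrightarrow> affine_hyperplane L \<and>
      (0 < \<rho> \<and> pot k c \<rho> \<le> (\<beta> / 2 * \<rho>) powr \<gamma> \<longrightarrow>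
      (\<forall>c' \<rho>'. \<beta> * \<rho> \<le> \<rho>' \<and>
         cball c' \<rho>' \<subseteq> cball c \<rho> - hyperplane_nbhd L (\<beta> * \<rho>) \<longrightarrow>
         pot k c' \<rho>' \<le> (\<beta> / 2 * \<rho>') powr \<gamma>))" for k c \<rho> L
  define Lf where "Lf k c \<rho> = (SOME L. good k c \<rho> L)" for k c \<rho>
  have "\<exists>L. good k c \<rho> L" for k c \<rho>
  proof (cases "0 < \<rho> \<and> pot k c \<rho> \<le> (\<beta> / 2 * \<rho>) powr \<gamma>")
    case True
    then show ?thesis using step unfolding good_def by simp
  next
    case False
    then show ?thesis using ex_affine_hyperplane unfolding good_def by blast
  qed
  then have good: "good k c \<rho> (Lf k c \<rho>)" for k c \<rho>
    unfolding Lf_def by (rule someI_ex)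
  then have Lf1: "affine_hyperplane (Lf k c \<rho>)" for k c \<rho> by (simp add: good_def)
  have Lf2: "pot k c' \<rho>' \<le> (\<beta> / 2 * \<rho>') powr \<gamma>"
    if "0 < \<rho>" "pot k c \<rho> \<le> (\<beta> / 2 * \<rho>) powr \<gamma>" "\<beta> * \<rho> \<le> \<rho>'"
      "cball c' \<rho>' \<subseteq> cball c \<rho> - hyperplane_nbhd (Lf k c \<rho>) (\<beta> * \<rho>)" for k c \<rho> c' \<rho>'
    using good[of k c \<rho>] that unfolding good_def by blast
  \<comment> \<open>The phase of a radius: the \<open>k\<close> with
    \<open>R (Suc k) < \<rho> \<le> R k\<close>, and \<open>0\<close> for radii above
    \<open>R 0\<close>.\<close>
  define ph where "ph \<rho> = (LEAST k. R (Suc k) < \<rho>)" for \<rho>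
  define \<sigma> :: "'a haw_strategy" where
    "\<sigma> h = (Lf (ph (snd (last h))) (fst (last h)) (snd (last h)), \<beta> * snd (last h))" for h
  have R_mono: "R n \<le> R m" if "m \<le> n" for m n
    using that R(2) by (rule lift_Suc_antimono_le[rotated])
  show ?thesis
  proof (rule that[of \<sigma>])
    show "alice_move \<beta> \<rho> (\<sigma> (h @ [(c, \<rho>)]))" if "0 < \<rho>" for h c \<rho>
      using that \<beta> Lf1 by (simp add: alice_move_def \<sigma>_def)
  next
    fix U B z k \<kappa>
    assume play: "bob_play \<beta> U \<sigma> B" and lim: "(\<lambda>n. snd (B n)) \<longlonglongrightarrow> 0"
      and z: "\<And>n. z \<in> cball (fst (B n)) (snd (B n))" and Rk: "R k < snd (B 0)" and \<kappa>: "\<kappa> \<in> K k"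
    define c where "c n = fst (B n)" for n
    define \<rho> where "\<rho> n = snd (B n)" for n
    have bet: "\<beta> * \<rho> n \<le> \<rho> (Suc n)"
      and sub: "cball (c (Suc n)) (\<rho> (Suc n)) \<subseteq>
        cball (c n) (\<rho> n) - hyperplane_nbhd (Lf (ph (\<rho> n)) (c n) (\<rho> n)) (\<beta> * \<rho> n)" for n
      using play by (auto simp: bob_play_def \<sigma>_def c_def \<rho>_def)
    have pos: "0 < \<rho> n" for n
    proof (induction n)
      case 0 then show ?case using play by (simp add: bob_play_def \<rho>_def)
    next
      case (Suc n)
      then have "0 < \<beta> * \<rho> n" using \<beta> by simp
      then show ?case using bet[of n] by linarith
    qed
    have "\<rho> (Suc n) \<le> \<rho> n" for n
    proof -
      have "cball (c (Suc n)) (\<rho> (Suc n)) \<subseteq> cball (c n) (\<rho> n)" using sub by blast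
      then have "dist (c (Suc n)) (c n) + \<rho> (Suc n) \<le> \<rho> n"
        using pos[of "Suc n"] by (simp add: cball_subset_cball_iff)
      then show ?thesis using zero_le_dist[of "c (Suc n)" "c n"] by linarith
    qed
    then have \<rho>_mono: "\<rho> n \<le> \<rho> m" if "m \<le> n" for m n
      using that by (rule lift_Suc_antimono_le)
    have ex: "\<exists>n. \<rho> n \<le> x" if "0 < x" for x
    proof -
      have "eventually (\<lambda>n. \<rho> n < x) sequentially"
        using lim that unfolding \<rho>_def by (rule order_tendstoD)
      then show ?thesis by (meson eventually_sequentially le_refl less_imp_le)
    qed
    define n where "n = (LEAST n. \<rho> n \<le> R k)"
    define m where "m = (LEAST n. \<rho> n \<le> R (Suc k))"
    have n: "\<rho> n \<le> R k" "\<And>i. i < n \<Longrightarrow> R k < \<rho> i"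
      unfolding n_def using LeastI_ex[OF ex[OF R(1)]] not_less_Least not_le by blast+
    have m: "\<rho> m \<le> R (Suc k)" "\<And>i. i < m \<Longrightarrow> R (Suc k) < \<rho> i"
      unfolding m_def using LeastI_ex[OF ex[OF R(1)]] not_less_Least not_le by blast+
    have "n \<le> m" using n(2)[of m] m(1) R(2)[of k] by (cases "m < n") auto
    \<comment> \<open>Since the first ball is larger than \<open>R k\<close>, phase \<open>k\<close>
      is entered by a move of Bob, which cannot shrink the radius by more than
      \<open>\<beta>\<close>. Hence \<open>\<rho> n\<close> is still at least
      \<open>\<beta> * R k\<close> and \<open>start\<close> applies.\<close>
    have "n \<noteq> 0" using n(1) Rk by (intro notI) (simp add: \<rho>_def)
    then obtain n' where n': "n = Suc n'" by (cases n) auto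
    have "\<beta> * R k \<le> \<beta> * \<rho> n'" using n(2)[of n'] n' \<beta> by simp
    then have init: "pot k (c n) (\<rho> n) \<le> (\<beta> / 2 * \<rho> n) powr \<gamma>"
      using n(1) bet[of n'] n' by (intro start) auto
    have "pot k (c i) (\<rho> i) \<le> (\<beta> / 2 * \<rho> i) powr \<gamma>" if "n \<le> i" "i \<le> m" for i
      using that
    proof (induction i rule: dec_induct)
      case (step i)
      have "\<rho> i \<le> R k" using \<rho>_mono[OF step(1)] n(1) by linarith
      have "ph (\<rho> i) = k" unfolding ph_def
      proof (rule Least_equality)
        show "R (Suc k) < \<rho> i" using m(2) step by simp
        fix k' assume "R (Suc k') < \<rho> i"
        then show "k \<le> k'" using R_mono[of "Suc k'" k] \<open>\<rho> i \<le> R k\<close> by (cases "Suc k' \<le> k") auto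
      qed
      then have "cball (c (Suc i)) (\<rho> (Suc i)) \<subseteq> cball (c i) (\<rho> i) - hyperplane_nbhd (Lf k (c i) (\<rho> i)) (\<beta> * \<rho> i)"
        using sub[of i] by (simp only:)
      with step(3) step(4) show ?case by (intro Lf2[OF pos _ bet]) simp_all
    qed (use init in simp)
    then have fin: "pot k (c m) (\<rho> m) \<le> (\<beta> / 2 * \<rho> m) powr \<gamma>" using \<open>n \<le> m\<close> by simp
    \<comment> \<open>At the end of the phase the bound on the potential is smaller than the weight
      of any single obstacle of \<open>K k\<close>, while all of them have scale at least the
      radius. So none is hit.\<close>
    show "z \<notin> Ob k \<kappa>"
    proof
      assume "z \<in> Ob k \<kappa>"
      moreover have "z \<in> cball (c m) (\<rho> m)" using z by (simp add: c_def \<rho>_def)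
      ultimately have "\<kappa> \<in> hit_obstacles (Ob k) (\<tau> k) (K k) (c m) (\<rho> m)"
        using \<kappa> stop[OF \<kappa>] m(1) unfolding hit_obstacles_def by auto
      then have "r k \<kappa> powr \<gamma> \<le> pot k (c m) (\<rho> m)"
        unfolding pot_def potential_def using finK
        by (intro member_le_sum) (auto simp: hit_obstacles_def)
      moreover have "0 < \<beta> / 2 * R (Suc k)" using \<beta> R(1) by simp
      ultimately have "r k \<kappa> powr \<gamma> \<le> (\<beta> / 2 * \<rho> m) powr \<gamma>" "0 \<le> r k \<kappa>" "0 \<le> \<beta> / 2 * \<rho> m"
        using fin conjunct2[OF stop[OF \<kappa>]] \<beta> pos[of m] by (linarith, linarith, auto)
      then have "r k \<kappa> \<le> \<beta> / 2 * \<rho> m" using powr_le_cancel \<gamma> by blast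
      moreover have "\<beta> / 2 * \<rho> m \<le> \<beta> / 2 * R (Suc k)" using m(1) \<beta> by simp
      ultimately show False using stop[OF \<kappa>] by linarith
    qed
  qed
qed

section \<open>Obstacles attached to rational points\<close>

lemma infdist_hyperplane_le:
  fixes a :: "'a::euclidean_space"
  assumes "a \<noteq> 0"
  shows "infdist z {x. a \<bullet> x = b} \<le> \<bar>a \<bullet> z - b\<bar> / norm a"
proof -
  define y where "y = z - ((a \<bullet> z - b) / (a \<bullet> a)) *\<^sub>R a"
  have "a \<bullet> y = b" using assms by (simp add: y_def inner_diff_right)
  then have "infdist z {x. a \<bullet> x = b} \<le> dist z y" by (intro infdist_le) simp
  also have "dist z y = \<bar>a \<bullet> z - b\<bar> / (norm a * norm a) * norm a"
    by (simp add: y_def dist_norm power2_norm_eq_inner[symmetric] power2_eq_square abs_mult)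
  also have "\<dots> = \<bar>a \<bullet> z - b\<bar> / norm a" using assms by simp
  finally show ?thesis .
qed

text \<open>The point \<open>(p/q, r/q)\<close> lies on the line \<open>A x + B y + C = 0\<close>, and \<open>z\<close> is in the box of
  half side lengths \<open>\<epsilon>/(a q)\<close> and \<open>\<epsilon>/(b q)\<close> around it.\<close>

definition box_on_line ::
  "real \<Rightarrow> real \<Rightarrow> nat \<Rightarrow> nat \<Rightarrow> real \<times> real \<Rightarrow> real \<Rightarrow> real \<Rightarrow> int \<Rightarrow> int \<Rightarrow> int \<Rightarrow> int \<Rightarrow> int \<Rightarrow> int \<Rightarrow> bool"
  where
  "box_on_line \<epsilon> \<mu> i j z a b q p r A B C \<longleftrightarrow> 0 < a \<and> 0 < b \<and>
     2 ^ j \<le> q \<and> q < 2 ^ Suc j \<and> \<bar>q * fst z - p\<bar> < \<epsilon> / a \<and> \<bar>q * snd z - r\<bar> < \<epsilon> / b \<and>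
     A * p + B * r + C * q = 0 \<and> \<bar>B\<bar> \<le> \<bar>A\<bar> \<and> 2 ^ i \<le> \<bar>A\<bar> \<and> \<bar>A\<bar> < 2 ^ Suc i \<and>
     \<bar>A\<bar> \<le> \<mu> * a \<and> \<bar>B\<bar> \<le> \<mu> * b"

definition obstacle :: "real \<Rightarrow> real \<Rightarrow> nat \<Rightarrow> nat \<Rightarrow> (real \<times> real) set" where
  "obstacle \<epsilon> \<mu> i j = {z. \<exists>a b q p r A B C. box_on_line \<epsilon> \<mu> i j z a b q p r A B C}"

lemma two_power_of_int:
  "2 ^ n \<le> (x::int) \<longleftrightarrow> (2::real) ^ n \<le> of_int x" "x < 2 ^ n \<longleftrightarrow> of_int x < (2::real) ^ n"
  by (metis of_int_le_iff of_int_numeral of_int_power, metis of_int_less_iff of_int_numeral of_int_power)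

lemma box_on_lineD:
  assumes "box_on_line \<epsilon> \<mu> i j z a b q p r A B C"
  shows "0 < a" "0 < b" "0 < real_of_int q" "2 ^ j \<le> real_of_int q" "real_of_int q < 2 ^ Suc j"
    "\<bar>q * fst z - p\<bar> < \<epsilon> / a" "\<bar>q * snd z - r\<bar> < \<epsilon> / b" "A * p + B * r + C * q = 0"
    "\<bar>real_of_int B\<bar> \<le> \<bar>real_of_int A\<bar>" "2 ^ i \<le> \<bar>real_of_int A\<bar>" "\<bar>real_of_int A\<bar> < 2 ^ Suc i"
    "\<bar>real_of_int A\<bar> \<le> \<mu> * a" "\<bar>real_of_int B\<bar> \<le> \<mu> * b"
proof -
  show "2 ^ j \<le> real_of_int q"
    using assms unfolding box_on_line_def two_power_of_int by (elim conjE)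
  then show "0 < real_of_int q" by (rule less_le_trans[rotated]) simp
qed (use assms in \<open>unfold box_on_line_def two_power_of_int of_int_abs, elim conjE, linarith\<close>)+

lemma abs_mult_less_of_box:
  fixes A u \<epsilon> \<mu> a c :: real
  assumes "\<bar>A\<bar> \<le> c * (\<mu> * a)" "\<bar>u\<bar> < \<epsilon> / a" "0 < a" "0 \<le> c" "0 \<le> \<mu>"
  shows "\<bar>A * u\<bar> \<le> c * \<mu> * \<epsilon>"
proof -
  have "\<bar>A * u\<bar> \<le> (c * (\<mu> * a)) * (\<epsilon> / a)"
    unfolding abs_mult using assms by (intro mult_mono) auto
  also have "\<dots> = c * \<mu> * \<epsilon>" using assms by simp
  finally show ?thesis .
qed

text \<open>The point of the second box lies on the line of the first one because the integer
  \<open>A p' + B r' + C q'\<close> is less than \<open>1\<close> in absolute value.\<close>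

lemma box_near_line:
  assumes t: "box_on_line \<epsilon> \<mu> i j z a b q p r A B C"
    and t': "box_on_line \<epsilon> \<mu> i j z' a' b' q' p' r' A' B' C'"
    and B: "\<bar>B\<bar> \<le> \<bar>B'\<bar>"
    and \<epsilon>: "0 < \<epsilon>" "0 \<le> \<mu>" "\<mu> * \<epsilon> \<le> 1 / 28"
    and d: "dist z z' \<le> 2 * (1/2) ^ (i + j + 5)"
  shows "\<bar>A * fst z' + B * snd z' + C\<bar> \<le> 3 * (\<mu> * \<epsilon>) / 2 ^ j"
proof -
  define f where "f w = A * fst w + B * snd w + C" for w :: "real \<times> real"
  note D = box_on_lineD[OF t] and D' = box_on_lineD[OF t']
  have "q * f z = A * (q * fst z - p) + B * (q * snd z - r) + (A * p + B * r + C * q)"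
    by (simp add: f_def algebra_simps)
  also have "A * p + B * r + C * q = 0" using D(8) by simp
  finally have qf: "q * f z = A * (q * fst z - p) + B * (q * snd z - r)" by simp
  have "\<bar>A * (q * fst z - p)\<bar> \<le> 1 * \<mu> * \<epsilon>" "\<bar>B * (q * snd z - r)\<bar> \<le> 1 * \<mu> * \<epsilon>"
    using D \<epsilon> by (intro abs_mult_less_of_box[of _ _ _ a] abs_mult_less_of_box[of _ _ _ b]; simp)+
  then have "q * \<bar>f z\<bar> \<le> 2 * (\<mu> * \<epsilon>)" using qf D(3) abs_mult[of "real_of_int q" "f z"] by linarith
  moreover have "2 ^ j * \<bar>f z\<bar> \<le> q * \<bar>f z\<bar>" using D(4) by (intro mult_right_mono) auto
  ultimately have fz: "2 ^ j * \<bar>f z\<bar> \<le> 2 * (\<mu> * \<epsilon>)" by linarith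
  have "\<bar>fst z' - fst z\<bar> \<le> dist z z'" "\<bar>snd z' - snd z\<bar> \<le> dist z z'"
    using dist_fst_le[of z' z] dist_snd_le[of z' z] by (simp_all add: dist_real_def dist_commute)
  then have "\<bar>fst z' - fst z\<bar> \<le> 2 * (1/2) ^ (i + j + 5)" "\<bar>snd z' - snd z\<bar> \<le> 2 * (1/2) ^ (i + j + 5)"
    using d by linarith+
  then have "\<bar>A * (fst z' - fst z)\<bar> \<le> 2 * 2 ^ i * (2 * (1/2) ^ (i + j + 5))"
      "\<bar>B * (snd z' - snd z)\<bar> \<le> 2 * 2 ^ i * (2 * (1/2) ^ (i + j + 5))"
    unfolding abs_mult using D(9,11) by (intro mult_mono; simp)+
  \<comment> \<open>The coefficients are below \<open>2 ^ Suc i\<close> and the points at most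
    \<open>2 * (1/2) ^ (i + j + 5)\<close> apart: the summand 5 in the scale keeps the change of
    \<open>f\<close> within a quarter of \<open>1 / 2 ^ j\<close>.\<close>
  moreover have "2 * 2 ^ i * (2 * (1/2) ^ (i + j + 5)) = 1 / (8 * (2::real) ^ j)"
    by (simp add: power_add power_divide)
  moreover have "1 / (8 * (2::real) ^ j) + 1 / (8 * 2 ^ j) = 1 / (4 * 2 ^ j)" by simp
  ultimately have "\<bar>A * (fst z' - fst z) + B * (snd z' - snd z)\<bar> \<le> 1 / (4 * 2 ^ j)"
    by linarith
  moreover have "f z' - f z = A * (fst z' - fst z) + B * (snd z' - snd z)"
    by (simp add: f_def algebra_simps)
  ultimately have "\<bar>f z' - f z\<bar> \<le> 1 / (4 * 2 ^ j)" by simp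
  then have "2 ^ j * \<bar>f z' - f z\<bar> \<le> 1 / 4" by (simp add: field_simps)
  moreover have "2 ^ j * \<bar>f z'\<bar> \<le> 2 ^ j * \<bar>f z' - f z\<bar> + 2 ^ j * \<bar>f z\<bar>"
    unfolding distrib_left[symmetric] by (intro mult_left_mono) auto
  ultimately have fz': "2 ^ j * \<bar>f z'\<bar> \<le> 2 * (\<mu> * \<epsilon>) + 1 / 4" using fz by linarith
  define n where "n = A * p' + B * r' + C * q'"
  have qf': "q' * f z' = A * (q' * fst z' - p') + B * (q' * snd z' - r') + n"
    by (simp add: f_def n_def algebra_simps)
  \<comment> \<open>The coefficients of the first line are bounded in terms of the second box: for
    \<open>A\<close> since \<open>A\<close> and \<open>A'\<close> lie in the same dyadic range, for
    \<open>B\<close> by the assumption \<open>\<bar>B\<bar> \<le> \<bar>B'\<bar>\<close>.\<close>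
  have A': "\<bar>real_of_int A\<bar> \<le> 2 * (\<mu> * a')" "\<bar>real_of_int B\<bar> \<le> 1 * (\<mu> * b')"
  proof -
    have "\<bar>real_of_int A'\<bar> \<le> \<mu> * a'" "\<bar>real_of_int B'\<bar> \<le> \<mu> * b'" by (fact D')+
    moreover have "\<bar>real_of_int B\<bar> \<le> \<bar>real_of_int B'\<bar>" using B by linarith
    ultimately show "\<bar>real_of_int A\<bar> \<le> 2 * (\<mu> * a')" "\<bar>real_of_int B\<bar> \<le> 1 * (\<mu> * b')" using D(11) D'(10) by simp_all
  qed
  have "\<bar>A * (q' * fst z' - p')\<bar> \<le> 2 * \<mu> * \<epsilon>" "\<bar>B * (q' * snd z' - r')\<bar> \<le> 1 * \<mu> * \<epsilon>"
    by (rule abs_mult_less_of_box[OF A'(1) D'(6,1)] abs_mult_less_of_box[OF A'(2) D'(7,2)]; use \<epsilon> in simp)+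
  then have s: "\<bar>A * (q' * fst z' - p') + B * (q' * snd z' - r')\<bar> \<le> 3 * (\<mu> * \<epsilon>)" by linarith
  have "q' * \<bar>f z'\<bar> \<le> 2 ^ Suc j * \<bar>f z'\<bar>" using D'(5) by (intro mult_right_mono) auto
  then have "\<bar>q' * f z'\<bar> \<le> 2 * (2 * (\<mu> * \<epsilon>) + 1 / 4)" using fz' D'(3) abs_mult[of q' "f z'"] by simp
  moreover define u where "u = A * (q' * fst z' - p') + B * (q' * snd z' - r')"
  ultimately have "\<bar>u + n\<bar> \<le> 2 * (2 * (\<mu> * \<epsilon>) + 1 / 4)" "\<bar>u\<bar> \<le> 3 * (\<mu> * \<epsilon>)" using qf' s by simp_all
  moreover have "\<bar>real_of_int n\<bar> \<le> \<bar>u + n\<bar> + \<bar>u\<bar>" by linarith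
  \<comment> \<open>The two bounds add up to \<open>7 * (\<mu> * \<epsilon>) + 1 / 2\<close>, which
    is at most \<open>3 / 4\<close>; hence the constant \<open>1 / 28\<close>.\<close>
  ultimately have "\<bar>real_of_int n\<bar> < 1" using \<epsilon>(3) by (simp add: field_simps)
  then have "n = 0" by linarith
  then have "q' * \<bar>f z'\<bar> \<le> 3 * (\<mu> * \<epsilon>)" using qf' s D'(3) abs_mult[of q' "f z'"] by simp
  moreover have "2 ^ j * \<bar>f z'\<bar> \<le> q' * \<bar>f z'\<bar>" using D'(4) by (intro mult_right_mono) auto
  ultimately have "2 ^ j * \<bar>f z'\<bar> \<le> 3 * (\<mu> * \<epsilon>)" by linarith
  then show ?thesis unfolding f_def by (simp add: field_simps)
qed

text \<open>Among all boxes whose points lie in the ball, take one whose line has the least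
  \<open>\<bar>B\<bar>\<close>; then \<open>box_near_line\<close> compares every other box with it.
  Dividing by the length of the normal vector, at least \<open>2 ^ i\<close>, gives the
  width.\<close>

lemma obstacle_near_line:
  assumes \<epsilon>: "0 < \<epsilon>" "0 \<le> \<mu>" "\<mu> * \<epsilon> \<le> 1 / 28" and \<rho>: "\<rho> \<le> (1/2) ^ (i + j + 5)"
  shows "\<exists>L. affine_hyperplane L \<and>
    obstacle \<epsilon> \<mu> i j \<inter> cball c \<rho> \<subseteq> hyperplane_nbhd L (3 * \<epsilon> * \<mu> * (1/2) ^ (i + j))"
proof (cases "obstacle \<epsilon> \<mu> i j \<inter> cball c \<rho> = {}")
  case True
  then show ?thesis using ex_affine_hyperplane by auto
next
  case False
  define P where "P n \<longleftrightarrow> (\<exists>z\<in>cball c \<rho>. \<exists>a b q p r A B C.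
    box_on_line \<epsilon> \<mu> i j z a b q p r A B C \<and> n = nat \<bar>B\<bar>)" for n
  have "\<exists>n. P n" using False unfolding P_def obstacle_def by blast
  then have "P (LEAST n. P n)" by (rule LeastI_ex)
  then obtain z a b q p r A B C where z: "z \<in> cball c \<rho>"
    and t: "box_on_line \<epsilon> \<mu> i j z a b q p r A B C" and least: "(LEAST n. P n) = nat \<bar>B\<bar>"
    unfolding P_def by blast
  have A: "2 ^ i \<le> \<bar>real_of_int A\<bar>"
    by (rule box_on_lineD[OF t])
  define v where "v = (real_of_int A, real_of_int B)"
  have v: "2 ^ i \<le> norm v" using A norm_fst_le[of "real_of_int A" "real_of_int B"] by (simp add: v_def)
  then have "v \<noteq> 0" using zero_less_power[of "2::real" i] by (metis norm_zero not_le zero_less_numeral)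
  have "w \<in> hyperplane_nbhd {x. v \<bullet> x = - C} (3 * \<epsilon> * \<mu> * (1/2) ^ (i + j))"
    if w: "w \<in> obstacle \<epsilon> \<mu> i j \<inter> cball c \<rho>" for w
  proof -
    obtain a' b' q' p' r' A' B' C' where t': "box_on_line \<epsilon> \<mu> i j w a' b' q' p' r' A' B' C'"
      using w by (auto simp: obstacle_def)
    then have "P (nat \<bar>B'\<bar>)" using w unfolding P_def by blast
    then have "nat \<bar>B\<bar> \<le> nat \<bar>B'\<bar>" using Least_le least by metis
    then have B: "\<bar>B\<bar> \<le> \<bar>B'\<bar>" by linarith
    have "dist z w \<le> 2 * (1/2) ^ (i + j + 5)"
      using z w \<rho> dist_triangle3[of z w c] by simp
    then have "\<bar>A * fst w + B * snd w + C\<bar> \<le> 3 * (\<mu> * \<epsilon>) / 2 ^ j"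
      by (rule box_near_line[OF t t' B \<epsilon>])
    moreover have "v \<bullet> w - (- C) = A * fst w + B * snd w + C"
      by (cases w) (simp add: v_def)
    ultimately have "\<bar>v \<bullet> w - (- C)\<bar> / norm v \<le> (3 * (\<mu> * \<epsilon>) / 2 ^ j) / 2 ^ i"
      using v \<epsilon> by (intro frac_le) auto
    also have "\<dots> = 3 * \<epsilon> * \<mu> * (1/2) ^ (i + j)" by (simp add: power_add power_divide mult.commute)
    finally show ?thesis
      using infdist_hyperplane_le[OF \<open>v \<noteq> 0\<close>, of w "- C"] by (simp add: hyperplane_nbhd_def)
  qed
  then show ?thesis using \<open>v \<noteq> 0\<close>
    by (intro exI[of _ "{x. v \<bullet> x = - C}"]) (use affine_hyperplane_def in blast)
qed

section \<open>Lines through rational points and the classes they fall into\<close>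

text \<open>Pigeonhole: two of the \<open>(M + 1) * (N + 1)\<close> values
  \<open>u * p + v * r\<close> agree modulo \<open>q\<close>, and their difference is the
  relation.\<close>

lemma int_relation_mod:
  fixes p r q :: int
  assumes "0 < q" "q < int ((M + 1) * (N + 1))"
  obtains A B :: int where "(A, B) \<noteq> (0, 0)" "\<bar>A\<bar> \<le> int M" "\<bar>B\<bar> \<le> int N" "q dvd A * p + B * r"
proof -
  let ?f = "\<lambda>(u, v). (int u * p + int v * r) mod q"
  let ?S = "{..M} \<times> {..N}"
  have "?f ` ?S \<subseteq> {0..<q}" using assms(1) by auto
  then have "card (?f ` ?S) \<le> nat q" using card_mono[of "{0..<q}" "?f ` ?S"] by simp
  also have "\<dots> < card ?S" using assms by (simp only: card_cartesian_product card_atMost Suc_eq_plus1 nat_less_iff)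
  finally have "\<not> inj_on ?f ?S" using card_image by fastforce
  then obtain u v u' v' where uv: "(u, v) \<in> ?S" "(u', v') \<in> ?S" "(u, v) \<noteq> (u', v')"
    "(int u * p + int v * r) mod q = (int u' * p + int v' * r) mod q"
    unfolding inj_on_def by auto
  show ?thesis
  proof (rule that[of "int u - int u'" "int v - int v'"])
    have "q dvd (int u * p + int v * r) - (int u' * p + int v' * r)"
      using uv(4) by (simp add: mod_eq_dvd_iff)
    then show "q dvd (int u - int u') * p + (int v - int v') * r" by (simp add: algebra_simps)
  qed (use uv in auto)
qed

lemma power_of_two_bracket:
  assumes "1 \<le> (n::int)" obtains j where "2 ^ j \<le> n" "n < 2 ^ Suc j"
proof -
  have "\<exists>j. n < 2 ^ j"
    by (rule exI[of _ "nat n"]) (use assms of_nat_less_two_power[of "nat n"] in auto)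
  define k where "k = (LEAST j. n < 2 ^ j)"
  have k: "n < 2 ^ k" unfolding k_def using \<open>\<exists>j. n < 2 ^ j\<close> by (rule LeastI_ex)
  have "k \<noteq> 0" using k assms by (intro notI) simp
  then obtain j where j: "k = Suc j" by (cases k) auto
  have "\<not> n < 2 ^ j" using not_less_Least[of j "\<lambda>j. n < 2 ^ j"] j k_def by simp
  then show ?thesis using that[of j] k j by simp
qed

text \<open>The least \<open>\<mu>\<close> for which the pigeonhole argument covers all denominators
  below \<open>2 ^ Suc j\<close>: if \<open>a * b = Q\<close>, then
  \<open>(\<mu> * a) * (\<mu> * b) = 2 ^ Suc j\<close>.\<close>

definition line_bound :: "real \<Rightarrow> nat \<Rightarrow> real" where
  "line_bound Q j = sqrt (2 ^ Suc j / Q)"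

text \<open>A relation modulo \<open>q\<close> between \<open>p\<close> and \<open>r\<close> is an
  integer line through \<open>(p/q, r/q)\<close>. The definition of \<open>obstacle\<close> demands
  \<open>\<bar>B\<bar> \<le> \<bar>A\<bar>\<close>; in the opposite case the coordinates are
  exchanged.\<close>

lemma box_in_obstacle:
  fixes p q r :: int and a b Q \<epsilon> :: real and z :: "real \<times> real"
  assumes Q: "0 < Q" and ab: "1 \<le> a" "1 \<le> b" "a * b = Q" and q: "1 \<le> q" "q < \<epsilon> * Q"
    and \<epsilon>: "0 < \<epsilon>" "\<epsilon> \<le> 1 / 2"
    and box: "\<bar>q * fst z - p\<bar> < \<epsilon> / a" "\<bar>q * snd z - r\<bar> < \<epsilon> / b"
  obtains i j where "2 ^ j \<le> \<epsilon> * Q" "2 ^ i \<le> Q"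
    "z \<in> obstacle \<epsilon> (line_bound Q j) i j \<or> prod.swap z \<in> obstacle \<epsilon> (line_bound Q j) i j"
proof -
  obtain j where j: "2 ^ j \<le> q" "q < 2 ^ Suc j" using power_of_two_bracket[OF q(1)] by metis
  have jr: "2 ^ j \<le> real_of_int q" "real_of_int q < 2 ^ Suc j"
    using j unfolding two_power_of_int by simp_all
  define \<mu> where "\<mu> = line_bound Q j"
  \<comment> \<open>This makes \<open>\<mu> \<le> 1\<close>, so that the coefficients of the line
    are at most \<open>Q\<close> and only finitely many \<open>i\<close> occur for given
    \<open>Q\<close>.\<close>
  have "2 ^ Suc j \<le> Q"
  proof -
    have "2 ^ Suc j \<le> 2 * (\<epsilon> * Q)" using jr(1) q(2) unfolding power_Suc by linarith
    also have "\<dots> \<le> Q" using \<epsilon> Q by simp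
    finally show ?thesis .
  qed
  then have \<mu>: "0 < \<mu>" "\<mu> \<le> 1" "\<mu>\<^sup>2 * Q = 2 ^ Suc j"
    using Q by (simp_all add: \<mu>_def line_bound_def)
  define M where "M = nat \<lfloor>\<mu> * a\<rfloor>"
  define N where "N = nat \<lfloor>\<mu> * b\<rfloor>"
  have MN: "int M = \<lfloor>\<mu> * a\<rfloor>" "int N = \<lfloor>\<mu> * b\<rfloor>" using \<mu> ab by (simp_all add: M_def N_def)
  have "real_of_int q < 2 ^ Suc j" by (rule jr)
  also have "2 ^ Suc j = (\<mu> * a) * (\<mu> * b)" using \<mu>(3) ab(3) by (simp add: power2_eq_square algebra_simps)
  also have "\<dots> \<le> (real M + 1) * (real N + 1)"
  proof (intro mult_mono)
    have "real M = of_int \<lfloor>\<mu> * a\<rfloor>" "real N = of_int \<lfloor>\<mu> * b\<rfloor>" using MN by (metis of_int_of_nat_eq)+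
    then show "\<mu> * a \<le> real M + 1" "\<mu> * b \<le> real N + 1" by linarith+
  qed (use \<mu> ab in auto)
  also have "\<dots> = real_of_int (int ((M + 1) * (N + 1)))" by (simp add: algebra_simps)
  finally have "q < int ((M + 1) * (N + 1))" by linarith
  then obtain A B where AB: "(A, B) \<noteq> (0, 0)" "\<bar>A\<bar> \<le> int M" "\<bar>B\<bar> \<le> int N" "q dvd A * p + B * r"
    using int_relation_mod[of q M N p r] q(1) by auto
  then obtain C' where "A * p + B * r = q * C'" by (auto simp: dvd_def)
  then have C: "A * p + B * r + (- C') * q = 0" by simp
  have Ab: "\<bar>real_of_int A\<bar> \<le> \<mu> * a" "\<bar>real_of_int B\<bar> \<le> \<mu> * b" using AB(2,3) MN by linarith+
  define H where "H = max \<bar>A\<bar> \<bar>B\<bar>"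
  have "1 \<le> H" using AB(1) by (auto simp: H_def)
  then obtain i where i: "2 ^ i \<le> H" "H < 2 ^ Suc i" using power_of_two_bracket by metis
  have "a * 1 \<le> a * b" "1 * b \<le> a * b" using ab by (intro mult_mono; simp)+
  then have "\<mu> * a \<le> 1 * Q" "\<mu> * b \<le> 1 * Q"
    unfolding ab(3) using \<mu> ab by (intro mult_mono; simp)+
  then have "real_of_int H \<le> Q" using Ab by (auto simp: H_def max_def)
  moreover have "2 ^ i \<le> real_of_int H" using i(1) unfolding two_power_of_int .
  ultimately have iQ: "2 ^ i \<le> Q" by linarith
  have "z \<in> obstacle \<epsilon> \<mu> i j \<or> prod.swap z \<in> obstacle \<epsilon> \<mu> i j"
  proof (cases "\<bar>B\<bar> \<le> \<bar>A\<bar>")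
    case True
    then have "box_on_line \<epsilon> \<mu> i j z a b q p r A B (- C')"
      using ab j box C Ab i by (simp add: box_on_line_def H_def max_def)
    then show ?thesis unfolding obstacle_def by blast
  next
    case False
    then have "box_on_line \<epsilon> \<mu> i j (prod.swap z) b a q r p B A (- C')"
      using ab j box C Ab i by (simp add: box_on_line_def H_def max_def)
    then show ?thesis unfolding obstacle_def by blast
  qed
  moreover have "2 ^ j \<le> \<epsilon> * Q" using jr q by linarith
  ultimately show ?thesis using that[of j i] iQ unfolding \<mu>_def by blast
qed

section \<open>Sums of powers of strip widths\<close>

text \<open>The sum is dominated by the geometric series that starts at the least index of
  \<open>I\<close>, whose term is at most \<open>X\<close>.\<close>

lemma sum_geometric_le:
  fixes u c X :: real
  assumes "finite I" "0 < u" "u < 1" "0 \<le> c" "0 \<le> X" "\<And>i. i \<in> I \<Longrightarrow> c * u ^ i \<le> X"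
  shows "(\<Sum>i\<in>I. c * u ^ i) \<le> X / (1 - u)"
proof (cases "I = {}")
  case True
  then show ?thesis using assms by simp
next
  case False
  define m where "m = Min I"
  have m: "m \<in> I" "\<And>i. i \<in> I \<Longrightarrow> m \<le> i" using False assms(1) by (auto simp: m_def)
  have inj: "inj_on (\<lambda>i. i - m) I" using m(2) by (intro inj_onI) (metis le_add_diff_inverse)
  have "(\<Sum>i\<in>I. c * u ^ i) = (\<Sum>i\<in>I. (c * u ^ m) * u ^ (i - m))"
  proof (rule sum.cong)
    fix i assume "i \<in> I"
    then have "u ^ i = u ^ m * u ^ (i - m)" using m(2) by (metis le_add_diff_inverse power_add)
    then show "c * u ^ i = (c * u ^ m) * u ^ (i - m)" by simp
  qed simp
  also have "\<dots> = (c * u ^ m) * (\<Sum>k\<in>(\<lambda>i. i - m) ` I. u ^ k)"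
    by (simp add: sum_distrib_left sum.reindex[OF inj])
  also have "(\<Sum>k\<in>(\<lambda>i. i - m) ` I. u ^ k) \<le> (\<Sum>k. u ^ k)"
    using assms by (intro sum_le_suminf) (auto intro: summable_geometric)
  also have "(\<Sum>k. u ^ k) = 1 / (1 - u)" using assms by (intro suminf_geometric) auto
  finally have "(\<Sum>i\<in>I. c * u ^ i) \<le> (c * u ^ m) * (1 / (1 - u))"
    using assms by (simp add: mult_left_mono)
  also have "\<dots> \<le> X * (1 / (1 - u))" using assms m(1) by (intro mult_right_mono) auto
  finally show ?thesis by simp
qed

text \<open>Counting down from the largest index turns the sum into a decreasing geometric
  one.\<close>

lemma sum_geometric_up_le:
  fixes v c X :: real
  assumes "finite I" "1 < v" "0 \<le> c" "0 \<le> X" "\<And>i. i \<in> I \<Longrightarrow> c * v ^ i \<le> X"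
  shows "(\<Sum>i\<in>I. c * v ^ i) \<le> X / (1 - 1 / v)"
proof (cases "I = {}")
  case True
  then show ?thesis using assms by simp
next
  case False
  define m where "m = Max I"
  have m: "m \<in> I" "\<And>i. i \<in> I \<Longrightarrow> i \<le> m" using False assms(1) by (auto simp: m_def)
  have inj: "inj_on (\<lambda>i. m - i) I" using m(2) by (intro inj_onI) (metis diff_diff_cancel)
  have eq: "c * v ^ i = (c * v ^ m) * (1 / v) ^ (m - i)" if "i \<in> I" for i
  proof -
    have "v ^ m = v ^ i * v ^ (m - i)" using m(2)[OF that] by (metis le_add_diff_inverse power_add)
    then show ?thesis using assms(2) by (simp add: power_divide)
  qed
  have "(\<Sum>i\<in>I. c * v ^ i) = (\<Sum>k\<in>(\<lambda>i. m - i) ` I. (c * v ^ m) * (1 / v) ^ k)"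
    by (simp add: sum.reindex[OF inj] eq)
  also have "\<dots> \<le> X / (1 - 1 / v)"
    using assms eq by (intro sum_geometric_le) auto
  finally show ?thesis .
qed

text \<open>Index \<open>(s, j, i)\<close>: denominators in \<open>{2^j..<2^(j+1)}\<close>, larger coefficient of the line in
  \<open>{2^i..<2^(i+1)}\<close>, and \<open>s\<close> tells which of the two coefficients is larger.\<close>

definition line_classes :: "real \<Rightarrow> real \<Rightarrow> (bool \<times> nat \<times> nat) set" where
  "line_classes \<epsilon> Q = {(s, j, i). 2 ^ j \<le> \<epsilon> * Q \<and> 2 ^ i \<le> Q}"

fun class_obstacle :: "real \<Rightarrow> real \<Rightarrow> bool \<times> nat \<times> nat \<Rightarrow> (real \<times> real) set" where
  "class_obstacle \<epsilon> Q (s, j, i) =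
     (if s then obstacle \<epsilon> (line_bound Q j) i j else prod.swap -` obstacle \<epsilon> (line_bound Q j) i j)"

text \<open>The radius up to which \<open>obstacle_near_line\<close> puts the whole class into one
  strip.\<close>

fun class_scale :: "bool \<times> nat \<times> nat \<Rightarrow> real" where
  "class_scale (s, j, i) = (1/2) ^ (i + j + 5)"

fun class_width :: "real \<Rightarrow> real \<Rightarrow> bool \<times> nat \<times> nat \<Rightarrow> real" where
  "class_width \<epsilon> Q (s, j, i) = 3 * \<epsilon> * line_bound Q j * (1/2) ^ (i + j)"

lemma finite_power_le: "finite {i. (2::real) ^ i \<le> X}"
proof -
  obtain n where n: "X < 2 ^ n" using real_arch_pow[of 2 X] by auto
  have "{i. (2::real) ^ i \<le> X} \<subseteq> {..n}"
  proof
    fix i assume "i \<in> {i. (2::real) ^ i \<le> X}"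
    then have "(2::real) ^ i < 2 ^ n" by (intro le_less_trans[OF _ n]) simp
    then show "i \<in> {..n}" by simp
  qed
  then show ?thesis using finite_subset by blast
qed

lemma finite_line_classes: "finite (line_classes \<epsilon> Q)"
proof -
  have "line_classes \<epsilon> Q \<subseteq> UNIV \<times> {j. 2 ^ j \<le> \<epsilon> * Q} \<times> {i. 2 ^ i \<le> Q}"
    by (auto simp: line_classes_def)
  then show ?thesis by (rule finite_subset) (intro finite_cartesian_product finite_power_le, simp)
qed

lemma line_bound_nonneg: "0 \<le> Q \<Longrightarrow> 0 \<le> line_bound Q j"
  by (simp add: line_bound_def)

lemma sum_bool_Sigma:
  assumes "finite A" "\<And>j. finite (B j)"
  shows "(\<Sum>\<kappa>\<in>(SIGMA s:(UNIV::bool set). Sigma A B). f \<kappa>) = (\<Sum>s\<in>UNIV. \<Sum>j\<in>A. \<Sum>i\<in>B j. f (s, j, i))"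
  using assms by (simp add: sum.Sigma split_def)

text \<open>For fixed \<open>j\<close> the powers of the widths decay geometrically in
  \<open>i\<close>, from a first term controlled by \<open>\<Theta>\<close>. The remaining factors
  grow with \<open>j\<close> like powers of \<open>line_bound Q j\<close>, that is geometrically, up
  to a last term controlled by \<open>\<Lambda>\<close>. The factor 2 counts the values of
  \<open>s\<close>.\<close>

lemma sum_class_width_le:
  fixes \<gamma> :: real
  assumes \<gamma>: "0 < \<gamma>" and \<epsilon>: "0 < \<epsilon>" and Q: "0 < Q"
    and J: "J \<subseteq> line_classes \<epsilon> Q" and \<Lambda>: "0 \<le> \<Lambda>" and \<Theta>: "0 \<le> \<Theta>"
    and bd: "\<And>s j i. (s, j, i) \<in> J \<Longrightarrow> line_bound Q j \<le> \<Lambda> \<and> (1/2) ^ (i + j) \<le> \<Theta>"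
  shows "(\<Sum>\<kappa>\<in>J. class_width \<epsilon> Q \<kappa> powr \<gamma>) \<le>
    2 * (3 * \<epsilon> * \<Lambda> * \<Theta>) powr \<gamma> / ((1 - (1/2) powr \<gamma>) * (1 - 1 / 2 powr (\<gamma> / 2)))"
proof -
  define u where "u = (1/2::real) powr \<gamma>"
  define v where "v = (2::real) powr (\<gamma> / 2)"
  have u: "0 < u" "u < 1" using \<gamma> powr_less_mono2[of \<gamma> "1/2" 1] by (auto simp: u_def)
  have v: "1 < v" using \<gamma> by (simp add: v_def)
  define Js where "Js = {j. 2 ^ j \<le> \<epsilon> * Q \<and> line_bound Q j \<le> \<Lambda>}"
  define Is where "Is j = {i. 2 ^ i \<le> Q \<and> (1/2) ^ (i + j) \<le> \<Theta>}" for j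
  have fin: "finite Js" "finite (Is j)" for j
    by (rule finite_subset[OF _ finite_power_le[of "\<epsilon> * Q"]], auto simp: Js_def)
       (rule finite_subset[OF _ finite_power_le[of Q]], auto simp: Is_def)
  have pu: "((1/2) ^ n) powr \<gamma> = u ^ n" for n
    by (simp add: u_def powr_realpow[symmetric] powr_powr powr_power mult.commute)
  define W where "W j = (3 * \<epsilon> * line_bound Q j) powr \<gamma>" for j
  have w: "class_width \<epsilon> Q (s, j, i) powr \<gamma> = W j * (u ^ j * u ^ i)" for s j i
    unfolding class_width.simps powr_mult[of "3 * \<epsilon> * line_bound Q j"] pu W_def by (simp only: power_add mult.commute)
  have lb: "line_bound Q j powr \<gamma> = (2 / Q) powr (\<gamma> / 2) * v ^ j" for j
  proof -
    have "line_bound Q j powr \<gamma> = (2 / Q * 2 ^ j) powr (\<gamma> / 2)"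
      using Q by (simp add: line_bound_def powr_half_sqrt[symmetric] powr_powr)
    also have "\<dots> = (2 / Q) powr (\<gamma> / 2) * (2 ^ j) powr (\<gamma> / 2)"
      by (rule powr_mult)
    also have "((2::real) ^ j) powr (\<gamma> / 2) = (2 powr real j) powr (\<gamma> / 2)" by (simp add: powr_realpow)
    also have "\<dots> = v powr real j" unfolding v_def powr_powr by (simp only: mult.commute)
    also have "\<dots> = v ^ j" using v by (simp add: powr_realpow)
    finally show ?thesis .
  qed
  have inner: "(\<Sum>i\<in>Is j. u ^ j * u ^ i) \<le> \<Theta> powr \<gamma> / (1 - u)" for j
  proof (rule sum_geometric_le[OF fin(2) u])
    fix i assume "i \<in> Is j"
    then have "((1/2) ^ (i + j)) powr \<gamma> \<le> \<Theta> powr \<gamma>" using \<gamma> by (intro powr_mono2) (auto simp: Is_def)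
    then show "u ^ j * u ^ i \<le> \<Theta> powr \<gamma>" unfolding pu by (simp add: power_add mult.commute)
  qed (use u in auto)
  have outer: "(\<Sum>j\<in>Js. (2 / Q) powr (\<gamma> / 2) * v ^ j) \<le> \<Lambda> powr \<gamma> / (1 - 1 / v)"
  proof (rule sum_geometric_up_le[OF fin(1) v])
    fix j assume "j \<in> Js"
    then have "line_bound Q j powr \<gamma> \<le> \<Lambda> powr \<gamma>"
      using \<gamma> Q line_bound_nonneg[of Q j] by (intro powr_mono2) (auto simp: Js_def)
    then show "(2 / Q) powr (\<gamma> / 2) * v ^ j \<le> \<Lambda> powr \<gamma>" by (simp add: lb)
  qed auto
  have "J \<subseteq> (SIGMA s:UNIV. SIGMA j:Js. Is j)"
  proof
    fix \<kappa> assume \<kappa>: "\<kappa> \<in> J"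
    obtain s j i where [simp]: "\<kappa> = (s, j, i)" by (cases \<kappa>)
    have "(s, j, i) \<in> line_classes \<epsilon> Q" using J \<kappa> by auto
    then show "\<kappa> \<in> (SIGMA s:UNIV. SIGMA j:Js. Is j)"
      using bd[of s j i] \<kappa> by (simp add: Js_def Is_def line_classes_def)
  qed
  then have "(\<Sum>\<kappa>\<in>J. class_width \<epsilon> Q \<kappa> powr \<gamma>) \<le>
      (\<Sum>\<kappa>\<in>(SIGMA s:UNIV. SIGMA j:Js. Is j). class_width \<epsilon> Q \<kappa> powr \<gamma>)"
    using fin by (intro sum_mono2 finite_SigmaI) auto
  also have "\<dots> = (\<Sum>s\<in>UNIV. \<Sum>j\<in>Js. \<Sum>i\<in>Is j. class_width \<epsilon> Q (s, j, i) powr \<gamma>)"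
    by (rule sum_bool_Sigma[OF fin])
  also have "\<dots> = 2 * (\<Sum>j\<in>Js. W j * (\<Sum>i\<in>Is j. u ^ j * u ^ i))"
    unfolding w sum_distrib_left[symmetric] by (simp only: sum_constant) simp
  also have "\<dots> \<le> 2 * (\<Sum>j\<in>Js. W j * (\<Theta> powr \<gamma> / (1 - u)))"
    by (intro mult_left_mono sum_mono inner) (simp_all add: W_def)
  also have "\<dots> = 2 * ((\<Theta> powr \<gamma> / (1 - u)) * (\<Sum>j\<in>Js. W j))"
    by (simp only: sum_distrib_right[symmetric] mult.commute)
  also have "(\<Sum>j\<in>Js. W j) = (3 * \<epsilon>) powr \<gamma> * (\<Sum>j\<in>Js. (2 / Q) powr (\<gamma> / 2) * v ^ j)"
    unfolding W_def powr_mult lb sum_distrib_left by (simp only: mult.assoc)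
  also have "2 * ((\<Theta> powr \<gamma> / (1 - u)) * ((3 * \<epsilon>) powr \<gamma> * (\<Sum>j\<in>Js. (2 / Q) powr (\<gamma> / 2) * v ^ j)))
      \<le> 2 * ((\<Theta> powr \<gamma> / (1 - u)) * ((3 * \<epsilon>) powr \<gamma> * (\<Lambda> powr \<gamma> / (1 - 1 / v))))"
    using u by (intro mult_left_mono outer) auto
  also have "\<dots> = 2 * (3 * \<epsilon> * \<Lambda> * \<Theta>) powr \<gamma> / ((1 - u) * (1 - 1 / v))"
    by (simp add: powr_mult)
  finally show ?thesis by (simp add: u_def v_def)
qed

lemma line_bound_le:
  assumes "0 < Q" "2 ^ j \<le> x" shows "line_bound Q j \<le> sqrt (2 * x / Q)"
  using assms by (simp add: line_bound_def divide_right_mono)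

lemma obstacle_family_lines:
  assumes "0 < \<epsilon>" "\<epsilon> \<le> 1 / 28" "0 < Q"
  shows "obstacle_family (class_obstacle \<epsilon> Q) class_scale (class_width \<epsilon> Q) (line_classes \<epsilon> Q)"
  unfolding obstacle_family_def
proof (intro conjI finite_line_classes ballI allI impI)
  fix \<kappa> assume \<kappa>: "\<kappa> \<in> line_classes \<epsilon> Q"
  obtain s j i where [simp]: "\<kappa> = (s, j, i)" by (cases \<kappa>)
  have pos: "0 < line_bound Q j" using assms by (simp add: line_bound_def)
  then show "0 < class_width \<epsilon> Q \<kappa>" "0 < class_scale \<kappa>" using assms by simp_all
  \<comment> \<open>Denominators below \<open>\<epsilon> * Q\<close> have
    \<open>\<mu> \<le> 1\<close>, so the smallness of \<open>\<mu> * \<epsilon>\<close> needed for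
    \<open>obstacle_near_line\<close> follows from that of \<open>\<epsilon>\<close>.\<close>
  have "line_bound Q j \<le> sqrt (2 * (\<epsilon> * Q) / Q)"
    using \<kappa> assms by (intro line_bound_le) (auto simp: line_classes_def)
  also have "\<dots> \<le> 1" using assms by simp
  finally have "line_bound Q j * \<epsilon> \<le> 1 * (1 / 28)" using assms pos by (intro mult_mono) auto
  then have 1: "line_bound Q j * \<epsilon> \<le> 1 / 28" by simp
  fix c :: "real \<times> real" and \<rho> :: real
  assume "0 < \<rho> \<and> \<rho> \<le> class_scale \<kappa>"
  then have \<rho>: "\<rho> \<le> (1/2) ^ (i + j + 5)" by simp
  show "\<exists>L. affine_hyperplane L \<and> class_obstacle \<epsilon> Q \<kappa> \<inter> cball c \<rho> \<subseteq> hyperplane_nbhd L (class_width \<epsilon> Q \<kappa>)"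
  proof (cases s)
    case True
    then show ?thesis using obstacle_near_line[OF assms(1) less_imp_le[OF pos] 1 \<rho>, of c] by simp
  next
    case False
    \<comment> \<open>Exchanging the coordinates is an isometry that maps lines to lines, so the
      strip can be transported back.\<close>
    obtain L where L: "affine_hyperplane L"
      "obstacle \<epsilon> (line_bound Q j) i j \<inter> cball (prod.swap c) \<rho>
         \<subseteq> hyperplane_nbhd L (3 * \<epsilon> * line_bound Q j * (1/2) ^ (i + j))"
      using obstacle_near_line[OF assms(1) less_imp_le[OF pos] 1 \<rho>] by blast
    have iso: "dist (prod.swap z) (prod.swap w) = dist z w" for z w :: "real \<times> real"
      by (cases z; cases w) (simp add: dist_Pair_Pair add.commute)
    obtain a b where ab: "a \<noteq> 0" "L = {z. a \<bullet> z = b}" using L(1) by (auto simp: affine_hyperplane_def)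
    have "prod.swap -` L = {z. prod.swap a \<bullet> z = b}"
      unfolding ab(2) by (cases a) (auto simp: add.commute)
    moreover have "prod.swap a \<noteq> 0" using ab(1) by (cases a) (auto simp: zero_prod_def)
    ultimately have h: "affine_hyperplane (prod.swap -` L)" unfolding affine_hyperplane_def by blast
    have "infdist (prod.swap z) L = infdist z (prod.swap -` L)" for z
    proof -
      have "L = prod.swap ` (prod.swap -` L)" by (simp add: surj_image_vimage_eq)
      then have "dist (prod.swap z) ` L = dist z ` (prod.swap -` L)"
        using iso by (metis (no_types, lifting) image_cong image_image)
      moreover have "L \<noteq> {}" "prod.swap -` L \<noteq> {}"
        using affine_hyperplane_nonempty L(1) h by auto
      ultimately show ?thesis by (simp add: infdist_def)
    qed
    then have inf: "infdist (prod.swap z) L = infdist z (prod.swap -` L)" for z .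
    have "prod.swap -` obstacle \<epsilon> (line_bound Q j) i j \<inter> cball c \<rho>
        \<subseteq> hyperplane_nbhd (prod.swap -` L) (3 * \<epsilon> * line_bound Q j * (1/2) ^ (i + j))"
    proof
      fix w assume w: "w \<in> prod.swap -` obstacle \<epsilon> (line_bound Q j) i j \<inter> cball c \<rho>"
      then have "prod.swap w \<in> obstacle \<epsilon> (line_bound Q j) i j \<inter> cball (prod.swap c) \<rho>"
        by (simp add: iso)
      then have "prod.swap w \<in> hyperplane_nbhd L (3 * \<epsilon> * line_bound Q j * (1/2) ^ (i + j))"
        using L(2) by (rule subsetD[rotated])
      then show "w \<in> hyperplane_nbhd (prod.swap -` L) (3 * \<epsilon> * line_bound Q j * (1/2) ^ (i + j))"
        unfolding hyperplane_nbhd_def mem_Collect_eq inf .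
    qed
    then show ?thesis using h False by auto
  qed
qed

lemma finite_positive_lower_bound:
  fixes f :: "'k \<Rightarrow> real"
  assumes "finite K" "\<And>\<kappa>. \<kappa> \<in> K \<Longrightarrow> 0 < f \<kappa>"
  shows "\<exists>m>0. \<forall>\<kappa>\<in>K. m \<le> f \<kappa>"
  using assms
proof (induction K rule: finite_induct)
  case empty
  then show ?case by (intro exI[of _ 1]) simp
next
  case (insert x K)
  then obtain m where "0 < m" "\<forall>\<kappa>\<in>K. m \<le> f \<kappa>" by auto
  then show ?case using insert.prems[of x] by (intro exI[of _ "min m (f x)"]) auto
qed

text \<open>A scale comparable to \<open>x\<close> bounds \<open>(1/2) ^ (i + j)\<close> by a
  multiple of \<open>x\<close>, and \<open>line_bound\<close> is at most 1. So the sum is at most a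
  constant times \<open>(\<epsilon> * x) powr \<gamma>\<close>, with a constant that depends only on
  \<open>\<beta>\<close> and \<open>\<gamma>\<close>.\<close>

lemma new_line_classes_sum:
  fixes \<gamma> \<eta> \<beta> :: real
  assumes \<beta>: "0 < \<beta>" and \<gamma>: "0 < \<gamma>" and \<eta>: "0 < \<eta>"
  obtains \<epsilon> where "0 < \<epsilon>" "\<epsilon> \<le> 1 / 28"
    "\<And>Q x. 0 < Q \<Longrightarrow> 0 < x \<Longrightarrow>
      (\<Sum>\<kappa> | \<kappa> \<in> line_classes \<epsilon> Q \<and> x \<le> class_scale \<kappa> \<and> \<beta> * class_scale \<kappa> \<le> x.
         class_width \<epsilon> Q \<kappa> powr \<gamma>) \<le> \<eta> * x powr \<gamma>"
proof -
  define C where "C = (1 - (1/2) powr \<gamma>) * (1 - 1 / 2 powr (\<gamma> / 2))"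
  have C: "0 < C" using \<gamma> powr_less_mono2[of \<gamma> "1/2" 1] by (simp add: C_def)
  \<comment> \<open>Chosen such that \<open>2 * (96 * \<epsilon> / \<beta>) powr \<gamma> / C \<le>
    \<eta>\<close>; here 96 is the factor 3 of the width times the \<open>2 ^ 5\<close> of the
    scale.\<close>
  define \<epsilon> where "\<epsilon> = min (1 / 28) (\<beta> / 96 * (\<eta> * C / 2) powr (1 / \<gamma>))"
  have \<epsilon>: "0 < \<epsilon>" "\<epsilon> \<le> 1 / 28" using \<beta> \<eta> C by (simp_all add: \<epsilon>_def)
  show ?thesis
  proof (rule that[OF \<epsilon>])
    fix Q x :: real assume Q: "0 < Q" and x: "0 < x"
    have bd: "line_bound Q j \<le> 1 \<and> (1/2) ^ (i + j) \<le> 32 * x / \<beta>"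
      if "(s, j, i) \<in> {\<kappa>. \<kappa> \<in> line_classes \<epsilon> Q \<and> x \<le> class_scale \<kappa> \<and> \<beta> * class_scale \<kappa> \<le> x}"
      for s j i
    proof
      have "2 ^ j \<le> \<epsilon> * Q" "\<beta> * (1/2) ^ (i + j + 5) \<le> x" using that by (simp_all add: line_classes_def)
      then have "line_bound Q j \<le> sqrt (2 * (\<epsilon> * Q) / Q)" using Q by (intro line_bound_le)
      also have "\<dots> \<le> 1" using Q \<epsilon> by simp
      finally show "line_bound Q j \<le> 1" .
      have "\<beta> * (1/2) ^ (i + j) \<le> 32 * x"
        using \<open>\<beta> * (1/2) ^ (i + j + 5) \<le> x\<close> unfolding power_add[of _ "i + j" 5] by (simp add: field_simps)
      then show "(1/2) ^ (i + j) \<le> 32 * x / \<beta>" using \<beta> by (simp add: field_simps)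
    qed
    have "(\<Sum>\<kappa> | \<kappa> \<in> line_classes \<epsilon> Q \<and> x \<le> class_scale \<kappa> \<and> \<beta> * class_scale \<kappa> \<le> x.
         class_width \<epsilon> Q \<kappa> powr \<gamma>) \<le> 2 * (3 * \<epsilon> * 1 * (32 * x / \<beta>)) powr \<gamma> / C"
      unfolding C_def using \<beta> x by (intro sum_class_width_le[OF \<gamma> \<epsilon>(1) Q _ _ _ bd]) auto
    also have "3 * \<epsilon> * 1 * (32 * x / \<beta>) = (96 * \<epsilon> / \<beta>) * x" by simp
    also have "2 * ((96 * \<epsilon> / \<beta>) * x) powr \<gamma> / C \<le> 2 * ((\<eta> * C / 2) * x powr \<gamma>) / C"
    proof -
      have "96 * \<epsilon> / \<beta> \<le> (\<eta> * C / 2) powr (1 / \<gamma>)"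
      proof -
        have "\<epsilon> \<le> \<beta> / 96 * (\<eta> * C / 2) powr (1 / \<gamma>)" by (simp add: \<epsilon>_def)
        then show ?thesis using \<beta> by (simp add: field_simps)
      qed
      then have "(96 * \<epsilon> / \<beta>) powr \<gamma> \<le> ((\<eta> * C / 2) powr (1 / \<gamma>)) powr \<gamma>"
        using \<gamma> \<epsilon> \<beta> by (intro powr_mono2) auto
      also have "\<dots> = \<eta> * C / 2" using \<gamma> \<eta> C by (simp add: powr_powr)
      finally show ?thesis
        unfolding powr_mult using C by (intro divide_right_mono mult_left_mono mult_right_mono) auto
    qed
    also have "\<dots> = \<eta> * x powr \<gamma>" using C by simp
    finally show "(\<Sum>\<kappa> | \<kappa> \<in> line_classes \<epsilon> Q \<and> x \<le> class_scale \<kappa> \<and> \<beta> * class_scale \<kappa> \<le> x.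
         class_width \<epsilon> Q \<kappa> powr \<gamma>) \<le> \<eta> * x powr \<gamma>" .
  qed
qed

text \<open>Active classes have scale at least \<open>\<beta> * R\<close>, which bounds
  \<open>2 ^ j\<close> independently of \<open>Q\<close>. Hence their \<open>line_bound\<close>, and
  with it their widths, tend to zero as \<open>Q\<close> grows.\<close>

lemma initial_potential_small:
  fixes \<gamma> \<beta> \<epsilon> R :: real
  assumes \<beta>: "0 < \<beta>" and \<gamma>: "0 < \<gamma>" and \<epsilon>: "0 < \<epsilon>" and R: "0 < R"
  obtains Q0 where "\<And>Q c \<rho>. Q0 \<le> Q \<Longrightarrow> 0 < Q \<Longrightarrow> \<beta> * R \<le> \<rho> \<Longrightarrow>
    potential \<gamma> (class_obstacle \<epsilon> Q) class_scale (class_width \<epsilon> Q) (line_classes \<epsilon> Q) c \<rho>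
      \<le> (\<beta> / 2 * \<rho>) powr \<gamma>"
proof -
  define C where "C = (1 - (1/2) powr \<gamma>) * (1 - 1 / 2 powr (\<gamma> / 2))"
  have C: "0 < C" using \<gamma> powr_less_mono2[of \<gamma> "1/2" 1] by (simp add: C_def)
  \<comment> \<open>The value of \<open>line_bound\<close> at which the sum in
    \<open>sum_class_width_le\<close> becomes
    \<open>(\<beta> / 2 * (\<beta> * R)) powr \<gamma>\<close>.\<close>
  define X where "X = (\<beta> / 2 * (\<beta> * R)) * (C / 2) powr (1 / \<gamma>) / (3 * \<epsilon>)"
  have X: "0 < X" using \<beta> R C \<epsilon> by (simp add: X_def)
  show ?thesis
  proof (rule that[of "2 / (\<beta> * R * X\<^sup>2)"])
    fix Q c \<rho> assume QX: "2 / (\<beta> * R * X\<^sup>2) \<le> Q" and Q: "0 < Q" and \<rho>: "\<beta> * R \<le> \<rho>"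
    let ?H = "hit_obstacles (class_obstacle \<epsilon> Q) class_scale (line_classes \<epsilon> Q) c \<rho>"
    have bd: "line_bound Q j \<le> X \<and> (1/2) ^ (i + j) \<le> (1::real)" if "(s, j, i) \<in> ?H" for s j i
    proof
      have "\<beta> * R \<le> (1/2) ^ (i + j + 5)" using that \<rho> by (simp add: hit_obstacles_def)
      also have "\<dots> \<le> (1/2) ^ j" by (intro power_decreasing) auto
      finally have "2 ^ j \<le> 1 / (\<beta> * R)" using \<beta> R by (simp add: field_simps)
      then have "line_bound Q j \<le> sqrt (2 * (1 / (\<beta> * R)) / Q)" using Q by (intro line_bound_le)
      also have "2 * (1 / (\<beta> * R)) / Q \<le> X\<^sup>2" using QX Q X \<beta> R by (simp add: field_simps)
      then have "sqrt (2 * (1 / (\<beta> * R)) / Q) \<le> X" using X by (intro real_le_lsqrt) auto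
      finally show "line_bound Q j \<le> X" .
      show "(1/2) ^ (i + j) \<le> (1::real)" by (intro power_le_one) auto
    qed
    have "potential \<gamma> (class_obstacle \<epsilon> Q) class_scale (class_width \<epsilon> Q) (line_classes \<epsilon> Q) c \<rho>
        \<le> 2 * (3 * \<epsilon> * X * 1) powr \<gamma> / C"
      unfolding potential_def C_def
      using X by (intro sum_class_width_le[OF \<gamma> \<epsilon> Q _ _ _ bd])
         (auto simp: hit_obstacles_def simp del: class_obstacle.simps)
    also have "3 * \<epsilon> * X * 1 = (\<beta> / 2 * (\<beta> * R)) * (C / 2) powr (1 / \<gamma>)"
      using \<epsilon> by (simp add: X_def)
    also have "2 * (\<dots>) powr \<gamma> / C = (\<beta> / 2 * (\<beta> * R)) powr \<gamma>"
      unfolding powr_mult[of _ "(C / 2) powr (1 / \<gamma>)"] powr_powr using \<gamma> C by simp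
    also have "\<dots> \<le> (\<beta> / 2 * \<rho>) powr \<gamma>" using \<beta> \<gamma> R \<rho> by (intro powr_mono2 mult_left_mono) auto
    finally show "potential \<gamma> (class_obstacle \<epsilon> Q) class_scale (class_width \<epsilon> Q) (line_classes \<epsilon> Q) c \<rho>
      \<le> (\<beta> / 2 * \<rho>) powr \<gamma>" .
  qed
qed

section \<open>Passing to ever larger values of \<open>Q\<close>\<close>

text \<open>Radii and values of \<open>Q\<close> are chosen alternately: \<open>Q n\<close> so large
  that the potential is small from radius \<open>R n\<close> on, then \<open>R (Suc n)\<close> below
  the scales and widths of all the finitely many classes for \<open>Q n\<close>. The constant
  \<open>\<epsilon>\<close> is fixed beforehand.\<close>

theorem line_avoiding_strategy:
  fixes \<beta> :: real
  assumes \<beta>: "0 < \<beta>" "\<beta> < 1"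
  obtains \<epsilon> and \<sigma> :: "(real \<times> real) haw_strategy" where "0 < \<epsilon>" "\<epsilon> \<le> 1 / 28"
    "\<And>h c \<rho>. 0 < \<rho> \<Longrightarrow> alice_move \<beta> \<rho> (\<sigma> (h @ [(c, \<rho>)]))"
    "\<And>U B z M. bob_play \<beta> U \<sigma> B \<Longrightarrow> (\<lambda>n. snd (B n)) \<longlonglongrightarrow> 0 \<Longrightarrow>
       (\<And>n. z \<in> cball (fst (B n)) (snd (B n))) \<Longrightarrow>
       \<exists>Q\<ge>M. \<forall>\<kappa>\<in>line_classes \<epsilon> Q. z \<notin> class_obstacle \<epsilon> Q \<kappa>"
proof -
  obtain \<gamma> \<eta> where \<gamma>: "0 < \<gamma>" and \<eta>: "0 < \<eta>" and step: "\<forall>(Ob :: bool \<times> nat \<times> nat \<Rightarrow> (real \<times> real) set) \<tau> r K c \<rho>.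
      obstacle_family Ob \<tau> r K \<and> 0 < \<rho> \<and>
        potential \<gamma> Ob \<tau> r K c \<rho> \<le> (\<beta> / 2 * \<rho>) powr \<gamma> \<and>
        (\<forall>x>0. (\<Sum>\<kappa> | \<kappa> \<in> K \<and> x \<le> \<tau> \<kappa> \<and> \<beta> * \<tau> \<kappa> \<le> x. r \<kappa> powr \<gamma>) \<le> \<eta> * x powr \<gamma>) \<longrightarrow>
      (\<exists>L. affine_hyperplane L \<and> (\<forall>c' \<rho>'. \<beta> * \<rho> \<le> \<rho>' \<and>
         cball c' \<rho>' \<subseteq> cball c \<rho> - hyperplane_nbhd L (\<beta> * \<rho>) \<longrightarrow>
         potential \<gamma> Ob \<tau> r K c' \<rho>' \<le> (\<beta> / 2 * \<rho>') powr \<gamma>))"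
    using potential_step[OF \<beta>] by (elim exE conjE)
  obtain \<epsilon> where \<epsilon>: "0 < \<epsilon>" "\<epsilon> \<le> 1 / 28" and new: "\<And>Q x. 0 < Q \<Longrightarrow> 0 < x \<Longrightarrow>
      (\<Sum>\<kappa> | \<kappa> \<in> line_classes \<epsilon> Q \<and> x \<le> class_scale \<kappa> \<and> \<beta> * class_scale \<kappa> \<le> x.
         class_width \<epsilon> Q \<kappa> powr \<gamma>) \<le> \<eta> * x powr \<gamma>"
    by (rule new_line_classes_sum[OF \<beta>(1) \<gamma> \<eta>]) blast
  define pot where
    "pot Q = potential \<gamma> (class_obstacle \<epsilon> Q) class_scale (class_width \<epsilon> Q) (line_classes \<epsilon> Q)" for Q
  \<comment> \<open>A pair consists of a radius and the value of \<open>Q\<close> for the phase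
    starting there. The bounds in terms of \<open>n\<close> force the radii to zero and the values
    of \<open>Q\<close> to infinity; \<open>S\<close> says that the next radius lies beyond the end
    of the phase.\<close>
  define P where "P n p \<longleftrightarrow> 0 < fst p \<and> fst p \<le> (1/2) ^ n \<and> 1 + real n \<le> snd p \<and>
      (\<forall>c \<rho>. \<beta> * fst p \<le> \<rho> \<longrightarrow> pot (snd p) c \<rho> \<le> (\<beta> / 2 * \<rho>) powr \<gamma>)" for n :: nat and p
  define S where "S p p' \<longleftrightarrow> fst p' \<le> fst p \<and> (\<forall>\<kappa>\<in>line_classes \<epsilon> (snd p).
      fst p' \<le> class_scale \<kappa> \<and> \<beta> / 2 * fst p' < class_width \<epsilon> (snd p) \<kappa>)" for p p' :: "real \<times> real"
  have ex_Q: "\<exists>Q. P n (R, Q)" if R: "0 < R" "R \<le> (1/2) ^ n" for n R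
  proof -
    obtain Q0 where "\<And>Q c \<rho>. Q0 \<le> Q \<Longrightarrow> 0 < Q \<Longrightarrow> \<beta> * R \<le> \<rho> \<Longrightarrow> pot Q c \<rho> \<le> (\<beta> / 2 * \<rho>) powr \<gamma>"
      unfolding pot_def by (rule initial_potential_small[OF \<beta>(1) \<gamma> \<epsilon>(1) R(1)]) blast
    then have "P n (R, max Q0 (1 + real n))" using R by (simp add: P_def less_max_iff_disj)
    then show ?thesis by blast
  qed
  have "\<exists>F. \<forall>n. P n (F n) \<and> S (F n) (F (Suc n))"
  proof (rule dependent_nat_choice[where Q = "\<lambda>_. S"])
    show "\<exists>p. P 0 p" using ex_Q[of 1 0] by auto
  next
    fix p n assume Pn: "P n p"
    define R where "R = fst p"
    define Q where "Q = snd p"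
    have R: "0 < R" "R \<le> (1/2) ^ n" and Q: "0 < Q" using Pn by (auto simp: P_def R_def Q_def)
    have "\<exists>m>0. \<forall>\<kappa>\<in>line_classes \<epsilon> Q. m \<le> min (class_scale \<kappa>) (class_width \<epsilon> Q \<kappa>)"
      using obstacle_family_lines[OF \<epsilon> Q] finite_line_classes
      by (intro finite_positive_lower_bound) (auto simp: obstacle_family_def simp del: class_scale.simps class_width.simps)
    then obtain m where m: "0 < m" "\<And>\<kappa>. \<kappa> \<in> line_classes \<epsilon> Q \<Longrightarrow> m \<le> class_scale \<kappa>"
      "\<And>\<kappa>. \<kappa> \<in> line_classes \<epsilon> Q \<Longrightarrow> m \<le> class_width \<epsilon> Q \<kappa>" by auto
    define R' where "R' = min (R / 2) m"
    have R': "0 < R'" "R' \<le> (1/2) ^ Suc n" "R' \<le> R" "R' \<le> m" using R m by (auto simp: R'_def)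
    have "\<beta> / 2 * R' < m"
    proof -
      have "\<beta> / 2 * R' < 1 * R'" using \<beta> R' by (intro mult_strict_right_mono) auto
      also have "1 * R' \<le> m" using R' by simp
      finally show ?thesis .
    qed
    then have "S p (R', Q')" for Q'
      using R' m unfolding S_def R_def[symmetric] Q_def[symmetric] by force
    then show "\<exists>p'. P (Suc n) p' \<and> S p p'" using ex_Q[OF R'(1,2)] by blast
  qed
  then obtain F where F: "\<And>n. P n (F n)" "\<And>n. S (F n) (F (Suc n))" by blast
  define R where "R n = fst (F n)" for n
  define Q where "Q n = snd (F n)" for n
  have Q: "0 < Q n" "1 + real n \<le> Q n" for n
    using F(1)[of n] by (auto simp: P_def Q_def)
  have R: "0 < R n" "R n \<le> (1/2) ^ n" "R (Suc n) \<le> R n" for n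
    using F(1)[of n] F(2)[of n] by (auto simp: P_def S_def R_def)
  have pots: "\<beta> * R n \<le> \<rho> \<Longrightarrow> pot (Q n) c \<rho> \<le> (\<beta> / 2 * \<rho>) powr \<gamma>" for n c \<rho>
    using F(1)[of n] unfolding P_def Q_def R_def by blast
  have stop: "R (Suc n) \<le> class_scale \<kappa> \<and> \<beta> / 2 * R (Suc n) < class_width \<epsilon> (Q n) \<kappa>"
    if "\<kappa> \<in> line_classes \<epsilon> (Q n)" for n \<kappa>
    using F(2)[of n] that unfolding S_def R_def Q_def by blast
  define good where "good \<sigma> \<longleftrightarrow> (\<forall>h c \<rho>. 0 < \<rho> \<longrightarrow> alice_move \<beta> \<rho> (\<sigma> (h @ [(c, \<rho>)]))) \<and>
      (\<forall>U B z k. \<forall>\<kappa>\<in>line_classes \<epsilon> (Q k). bob_play \<beta> U \<sigma> B \<and> (\<lambda>n. snd (B n)) \<longlonglongrightarrow> 0 \<and>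
         (\<forall>n. z \<in> cball (fst (B n)) (snd (B n))) \<and> R k < snd (B 0) \<longrightarrow>
         z \<notin> class_obstacle \<epsilon> (Q k) \<kappa>)" for \<sigma> :: "(real \<times> real) haw_strategy"
  have "\<exists>\<sigma>. good \<sigma>"
  proof (rule phase_strategy[where Ob = "\<lambda>k. class_obstacle \<epsilon> (Q k)" and \<tau> = "\<lambda>_. class_scale" and
        r = "\<lambda>k. class_width \<epsilon> (Q k)" and K = "\<lambda>k. line_classes \<epsilon> (Q k)" and R = R, OF \<beta>(1) \<gamma>])
    fix k c \<rho>
    assume "0 < \<rho>" and "potential \<gamma> (class_obstacle \<epsilon> (Q k)) class_scale (class_width \<epsilon> (Q k))
      (line_classes \<epsilon> (Q k)) c \<rho> \<le> (\<beta> / 2 * \<rho>) powr \<gamma>"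
    then show "\<exists>L. affine_hyperplane L \<and> (\<forall>c' \<rho>'. \<beta> * \<rho> \<le> \<rho>' \<and>
         cball c' \<rho>' \<subseteq> cball c \<rho> - hyperplane_nbhd L (\<beta> * \<rho>) \<longrightarrow>
         potential \<gamma> (class_obstacle \<epsilon> (Q k)) class_scale (class_width \<epsilon> (Q k))
           (line_classes \<epsilon> (Q k)) c' \<rho>' \<le> (\<beta> / 2 * \<rho>') powr \<gamma>)"
      by (intro step[rule_format] conjI obstacle_family_lines[OF \<epsilon> Q(1)] allI impI new[OF Q(1)])
  next
    show "\<beta> * R k \<le> \<rho> \<Longrightarrow> potential \<gamma> (class_obstacle \<epsilon> (Q k)) class_scale (class_width \<epsilon> (Q k))
      (line_classes \<epsilon> (Q k)) c \<rho> \<le> (\<beta> / 2 * \<rho>) powr \<gamma>" for k c \<rho>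
      using pots unfolding pot_def .
  next
    fix \<sigma> :: "(real \<times> real) haw_strategy"
    assume "\<And>h c \<rho>. 0 < \<rho> \<Longrightarrow> alice_move \<beta> \<rho> (\<sigma> (h @ [(c, \<rho>)]))" and
      "\<And>U B z k \<kappa>. bob_play \<beta> U \<sigma> B \<Longrightarrow> (\<lambda>n. snd (B n)) \<longlonglongrightarrow> 0 \<Longrightarrow>
       (\<And>n. z \<in> cball (fst (B n)) (snd (B n))) \<Longrightarrow> R k < snd (B 0) \<Longrightarrow>
       \<kappa> \<in> line_classes \<epsilon> (Q k) \<Longrightarrow> z \<notin> class_obstacle \<epsilon> (Q k) \<kappa>"
    then have "good \<sigma>" unfolding good_def by blast
    then show "\<exists>\<sigma>. good \<sigma>" by (intro exI)
  qed (rule finite_line_classes | rule R(1) | rule R(3) | (rule stop, assumption))+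
  then obtain \<sigma> where \<sigma>: "good \<sigma>" ..
  show ?thesis
  proof (rule that[OF \<epsilon>, of \<sigma>])
    show "0 < \<rho> \<Longrightarrow> alice_move \<beta> \<rho> (\<sigma> (h @ [(c, \<rho>)]))" for h c \<rho>
      using \<sigma> unfolding good_def by blast
  next
    fix U B z M
    assume play: "bob_play \<beta> U \<sigma> B" "(\<lambda>n. snd (B n)) \<longlonglongrightarrow> 0" "\<And>n. z \<in> cball (fst (B n)) (snd (B n))"
    have "0 < snd (B 0)" using play(1) by (simp add: bob_play_def)
    then obtain k0 where k0: "(1/2) ^ k0 < snd (B 0)" using real_arch_pow_inv[of "snd (B 0)" "1/2"] by auto
    obtain k1 :: nat where k1: "M \<le> real k1" using real_arch_simple by blast
    \<comment> \<open>From \<open>k0\<close> on, the phases begin below the radius of the first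
      ball, so that they are played in full; \<open>k1\<close> makes \<open>Q k\<close> at least
      \<open>M\<close>.\<close>
    define k where "k = max k0 k1"
    have "R k \<le> (1/2) ^ k0"
      using R(2)[of k] power_decreasing[of k0 k "1/2::real"] by (auto simp: k_def intro: order_trans)
    then have "\<forall>\<kappa>\<in>line_classes \<epsilon> (Q k). z \<notin> class_obstacle \<epsilon> (Q k) \<kappa>"
      using \<sigma> play k0 unfolding good_def by (meson le_less_trans)
    moreover have "M \<le> Q k" using Q(2)[of k] k1 by (simp add: k_def)
    ultimately show "\<exists>Q\<ge>M. \<forall>\<kappa>\<in>line_classes \<epsilon> Q. z \<notin> class_obstacle \<epsilon> Q \<kappa>" by blast
  qed
qed

lemma no_box_if_no_obstacle:
  fixes p q r :: int and z :: "real \<times> real" and a b Q \<epsilon> :: real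
  assumes "\<forall>\<kappa>\<in>line_classes \<epsilon> Q. z \<notin> class_obstacle \<epsilon> Q \<kappa>"
    and "0 < \<epsilon>" "\<epsilon> \<le> 1 / 28" "1 \<le> a" "1 \<le> b" "a * b = Q" "1 \<le> q" "q < \<epsilon> * Q"
    and "\<bar>q * fst z - p\<bar> < \<epsilon> / a"
  shows "\<epsilon> / b \<le> \<bar>q * snd z - r\<bar>"
proof (rule ccontr)
  assume "\<not> \<epsilon> / b \<le> \<bar>q * snd z - r\<bar>"
  moreover have "0 < Q" using assms(4-6) by auto
  ultimately obtain i j where "2 ^ j \<le> \<epsilon> * Q" "2 ^ i \<le> Q"
      "z \<in> obstacle \<epsilon> (line_bound Q j) i j \<or> prod.swap z \<in> obstacle \<epsilon> (line_bound Q j) i j"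
    using assms(2-) by (elim box_in_obstacle[of Q a b q \<epsilon> z p r]) (simp_all add: not_le)
  then have "(True, j, i) \<in> line_classes \<epsilon> Q" "(False, j, i) \<in> line_classes \<epsilon> Q"
      "z \<in> class_obstacle \<epsilon> Q (True, j, i) \<or> z \<in> class_obstacle \<epsilon> Q (False, j, i)"
    by (simp_all add: line_classes_def)
  then show False using assms(1) by blast
qed

section \<open>Lattices without short vectors\<close>

lemma exists_int_near: "\<exists>m::int. \<bar>x + m\<bar> \<le> (1/2::real)"
  by (rule exI[of _ "- round x"]) (use of_int_round_abs_le[of x] in \<open>simp add: abs_minus_commute\<close>)

text \<open>Reducing the projection of \<open>w\<close> to the plane of \<open>u\<close> and \<open>v\<close> modulo the lattice spanned by
  \<open>u\<close> and \<open>v\<close> makes its squared length at most \<open>(norm u\<^sup>2 + norm v\<^sup>2) / 4 \<le> norm w\<^sup>2 / 2\<close>, so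
  that the component of \<open>w\<close> orthogonal to this plane has at least half of the squared length of \<open>w\<close>.\<close>

lemma reduced_basis_bound_sorted:
  fixes u v w :: "real^3"
  assumes \<epsilon>: "0 < \<epsilon>" "\<epsilon> \<le> norm u" and sorted: "norm u \<le> norm v" "norm v \<le> norm w"
    and det: "(cross3 u v \<bullet> w)\<^sup>2 = 1"
    and minv: "\<And>m::int. norm v \<le> norm (v + of_int m *\<^sub>R u)"
    and minw: "\<And>m n::int. norm w \<le> norm (w + of_int m *\<^sub>R u + of_int n *\<^sub>R v)"
  shows "(norm w)\<^sup>2 \<le> 8 / (3 * \<epsilon> ^ 4)"
proof -
  define a where "a = u \<bullet> u"
  define b where "b = u \<bullet> v"
  define c where "c = v \<bullet> v"
  define e where "e = w \<bullet> w"
  define n where "n = cross3 u v"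
  define N where "N = n \<bullet> n"
  have \<epsilon>a: "\<epsilon>\<^sup>2 \<le> a" using \<epsilon> unfolding a_def power2_norm_eq_inner[symmetric] by (intro power_mono) auto
  have ac: "a \<le> c" "c \<le> e" using sorted
    unfolding a_def c_def e_def power2_norm_eq_inner[symmetric] by (auto intro: power_mono)
  have a: "0 < a" using \<epsilon>a \<epsilon> by (meson less_le_trans zero_less_power)
  have orth: "u \<bullet> n = 0" "v \<bullet> n = 0" by (simp_all add: n_def dot_cross_self)
  have N: "N = a * c - b\<^sup>2"
    using norm_cross[of u v] unfolding power2_norm_eq_inner by (simp add: N_def n_def a_def b_def c_def)
  \<comment> \<open>Adding \<open>u\<close> to \<open>v\<close> or subtracting it does not shorten
    \<open>v\<close>. This makes \<open>N\<close>, the Gram determinant of \<open>u\<close> and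
    \<open>v\<close>, at least \<open>3 / 4\<close> of the product of their squared lengths.\<close>
  have "\<bar>b\<bar> \<le> a / 2"
  proof -
    have "v \<bullet> v \<le> (v + of_int m *\<^sub>R u) \<bullet> (v + of_int m *\<^sub>R u)" for m
      using power_mono[OF minv[of m], of 2] by (simp add: power2_norm_eq_inner)
    from this[of 1] this[of "-1"] show ?thesis
      by (simp add: a_def b_def inner_simps inner_commute)
  qed
  then have "b\<^sup>2 \<le> (a / 2)\<^sup>2" using a by (simp add: abs_le_square_iff[symmetric])
  moreover have "a * a \<le> a * c" using a ac by simp
  ultimately have N34: "3 / 4 * (a * c) \<le> N" unfolding N by (simp add: power2_eq_square)
  have "\<epsilon>\<^sup>2 * \<epsilon>\<^sup>2 \<le> a * c" using \<epsilon>a ac a by (intro mult_mono) auto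
  then have N\<epsilon>: "3 / 4 * \<epsilon> ^ 4 \<le> N" using N34 by (simp add: power_add[symmetric])
  moreover have "0 < 3 / 4 * \<epsilon> ^ 4" using \<epsilon>(1) by simp
  ultimately have N0: "0 < N" by linarith
  \<comment> \<open>The coefficients of \<open>w\<close> with respect to \<open>u\<close>,
    \<open>v\<close> and the normal vector \<open>n\<close>, by Cramer's rule.\<close>
  define \<alpha> where "\<alpha> = cross3 w v \<bullet> n / N"
  define \<delta> where "\<delta> = cross3 u w \<bullet> n / N"
  define D where "D = n \<bullet> w"
  have "N *\<^sub>R w = (cross3 w v \<bullet> n) *\<^sub>R u + (cross3 u w \<bullet> n) *\<^sub>R v + D *\<^sub>R n"
    unfolding N_def D_def n_def
    by (simp add: cross3_def vec_eq_iff forall_3 inner_vec_def sum_3) algebra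
  moreover have "w = (1 / N) *\<^sub>R (N *\<^sub>R w)" using N0 by simp
  ultimately have "w = (1 / N) *\<^sub>R ((cross3 w v \<bullet> n) *\<^sub>R u + (cross3 u w \<bullet> n) *\<^sub>R v + D *\<^sub>R n)"
    by (simp only:)
  then have w: "w = \<alpha> *\<^sub>R u + \<delta> *\<^sub>R v + (D / N) *\<^sub>R n"
    by (simp add: \<alpha>_def \<delta>_def scaleR_add_right)
  \<comment> \<open>The coefficient of \<open>v\<close> is rounded first, then that of
    \<open>u\<close> after completing the square, where the choice of \<open>k\<close> enters
    through \<open>y * b / a\<close>.\<close>
  obtain k where k: "\<bar>\<delta> + of_int k\<bar> \<le> 1/2" using exists_int_near by blast
  define y where "y = \<delta> + of_int k"
  obtain m where m: "\<bar>(\<alpha> + y * b / a) + of_int m\<bar> \<le> 1/2" using exists_int_near by blast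
  define x where "x = \<alpha> + of_int m"
  have x: "\<bar>x + y * b / a\<bar> \<le> 1/2" using m by (simp add: x_def add_ac)
  have v': "w + of_int m *\<^sub>R u + of_int k *\<^sub>R v = x *\<^sub>R u + y *\<^sub>R v + (D / N) *\<^sub>R n"
    unfolding x_def y_def by (subst (1) w) (simp add: algebra_simps)
  have "e \<le> (x *\<^sub>R u + y *\<^sub>R v + (D / N) *\<^sub>R n) \<bullet> (x *\<^sub>R u + y *\<^sub>R v + (D / N) *\<^sub>R n)"
    unfolding v'[symmetric] e_def power2_norm_eq_inner[symmetric] using minw by (intro power_mono) auto
  also have "\<dots> = x\<^sup>2 * a + 2 * x * y * b + y\<^sup>2 * c + (D / N)\<^sup>2 * N"
    using orth by (simp add: inner_simps inner_commute a_def b_def c_def N_def power2_eq_square algebra_simps)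
  \<comment> \<open>\<open>D\<close> is the determinant of the basis up to sign, so
    \<open>D * D = 1\<close>: the component along \<open>n\<close> is fixed by the covolume.\<close>
  also have "(D / N)\<^sup>2 * N = 1 / N"
    using det N0 by (simp add: D_def n_def power2_eq_square)
  also have "x\<^sup>2 * a + 2 * x * y * b + y\<^sup>2 * c = a * (x + y * b / a)\<^sup>2 + y\<^sup>2 * (c - b\<^sup>2 / a)"
    using a by (simp add: power2_eq_square field_simps)
  also have "\<dots> \<le> a * (1/2)\<^sup>2 + (1/2)\<^sup>2 * c"
  proof (intro add_mono mult_mono)
    show "(x + y * b / a)\<^sup>2 \<le> (1/2)\<^sup>2" using x by (simp add: abs_le_square_iff[symmetric])
    show "y\<^sup>2 \<le> (1/2)\<^sup>2" using k by (simp add: y_def abs_le_square_iff[symmetric])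
    show "0 \<le> c - b\<^sup>2 / a" using N N0 a by (simp add: field_simps)
  qed (use a in auto)
  also have "\<dots> + 1 / N \<le> e / 2 + 1 / N" using ac by (simp add: power2_eq_square)
  finally have "e \<le> 2 / N" by simp
  also have "\<dots> \<le> 2 / (3 / 4 * \<epsilon> ^ 4)" using N\<epsilon> N0 \<epsilon>(1) by (intro divide_left_mono) auto
  finally show ?thesis by (simp add: e_def power2_norm_eq_inner)
qed

text \<open>Permuting the vectors changes the determinant only in sign, so they may be sorted by
  length; the bound for the longest one serves for all.\<close>

lemma reduced_basis_bound:
  fixes b :: "3 \<Rightarrow> real^3"
  assumes \<epsilon>: "0 < \<epsilon>" "\<And>i. \<epsilon> \<le> norm (b i)" and det: "(cross3 (b 1) (b 2) \<bullet> b 3)\<^sup>2 = 1"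
    and min: "\<And>i (c :: 3 \<Rightarrow> int). c i = 1 \<Longrightarrow> norm (b i) \<le> norm (\<Sum>j\<in>UNIV. of_int (c j) *\<^sub>R b j)"
  shows "(norm (b i))\<^sup>2 \<le> 8 / (3 * \<epsilon> ^ 4)"
proof -
  have sorted: "(norm (b l))\<^sup>2 \<le> 8 / (3 * \<epsilon> ^ 4)"
    if ne: "j \<noteq> k" "j \<noteq> l" "k \<noteq> l" and le: "norm (b j) \<le> norm (b k)" "norm (b k) \<le> norm (b l)" for j k l
  proof -
    have UN: "UNIV = {j, k, l}"
    proof (rule sym, rule card_subset_eq)
      show "card {j, k, l} = card (UNIV :: 3 set)" using ne by simp
    qed auto
    show ?thesis
    proof (rule reduced_basis_bound_sorted[OF \<epsilon>(1) \<epsilon>(2) le])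
      have "cross3 (b j) (b k) \<bullet> b l = cross3 (b 1) (b 2) \<bullet> b 3 \<or>
            cross3 (b j) (b k) \<bullet> b l = - (cross3 (b 1) (b 2) \<bullet> b 3)"
        using ne exhaust_3[of j] exhaust_3[of k] exhaust_3[of l]
        by (elim disjE; simp add: cross3_def inner_vec_def sum_3 algebra_simps)
      then show "(cross3 (b j) (b k) \<bullet> b l)\<^sup>2 = 1" using det by auto
      show "norm (b k) \<le> norm (b k + of_int m *\<^sub>R b j)" for m
        using min[of "\<lambda>i. if i = k then 1 else if i = j then m else 0" k] ne
        unfolding UN by (simp add: add_ac)
      show "norm (b l) \<le> norm (b l + of_int m *\<^sub>R b j + of_int n *\<^sub>R b k)" for m n
        using min[of "\<lambda>i. if i = l then 1 else if i = j then m else n" l] ne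
        unfolding UN by (simp add: add_ac)
    qed
  qed
  have "Max (range (\<lambda>i. norm (b i))) \<in> range (\<lambda>i. norm (b i))" by (rule Max_in) auto
  then obtain l where "Max (range (\<lambda>i. norm (b i))) = norm (b l)" by blast
  then have l: "norm (b i) \<le> norm (b l)" for i
    using Max_ge[of "range (\<lambda>i. norm (b i))" "norm (b i)"] by auto
  obtain j k where "j \<noteq> k" "j \<noteq> l" "k \<noteq> l" "norm (b j) \<le> norm (b k)"
  proof -
    obtain j k :: 3 where "j \<noteq> k" "j \<noteq> l" "k \<noteq> l"
    proof -
      have "1 \<noteq> (2::3)" "1 \<noteq> (3::3)" "2 \<noteq> (3::3)" by auto
      then show ?thesis using exhaust_3[of l] that by metis
    qed
    then show ?thesis using that[of j k] that[of k j] by (cases "norm (b j) \<le> norm (b k)") auto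
  qed
  then have "(norm (b l))\<^sup>2 \<le> 8 / (3 * \<epsilon> ^ 4)" using sorted l by blast
  moreover have "(norm (b i))\<^sup>2 \<le> (norm (b l))\<^sup>2" using l by (intro power_mono) auto
  ultimately show ?thesis by linarith
qed

section \<open>Mahler's criterion\<close>

lemma norm_matrix_columns: "(norm (h :: real^3^3))\<^sup>2 = (\<Sum>j\<in>UNIV. (norm (column j h))\<^sup>2)"
proof -
  have "(norm h)\<^sup>2 = (\<Sum>i\<in>UNIV. \<Sum>j\<in>UNIV. (h $ i $ j)\<^sup>2)"
    by (simp add: norm_vec_def L2_set_def sum_nonneg)
  also have "\<dots> = (\<Sum>j\<in>UNIV. \<Sum>i\<in>UNIV. (h $ i $ j)\<^sup>2)" by (rule sum.swap)
  also have "\<dots> = (\<Sum>j\<in>UNIV. (norm (column j h))\<^sup>2)"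
    by (simp add: norm_vec_def L2_set_def sum_nonneg column_def)
  finally show ?thesis .
qed

text \<open>As \<open>SL3_Z\<close> is closed, the matrices of the coset of norm at most
  \<open>norm g\<close> form a compact set; it contains \<open>g\<close>, and its shortest element
  is shortest in the whole coset.\<close>

lemma coset_shortest:
  assumes "g \<in> SL3_R"
  obtains \<gamma> where "\<gamma> \<in> SL3_Z" "\<And>\<delta>. \<delta> \<in> SL3_Z \<Longrightarrow> norm (g ** \<gamma>) \<le> norm (g ** \<delta>)"
proof -
  have "invertible g" using assms by (simp add: SL3_R_def invertible_det_nz)
  then obtain g' where g': "g ** g' = mat 1" "g' ** g = mat 1" unfolding invertible_def by blast
  define M where "M = ((\<lambda>h. g' ** h) -` SL3_Z) \<inter> cball 0 (norm g)"
  have "closed ((\<lambda>h. g' ** h) -` SL3_Z)"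
    by (intro closed_vimage closed_SL3_Z continuous_on_matrix_mult continuous_intros)
  then have "compact M" unfolding M_def by (rule closed_Int_compact) simp
  moreover have "g \<in> M" using g' mat_1_in_SL3_Z by (simp add: M_def)
  ultimately obtain h where h: "h \<in> M" "\<And>h'. h' \<in> M \<Longrightarrow> norm h \<le> norm h'"
    using continuous_attains_inf[of M norm] continuous_on_norm_id by blast
  define \<gamma> where "\<gamma> = g' ** h"
  have \<gamma>: "\<gamma> \<in> SL3_Z" "g ** \<gamma> = h"
    using h(1) g' by (simp_all add: \<gamma>_def M_def matrix_mul_assoc)
  show ?thesis
  proof (rule that[OF \<gamma>(1)])
    fix \<delta> assume \<delta>: "\<delta> \<in> SL3_Z"
    have "g' ** (g ** \<delta>) = \<delta>" using g' by (simp add: matrix_mul_assoc)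
    then show "norm (g ** \<gamma>) \<le> norm (g ** \<delta>)"
      using \<gamma>(2) h(2)[of "g ** \<delta>"] \<delta> h(2)[OF \<open>g \<in> M\<close>]
      by (cases "norm (g ** \<delta>) \<le> norm g") (auto simp: M_def)
  qed
qed

text \<open>An elementary column operation, acting by multiplication from the right on column
  \<open>i\<close> only.\<close>

definition column_op :: "3 \<Rightarrow> (3 \<Rightarrow> int) \<Rightarrow> real^3^3" where
  "column_op i c = (\<chi> r s. if s = i then of_int (c r) else if r = s then 1 else 0)"

lemma column_op_in_SL3_Z: "c i = 1 \<Longrightarrow> column_op i c \<in> SL3_Z"
  using exhaust_3[of i] by (auto simp: SL3_Z_def column_op_def det_3)

lemma column_mult_column_op:
  "column s (h ** column_op i c) =
     (if s = i then \<Sum>j\<in>UNIV. of_int (c j) *\<^sub>R column j h else column s h)"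
  using exhaust_3[of s] exhaust_3[of i]
  by (elim disjE; simp add: column_def matrix_matrix_mult_def column_op_def vec_eq_iff sum_3 mult.commute)

text \<open>The quantitative half of Mahler's criterion. For a representative of least norm, an
  integral column operation changing a single column cannot shorten that column, so the columns form
  a reduced basis.\<close>

lemma bounded_representative:
  assumes g: "g \<in> SL3_R" and \<epsilon>: "0 < \<epsilon>"
    and short: "\<And>v. (\<forall>i. v $ i \<in> \<int>) \<Longrightarrow> v \<noteq> 0 \<Longrightarrow> \<epsilon> \<le> norm (g *v v)"
  obtains h where "h \<in> SL3_R" "coset h = coset g" "(norm h)\<^sup>2 \<le> 8 / \<epsilon> ^ 4"
proof -
  obtain \<gamma> where \<gamma>: "\<gamma> \<in> SL3_Z" and min: "\<And>\<delta>. \<delta> \<in> SL3_Z \<Longrightarrow> norm (g ** \<gamma>) \<le> norm (g ** \<delta>)"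
    using coset_shortest[OF g] by metis
  define h where "h = g ** \<gamma>"
  have det: "det h = 1" using g \<gamma> by (simp add: h_def det_mul SL3_R_def SL3_Z_def)
  have col: "(norm (column i h))\<^sup>2 \<le> 8 / (3 * \<epsilon> ^ 4)" for i
  proof (rule reduced_basis_bound[OF \<epsilon>])
    fix i
    have "column i \<gamma> \<noteq> 0"
    proof
      assume "column i \<gamma> = 0"
      then have "det \<gamma> = 0" by (rule det_zero_column)
      then show False using \<gamma> by (simp add: SL3_Z_def)
    qed
    moreover have "\<forall>r. column i \<gamma> $ r \<in> \<int>" using \<gamma> by (simp add: SL3_Z_def column_def)
    moreover have "g *v column i \<gamma> = column i h"
      by (simp add: h_def column_def matrix_vector_mult_def matrix_matrix_mult_def)
    ultimately show "\<epsilon> \<le> norm (column i h)" using short[of "column i \<gamma>"] by simp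
  next
    have "cross3 (column 1 h) (column 2 h) \<bullet> column 3 h = det h"
      by (simp add: cross3_def inner_vec_def sum_3 det_3 column_def algebra_simps)
    then show "(cross3 (column 1 h) (column 2 h) \<bullet> column 3 h)\<^sup>2 = 1" using det by simp
  next
    fix i and c :: "3 \<Rightarrow> int" assume c: "c i = 1"
    let ?h = "h ** column_op i c"
    have "norm h \<le> norm ?h"
      using min[OF SL3_Z_mult[OF \<gamma> column_op_in_SL3_Z[of c i, OF c]]] by (simp add: h_def matrix_mul_assoc)
    then have "(norm h)\<^sup>2 \<le> (norm ?h)\<^sup>2" by (intro power_mono) auto
    moreover have "(norm h)\<^sup>2 = (norm (column i h))\<^sup>2 + (\<Sum>s\<in>UNIV - {i}. (norm (column s h))\<^sup>2)"
      unfolding norm_matrix_columns by (simp add: sum.remove[of UNIV i])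
    moreover have "(norm ?h)\<^sup>2 = (norm (column i ?h))\<^sup>2 + (\<Sum>s\<in>UNIV - {i}. (norm (column s ?h))\<^sup>2)"
      unfolding norm_matrix_columns by (simp add: sum.remove[of UNIV i])
    moreover have "(\<Sum>s\<in>UNIV - {i}. (norm (column s ?h))\<^sup>2) = (\<Sum>s\<in>UNIV - {i}. (norm (column s h))\<^sup>2)"
      by (intro sum.cong) (auto simp: column_mult_column_op)
    ultimately have "(norm (column i h))\<^sup>2 \<le> (norm (column i ?h))\<^sup>2" by linarith
    then have "norm (column i h) \<le> norm (column i ?h)" by (rule power2_le_imp_le) simp
    then show "norm (column i h) \<le> norm (\<Sum>j\<in>UNIV. of_int (c j) *\<^sub>R column j h)"
      by (simp add: column_mult_column_op)
  qed
  have "(norm h)\<^sup>2 \<le> (\<Sum>j\<in>(UNIV :: 3 set). 8 / (3 * \<epsilon> ^ 4))"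
    unfolding norm_matrix_columns by (intro sum_mono col)
  also have "\<dots> = 8 / \<epsilon> ^ 4" by simp
  finally have "(norm h)\<^sup>2 \<le> 8 / \<epsilon> ^ 4" .
  moreover have "coset h = coset g" using \<gamma> by (auto simp: coset_eq_iff h_def)
  moreover have "h \<in> SL3_R" using det by (simp add: SL3_R_def)
  ultimately show ?thesis using that by blast
qed

lemma compactin_bounded_cosets:
  "compactin X3_topology (coset ` {h \<in> SL3_R. (norm h)\<^sup>2 \<le> r})"
proof (rule image_compactin)
  have "closed {h :: real^3^3. det h = 1 \<and> (norm h)\<^sup>2 \<le> r}"
    unfolding det_3 by (intro closed_Collect_conj closed_Collect_eq closed_Collect_le continuous_intros)
  moreover have "norm h \<le> max 1 r" if "(norm h)\<^sup>2 \<le> r" for h :: "real^3^3"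
  proof (cases "norm h \<le> 1")
    case False
    then have "norm h * 1 \<le> norm h * norm h" by (intro mult_left_mono) auto
    then show ?thesis using that by (simp add: power2_eq_square)
  qed simp
  then have "bounded {h :: real^3^3. det h = 1 \<and> (norm h)\<^sup>2 \<le> r}"
    unfolding bounded_iff by blast
  ultimately have "compact {h \<in> SL3_R. (norm h)\<^sup>2 \<le> r}"
    by (simp add: SL3_R_def compact_eq_bounded_closed)
  then show "compactin (top_of_set SL3_R) {h \<in> SL3_R. (norm h)\<^sup>2 \<le> r}"
    by (auto simp: compactin_subtopology)
  show "continuous_map (top_of_set SL3_R) X3_topology coset"
    using quotient_map_coset by (rule quotient_imp_continuous_map)
qed

section \<open>From avoided boxes to recurrence of the orbit\<close>

lemma translate_coset: "translate a (coset g) = coset (a ** g)"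
  by (simp add: coset_def translate_def image_image matrix_mul_assoc)

lemma diag_flow_entries:
  "diag_flow s t $ 1 $ 1 = exp s" "diag_flow s t $ 1 $ 2 = 0" "diag_flow s t $ 1 $ 3 = 0"
  "diag_flow s t $ 2 $ 1 = 0" "diag_flow s t $ 2 $ 2 = exp t" "diag_flow s t $ 2 $ 3 = 0"
  "diag_flow s t $ 3 $ 1 = 0" "diag_flow s t $ 3 $ 2 = 0" "diag_flow s t $ 3 $ 3 = exp (- (s + t))"
  by (simp_all add: diag_flow_def)

lemma flow_vector_entries:
  "((diag_flow s t ** unipotent z) *v v) $ 1 = exp s * (v $ 3 * fst z + v $ 1)"
  "((diag_flow s t ** unipotent z) *v v) $ 2 = exp t * (v $ 3 * snd z + v $ 2)"
  "((diag_flow s t ** unipotent z) *v v) $ 3 = exp (- (s + t)) * v $ 3"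
  by (simp_all add: matrix_vector_mult_def matrix_matrix_mult_def sum_3 diag_flow_entries
      unipotent_entries algebra_simps)

text \<open>A short vector with positive third entry \<open>q\<close> is an approximation by a
  rational point of denominator \<open>q\<close>, in the box with \<open>a = exp s\<close>,
  \<open>b = exp t\<close>. A negative third entry is reduced to this by \<open>- v\<close>. If it
  vanishes, the other two entries are not contracted, so integrality excludes lengths below
  1.\<close>

lemma flow_vector_not_short:
  fixes v :: "real^3"
  assumes avoid: "\<forall>\<kappa>\<in>line_classes \<epsilon> (exp (s + t)). z \<notin> class_obstacle \<epsilon> (exp (s + t)) \<kappa>"
    and \<epsilon>: "0 < \<epsilon>" "\<epsilon> \<le> 1 / 28" and st: "0 \<le> s" "0 \<le> t"
    and v: "\<forall>i. v $ i \<in> \<int>" "v \<noteq> 0"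
  shows "\<epsilon> \<le> norm ((diag_flow s t ** unipotent z) *v v)"
proof -
  let ?g = "diag_flow s t ** unipotent z"
  have nonneg: "\<epsilon> \<le> norm (?g *v v)" if v: "\<forall>i. v $ i \<in> \<int>" "v \<noteq> 0" "0 \<le> v $ 3" for v
  proof (rule ccontr)
    assume "\<not> ?thesis"
    then have lt: "\<bar>(?g *v v) $ i\<bar> < \<epsilon>" for i
      using component_le_norm_cart[of "?g *v v" i] by linarith
    obtain m n q :: int where mnq: "v $ 1 = m" "v $ 2 = n" "v $ 3 = q"
      using v(1) by (metis Ints_cases)
    have x: "exp s * \<bar>q * fst z + m\<bar> < \<epsilon>" and y: "exp t * \<bar>q * snd z + n\<bar> < \<epsilon>"
      and z: "exp (- (s + t)) * \<bar>real_of_int q\<bar> < \<epsilon>"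
      using lt[of 1] lt[of 2] lt[of 3] unfolding flow_vector_entries mnq by (simp_all add: abs_mult)
    show False
    proof (cases "q = 0")
      case True
      have "\<bar>real_of_int m\<bar> \<le> exp s * \<bar>real_of_int m\<bar>" "\<bar>real_of_int n\<bar> \<le> exp t * \<bar>real_of_int n\<bar>"
        using st by (simp_all add: mult_le_cancel_right1)
      then have "\<bar>real_of_int m\<bar> < 1" "\<bar>real_of_int n\<bar> < 1" using x y \<epsilon> True by simp_all
      then have "m = 0" "n = 0" by linarith+
      then have "v = 0" using mnq True by (simp add: vec_eq_iff forall_3)
      then show False using v(2) by simp
    next
      case False
      then have q: "1 \<le> q" using v(3) mnq by linarith
      have "\<epsilon> / exp t \<le> \<bar>q * snd z - real_of_int (- n)\<bar>"
      proof (rule no_box_if_no_obstacle[OF avoid \<epsilon>, of "exp s" "exp t"])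
        show "q < \<epsilon> * exp (s + t)" using z q unfolding exp_minus by (simp add: field_simps)
        show "\<bar>q * fst z - real_of_int (- m)\<bar> < \<epsilon> / exp s" using x by (simp add: field_simps)
      qed (use st q in \<open>simp_all add: exp_add\<close>)
      then show False using y by (simp add: field_simps)
    qed
  qed
  show ?thesis
  proof (cases "0 \<le> v $ 3")
    case True
    then show ?thesis using nonneg v by blast
  next
    case False
    then have "\<epsilon> \<le> norm (?g *v (- v))" using v by (intro nonneg) auto
    moreover have "?g *v (- v) = - (?g *v v)" by (simp add: matrix_vector_mult_def vec_eq_iff sum_negf)
    ultimately show ?thesis by simp
  qed
qed

text \<open>The compact set \<open>K\<close> depends on \<open>\<epsilon>\<close> only, and it
  contains the entire fibre over \<open>ln Q\<close> for every \<open>Q\<close> whose obstacles are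
  avoided, hence fibres over arbitrarily large times.\<close>

lemma not_fiberwise_divergentI:
  assumes \<epsilon>: "0 < \<epsilon>" "\<epsilon> \<le> 1 / 28"
    and avoid: "\<And>M. \<exists>Q\<ge>M. \<forall>\<kappa>\<in>line_classes \<epsilon> Q. z \<notin> class_obstacle \<epsilon> Q \<kappa>"
  shows "\<not> fiberwise_divergent (torus_point z)"
proof -
  define K where "K = coset ` {h \<in> SL3_R. (norm h)\<^sup>2 \<le> 8 / \<epsilon> ^ 4}"
  have "\<exists>T>T0. (\<lambda>a. translate a (torus_point z)) ` L_plus T \<subseteq> K" for T0
  proof -
    obtain Q where Q: "exp (T0 + 1) \<le> Q" and av: "\<forall>\<kappa>\<in>line_classes \<epsilon> Q. z \<notin> class_obstacle \<epsilon> Q \<kappa>"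
      using avoid by blast
    have Q0: "0 < Q" using Q by (meson exp_gt_zero less_le_trans)
    have "T0 + 1 \<le> ln Q" using Q Q0 by (simp add: ln_ge_iff)
    then have "T0 < ln Q" by simp
    moreover have "(\<lambda>a. translate a (torus_point z)) ` L_plus (ln Q) \<subseteq> K"
    proof (rule image_subsetI)
      fix a assume "a \<in> L_plus (ln Q)"
      then obtain s t where a: "a = diag_flow s t" and st: "0 \<le> s" "0 \<le> t" "s + t = ln Q"
        by (auto simp: L_plus_def)
      have Qst: "exp (s + t) = Q" using st Q0 by simp
      have "det (diag_flow s t) = 1"
        by (simp add: det_3 diag_flow_entries exp_add[symmetric])
      then have "diag_flow s t ** unipotent z \<in> SL3_R"
        by (simp add: SL3_R_def det_mul det_unipotent)
      moreover have "\<epsilon> \<le> norm ((diag_flow s t ** unipotent z) *v v)" if "\<forall>i. v $ i \<in> \<int>" "v \<noteq> 0" for v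
        using av st(1,2) that \<epsilon> by (intro flow_vector_not_short) (simp_all add: Qst)
      ultimately obtain h where "h \<in> SL3_R" "coset h = coset (diag_flow s t ** unipotent z)"
          "(norm h)\<^sup>2 \<le> 8 / \<epsilon> ^ 4"
        using bounded_representative[of "diag_flow s t ** unipotent z" \<epsilon>] \<epsilon>(1) by metis
      then show "translate a (torus_point z) \<in> K"
        unfolding K_def a torus_point_def translate_coset by (intro image_eqI[of _ _ h]) auto
    qed
    ultimately show ?thesis by blast
  qed
  moreover have "compactin X3_topology K" unfolding K_def by (rule compactin_bounded_cosets)
  ultimately show ?thesis unfolding fiberwise_divergent_def by blast
qed

section \<open>The winning property\<close>

text \<open>By compactness the nested balls have a common point; it lies in \<open>U\<close> as it
  lies in the first ball, and the strategy avoids the obstacles at every such point.\<close>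

lemma HAW_on_not_fiberwise_divergent:
  "HAW_on U (U \<inter> {z. \<not> fiberwise_divergent (torus_point z)})"
  unfolding HAW_on_def
proof (intro allI impI)
  fix \<beta> :: real assume "0 < \<beta> \<and> \<beta> < 1 / 3"
  then have \<beta>: "0 < \<beta>" "\<beta> < 1" by auto
  define good where "good \<sigma> \<longleftrightarrow> (\<forall>h c \<rho>. 0 < \<rho> \<longrightarrow> alice_move \<beta> \<rho> (\<sigma> (h @ [(c, \<rho>)]))) \<and>
    (\<forall>B z. bob_play \<beta> U \<sigma> B \<and> (\<lambda>n. snd (B n)) \<longlonglongrightarrow> 0 \<and>
       (\<forall>n. z \<in> cball (fst (B n)) (snd (B n))) \<longrightarrow> \<not> fiberwise_divergent (torus_point z))"
    for \<sigma> :: "(real \<times> real) haw_strategy"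
  have "\<exists>\<sigma>. good \<sigma>"
  proof (rule line_avoiding_strategy[OF \<beta>])
    fix \<epsilon> and \<sigma> :: "(real \<times> real) haw_strategy"
    assume \<epsilon>: "0 < \<epsilon>" "\<epsilon> \<le> 1 / 28"
      and legal: "\<And>h c \<rho>. 0 < \<rho> \<Longrightarrow> alice_move \<beta> \<rho> (\<sigma> (h @ [(c, \<rho>)]))"
      and win: "\<And>U B z M. bob_play \<beta> U \<sigma> B \<Longrightarrow> (\<lambda>n. snd (B n)) \<longlonglongrightarrow> 0 \<Longrightarrow>
       (\<And>n. z \<in> cball (fst (B n)) (snd (B n))) \<Longrightarrow>
       \<exists>Q\<ge>M. \<forall>\<kappa>\<in>line_classes \<epsilon> Q. z \<notin> class_obstacle \<epsilon> Q \<kappa>"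
    have "good \<sigma>" unfolding good_def
    proof (intro conjI allI impI legal, assumption, elim conjE)
      fix B z
      assume B: "bob_play \<beta> U \<sigma> B" "(\<lambda>n. snd (B n)) \<longlonglongrightarrow> 0" "\<forall>n. z \<in> cball (fst (B n)) (snd (B n))"
      show "\<not> fiberwise_divergent (torus_point z)"
        by (rule not_fiberwise_divergentI[OF \<epsilon>]) (rule win[OF B(1,2)], use B(3) in blast)
    qed
    then show "\<exists>\<sigma>. good \<sigma>" by (intro exI)
  qed
  then obtain \<sigma> where \<sigma>: "good \<sigma>" by blast
  have "alice_winning_strategy \<beta> U (U \<inter> {z. \<not> fiberwise_divergent (torus_point z)}) \<sigma>"
    unfolding alice_winning_strategy_def
  proof (intro conjI allI impI)
    show "alice_move \<beta> \<rho> (\<sigma> (h @ [(c, \<rho>)]))" if "0 < \<rho>" for h c \<rho>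
      using \<sigma> that unfolding good_def by blast
  next
    fix B :: "nat \<Rightarrow> (real \<times> real) \<times> real"
    assume "bob_play \<beta> U \<sigma> B \<and> (\<lambda>n. snd (B n)) \<longlonglongrightarrow> 0"
    then have B: "bob_play \<beta> U \<sigma> B" "(\<lambda>n. snd (B n)) \<longlonglongrightarrow> 0" by auto
    have pos: "0 \<le> snd (B n)" for n
    proof (induction n)
      case (Suc n)
      then have "0 \<le> \<beta> * snd (B n)" using \<beta> by simp
      also have "\<dots> \<le> snd (B (Suc n))" using B(1) by (simp add: bob_play_def)
      finally show ?case .
    qed (use B(1) in \<open>simp add: bob_play_def\<close>)
    have sub: "cball (fst (B (Suc n))) (snd (B (Suc n))) \<subseteq> cball (fst (B n)) (snd (B n))" for n
      using B(1) unfolding bob_play_def by blast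
    have "(\<Inter>n. cball (fst (B n)) (snd (B n))) \<noteq> {}"
    proof (rule compact_nest)
      show "cball (fst (B n)) (snd (B n)) \<noteq> {}" for n using pos[of n] by simp
      show "cball (fst (B n)) (snd (B n)) \<subseteq> cball (fst (B m)) (snd (B m))" if "m \<le> n" for m n
        using sub that by (rule lift_Suc_antimono_le)
    qed simp
    then obtain z where z: "\<And>n. z \<in> cball (fst (B n)) (snd (B n))" by blast
    have "\<not> fiberwise_divergent (torus_point z)"
      using \<sigma> B z unfolding good_def by blast
    moreover have "z \<in> U" using z[of 0] B(1) by (auto simp: bob_play_def)
    ultimately show "(\<Inter>n. cball (fst (B n)) (snd (B n))) \<inter>
        (U \<inter> {z. \<not> fiberwise_divergent (torus_point z)}) \<noteq> {}"
      using z by blast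
  qed
  then show "\<exists>\<sigma>. alice_winning_strategy \<beta> U (U \<inter> {z. \<not> fiberwise_divergent (torus_point z)}) \<sigma>"
    by (intro exI)
qed

text \<open>A chart inverts \<open>torus_point\<close> on \<open>V\<close>, so in the chart the set
  becomes its lift to \<open>V\<close>.\<close>

lemma HAW_on_torus_not_fiberwise_divergent:
  "HAW_on_manifold (subtopology X3_topology torus) torus_atlas {p \<in> torus. \<not> fiberwise_divergent p}"
  unfolding HAW_on_manifold_def topspace_torus
proof (intro conjI C1_atlas_torus ballI case_prodI2)
  fix C U \<phi> assume C: "C \<in> torus_atlas" "C = (U, \<phi>)"
  then obtain V where V: "U = torus_point ` V" "\<phi> = inv_into V torus_point" "inj_on torus_point V"
    by (auto simp: torus_atlas_def)
  have inv: "\<phi> (torus_point z) = z" if "z \<in> V" for z using V that by (simp add: inv_into_f_f)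
  then have "\<phi> ` U = V" unfolding V(1) image_image by simp
  moreover have "{p \<in> torus. \<not> fiberwise_divergent p} \<inter> U =
      torus_point ` (V \<inter> {z. \<not> fiberwise_divergent (torus_point z)})"
    unfolding V(1) torus_def by auto
  then have "\<phi> ` ({p \<in> torus. \<not> fiberwise_divergent p} \<inter> U) =
      V \<inter> {z. \<not> fiberwise_divergent (torus_point z)}"
    using inv by (simp add: image_image)
  ultimately show "HAW_on (\<phi> ` U) (\<phi> ` ({p \<in> torus. \<not> fiberwise_divergent p} \<inter> U))"
    using HAW_on_not_fiberwise_divergent by simp
qed auto

section \<open>Hausdorff dimension\<close>

text \<open>One of the two balls of radius \<open>\<rho> / 4\<close> on either side of the line contains \<open>M\<^sup>2\<close> separated
  balls of radius \<open>\<rho> / (28 M)\<close>.\<close>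

lemma many_moves_off_hyperplane:
  fixes c :: "real \<times> real"
  assumes L: "affine_hyperplane L" and \<rho>: "0 < \<rho>" and M: "0 < M" and r: "r \<le> \<rho> / (28 * real M)"
  obtains f :: "nat \<Rightarrow> real \<times> real" where
    "\<And>n. n < M\<^sup>2 \<Longrightarrow> cball (f n) (\<rho> / (28 * real M)) \<subseteq> cball c \<rho> - hyperplane_nbhd L r"
    "\<And>m n x y. m < M\<^sup>2 \<Longrightarrow> n < M\<^sup>2 \<Longrightarrow> m \<noteq> n \<Longrightarrow> x \<in> cball (f m) (\<rho> / (28 * real M)) \<Longrightarrow>
       y \<in> cball (f n) (\<rho> / (28 * real M)) \<Longrightarrow> \<rho> / (28 * real M) \<le> dist x y"
proof -
  define s where "s = \<rho> / (28 * real M)"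
  have s: "0 < s" "28 * real M * s = \<rho>" using \<rho> M by (simp_all add: s_def)
  have sM: "s \<le> real M * s" using s(1) M by simp
  obtain a b where ab: "a \<noteq> 0" "L = {z. a \<bullet> z = b}" using L by (auto simp: affine_hyperplane_def)
  \<comment> \<open>The unit normal of \<open>L\<close> pointing to the side of \<open>c\<close>;
    moving from \<open>c\<close> by \<open>\<rho> / 2\<close> along it gives a centre
    \<open>d\<close> at distance at least \<open>\<rho> / 2\<close> from \<open>L\<close>.\<close>
  define u where "u = ((if b \<le> a \<bullet> c then 1 else -1) / norm a) *\<^sub>R a"
  have u: "norm u = 1" using ab by (simp add: u_def)
  define d where "d = c + (\<rho> / 2) *\<^sub>R u"
  have far: "\<rho> / 4 \<le> infdist z L" if "dist d z \<le> \<rho> / 4" for z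
  proof -
    have ud: "\<rho> / 2 \<le> u \<bullet> d - u \<bullet> l" if "l \<in> L" for l
    proof -
      have "u \<bullet> l \<le> u \<bullet> c" using that ab unfolding u_def
        by (auto simp: divide_right_mono)
      moreover have "u \<bullet> d = u \<bullet> c + \<rho> / 2"
        using u by (simp add: d_def inner_add_right power2_norm_eq_inner[symmetric])
      ultimately show ?thesis by linarith
    qed
    have "\<rho> / 4 \<le> dist z l" if l: "l \<in> L" for l
    proof -
      have "u \<bullet> (d - l) \<le> dist d l" using norm_cauchy_schwarz[of u "d - l"] u by (simp add: dist_norm)
      then have "\<rho> / 2 \<le> dist d l" using ud[OF l] by (simp add: inner_diff_right)
      then show ?thesis using \<open>dist d z \<le> \<rho> / 4\<close> dist_triangle[of d l z] by linarith
    qed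
    moreover have "L \<noteq> {}" using affine_hyperplane_nonempty[OF L] .
    ultimately show ?thesis using cINF_greatest[of L "\<rho> / 4" "dist z"] by (simp add: infdist_notempty)
  qed
  \<comment> \<open>An \<open>M\<close> by \<open>M\<close> grid of mesh \<open>3 * s\<close>, so
    that balls of radius \<open>s\<close> are \<open>s\<close> apart. All of them lie within
    \<open>6 * M * s + s \<le> 7 * M * s = \<rho> / 4\<close> of \<open>d\<close>, whence the
    constant 28.\<close>
  define f where "f n = d + (3 * s * real (n div M), 3 * s * real (n mod M))" for n
  show ?thesis
  proof (rule that[of f])
    fix n assume "n < M\<^sup>2"
    then have nM: "n div M < M" "n mod M < M" using M by (simp_all add: less_mult_imp_div_less power2_eq_square)
    have "norm (3 * s * real (n div M), 3 * s * real (n mod M)) \<le> 3 * s * real (n div M) + 3 * s * real (n mod M)"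
      using norm_Pair_le[of "3 * s * real (n div M)" "3 * s * real (n mod M)"] s by simp
    also have "\<dots> \<le> 3 * s * real M + 3 * s * real M"
      using nM s by (intro add_mono mult_left_mono) auto
    finally have "dist (f n) d \<le> 6 * (real M * s)" by (simp add: f_def dist_norm mult_ac)
    then have df: "dist d (f n) \<le> 6 * (real M * s)" by (simp only: dist_commute)
    have "z \<in> cball c \<rho> - hyperplane_nbhd L r" if "z \<in> cball (f n) (\<rho> / (28 * real M))" for z
    proof -
      have "dist (f n) z \<le> s" using that by (simp add: s_def)
      then have dz: "dist d z \<le> \<rho> / 4"
        using df sM s dist_triangle[of d z "f n"] by linarith
      have "dist c d = \<rho> / 2" using u \<rho> by (simp add: d_def dist_norm)
      then have "dist c z \<le> \<rho>" using dz \<rho> dist_triangle[of c z d] by linarith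
      moreover have "r < \<rho> / 4" using r s sM \<rho> unfolding s_def[symmetric] by linarith
      ultimately show ?thesis using far[OF dz] by (simp add: hyperplane_nbhd_def)
    qed
    then show "cball (f n) (\<rho> / (28 * real M)) \<subseteq> cball c \<rho> - hyperplane_nbhd L r" by blast
  next
    fix m n x y
    assume mn: "m < M\<^sup>2" "n < M\<^sup>2" "m \<noteq> n" and xy: "x \<in> cball (f m) (\<rho> / (28 * real M))" "y \<in> cball (f n) (\<rho> / (28 * real M))"
    have sep: "3 * s \<le> \<bar>3 * s * real i - 3 * s * real j\<bar>" if "i \<noteq> j" for i j :: nat
    proof -
      have "1 \<le> \<bar>real i - real j\<bar>" using that by linarith
      then have "3 * s * 1 \<le> 3 * s * \<bar>real i - real j\<bar>" using s by (intro mult_left_mono) auto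
      also have "\<dots> = \<bar>3 * s * real i - 3 * s * real j\<bar>" using s by (simp add: right_diff_distrib[symmetric] abs_mult)
      finally show ?thesis by simp
    qed
    have "m div M \<noteq> n div M \<or> m mod M \<noteq> n mod M" using mn(3) by (metis div_mult_mod_eq)
    then have "3 * s \<le> dist (f m) (f n)"
    proof
      assume "m div M \<noteq> n div M"
      then have "3 * s \<le> dist (fst (f m)) (fst (f n))" using sep by (simp add: f_def dist_real_def)
      then show ?thesis using dist_fst_le[of "f m" "f n"] by linarith
    next
      assume "m mod M \<noteq> n mod M"
      then have "3 * s \<le> dist (snd (f m)) (snd (f n))" using sep by (simp add: f_def dist_real_def)
      then show ?thesis using dist_snd_le[of "f m" "f n"] by linarith
    qed
    moreover have "dist (f m) (f n) \<le> dist (f m) x + dist x y + dist (f n) y"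
      using dist_triangle[of "f m" "f n" x] dist_triangle[of x "f n" y] by (simp add: dist_commute)
    ultimately show "\<rho> / (28 * real M) \<le> dist x y" using xy unfolding s_def[symmetric] by simp
  qed
qed

section \<open>A family of runs indexed by the unit interval\<close>

text \<open>A Cantor set with \<open>M\<^sup>2\<close> children of relative size
  \<open>1 / (28 * M)\<close> has dimension tending to 2 as \<open>M\<close> grows; it suffices that
  \<open>M powr (2 - s)\<close> is at least \<open>28 powr s\<close>.\<close>

lemma exists_branching:
  fixes s :: real
  assumes "0 < s" "s < 2"
  obtains M :: nat where "0 < M" "(28 * real M) powr s \<le> (real M)\<^sup>2"
proof -
  define x where "x = (28 :: real) powr (s / (2 - s))"
  obtain M :: nat where M: "max 1 x \<le> real M" using real_arch_simple by blast
  then have M0: "0 < M" by (metis less_le_trans max.bounded_iff of_nat_0_less_iff zero_less_one)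
  have "28 powr s = x powr (2 - s)" using assms by (simp add: x_def powr_powr)
  also have "\<dots> \<le> real M powr (2 - s)" using M assms by (intro powr_mono2) (auto simp: x_def)
  finally have "28 powr s * real M powr s \<le> real M powr (2 - s) * real M powr s"
    by (intro mult_right_mono) auto
  also have "\<dots> = (real M)\<^sup>2" using M0 by (simp add: powr_add[symmetric] powr_numeral)
  finally show ?thesis using that[OF M0] by (simp add: powr_mult)
qed

text \<open>The digit of \<open>t\<close> in base \<open>N\<close> at the place \<open>N\<close> to
  the power \<open>- (n + 1)\<close>; digits are counted from 0.\<close>

definition digit :: "nat \<Rightarrow> real \<Rightarrow> nat \<Rightarrow> nat" where
  "digit N t n = nat (\<lfloor>real N ^ Suc n * t\<rfloor> mod int N)"

lemma digit_less: "0 < N \<Longrightarrow> digit N t n < N"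
  by (simp add: digit_def nat_less_iff)

text \<open>The floors are the expansions truncated after \<open>n\<close> digits. At the first
  length \<open>Suc n\<close> at which they differ, only the last digit can differ, and agreement at
  length \<open>n\<close> bounds the distance.\<close>

lemma first_different_digit:
  assumes N: "1 < N" and t: "0 \<le> t" "t < 1" "0 \<le> t'" "t' < 1" "t \<noteq> t'"
  obtains n where "\<And>m. m < n \<Longrightarrow> digit N t m = digit N t' m" "digit N t n \<noteq> digit N t' n"
    "\<bar>t - t'\<bar> \<le> (1 / N) ^ n"
proof -
  let ?f = "\<lambda>n t. \<lfloor>real N ^ n * t\<rfloor>"
  have "\<exists>n. ?f n t \<noteq> ?f n t'"
  proof -
    obtain n where n: "1 / \<bar>t - t'\<bar> < real N ^ n" using real_arch_pow[of "real N"] N by auto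
    then have "1 < real N ^ n * \<bar>t - t'\<bar>" using t(5) by (simp add: field_simps)
    also have "\<dots> = \<bar>real N ^ n * t - real N ^ n * t'\<bar>"
      by (simp add: right_diff_distrib[symmetric] abs_mult)
    finally have "1 < \<bar>real N ^ n * t - real N ^ n * t'\<bar>" .
    then show ?thesis by (intro exI[of _ n]) linarith
  qed
  define k where "k = (LEAST n. ?f n t \<noteq> ?f n t')"
  have k: "?f k t \<noteq> ?f k t'" unfolding k_def using \<open>\<exists>n. ?f n t \<noteq> ?f n t'\<close> by (rule LeastI_ex)
  have less: "?f m t = ?f m t'" if "m < k" for m
    using not_less_Least[of m "\<lambda>n. ?f n t \<noteq> ?f n t'"] that unfolding k_def by blast
  have f0: "?f 0 t = 0" "?f 0 t' = 0" using t by (simp_all add: floor_eq_iff)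
  then have "k \<noteq> 0" using k by (intro notI) simp
  then obtain n where n: "k = Suc n" by (cases k) auto
  \<comment> \<open>Deleting the last digit of a truncated expansion.\<close>
  have div: "?f (Suc n) t div int N = ?f n t" for t
  proof -
    have "\<lfloor>real N ^ Suc n * t / real_of_int (int N)\<rfloor> = ?f (Suc n) t div int N"
      by (rule floor_divide_real_eq_div) simp
    then show ?thesis using N by simp
  qed
  show ?thesis
  proof (rule that[of n])
    show "digit N t m = digit N t' m" if "m < n" for m
      unfolding digit_def using less[of "Suc m"] n that by simp
    show "digit N t n \<noteq> digit N t' n"
    proof
      assume "digit N t n = digit N t' n"
      then have "?f (Suc n) t mod int N = ?f (Suc n) t' mod int N"
        using N unfolding digit_def by (simp add: eq_nat_nat_iff)
      moreover have "?f (Suc n) t div int N = ?f (Suc n) t' div int N"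
        unfolding div using less[of n] n by simp
      ultimately have "?f (Suc n) t = ?f (Suc n) t'" by (metis div_mult_mod_eq)
      then show False using k n by simp
    qed
    have "\<bar>real N ^ n * t - real N ^ n * t'\<bar> < 1" using less[of n] n by linarith
    then have "real N ^ n * \<bar>t - t'\<bar> < 1" by (simp add: right_diff_distrib[symmetric] abs_mult)
    then show "\<bar>t - t'\<bar> \<le> (1 / N) ^ n" using N by (simp add: field_simps)
  qed
qed

text \<open>The point \<open>x t\<close> is the outcome of the run in which Bob follows the base \<open>M\<^sup>2\<close> digits of \<open>t\<close>.\<close>

lemma HAW_on_inverse_Hoelder:
  fixes U A :: "(real \<times> real) set" and s :: real
  assumes haw: "HAW_on U A" and s: "0 < s" "s < 2" and \<rho>0: "0 < \<rho>0" and U: "cball c0 \<rho>0 \<subseteq> U"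
  obtains C and x :: "real \<Rightarrow> real \<times> real" where "0 < C"
    "\<And>t. x t \<in> A \<inter> cball c0 \<rho>0"
    "\<And>t t'. t \<in> {0..<1} \<Longrightarrow> t' \<in> {0..<1} \<Longrightarrow> \<bar>t - t'\<bar> \<le> C * dist (x t) (x t') powr s"
proof -
  obtain M :: nat where M: "0 < M" "(28 * real M) powr s \<le> (real M)\<^sup>2"
    using exists_branching[OF s] by metis
  \<comment> \<open>Bob's least admissible radius is then exactly that of the balls in
    \<open>many_moves_off_hyperplane\<close>, and the choice of \<open>M\<close> says
    \<open>1 / N \<le> \<beta> powr s\<close>.\<close>
  define \<beta> where "\<beta> = 1 / (28 * real M)"
  define N where "N = M\<^sup>2"
  have \<beta>: "0 < \<beta>" "\<beta> < 1 / 3" using M by (auto simp: \<beta>_def field_simps)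
  have \<beta>N: "1 / real N \<le> \<beta> powr s"
  proof -
    have "1 / real N \<le> 1 / (28 * real M) powr s" using M by (intro divide_left_mono) (auto simp: N_def)
    also have "\<dots> = \<beta> powr s" using M by (simp add: \<beta>_def powr_divide)
    finally show ?thesis .
  qed
  have "1 < (28 * real M) powr s" using M s by (intro gr_one_powr) auto
  then have "1 < real N" using M by (simp add: N_def)
  then have N: "1 < N" by simp
  obtain \<sigma> where \<sigma>: "alice_winning_strategy \<beta> U A \<sigma>" using haw \<beta> unfolding HAW_on_def by blast
  \<comment> \<open>\<open>F\<close> lists \<open>N\<close> pairwise separated centres that are
    legal for Bob after the history \<open>h\<close>.\<close>
  define good where "good h F \<longleftrightarrow> (let (c, \<rho>) = last h in
      (\<forall>n<N. cball (F n) (\<beta> * \<rho>) \<subseteq> cball c \<rho> - hyperplane_nbhd (fst (\<sigma> h)) (snd (\<sigma> h))) \<and>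
      (\<forall>m<N. \<forall>n<N. \<forall>x y. m \<noteq> n \<and> x \<in> cball (F m) (\<beta> * \<rho>) \<and> y \<in> cball (F n) (\<beta> * \<rho>) \<longrightarrow>
         \<beta> * \<rho> \<le> dist x y))" for h F
  define F where "F h = (SOME F. good h F)" for h
  have good: "good h (F h)" if h: "h \<noteq> []" "0 < snd (last h)" for h
  proof -
    obtain c \<rho> where cr: "last h = (c, \<rho>)" by (cases "last h")
    have "h = butlast h @ [(c, \<rho>)]" using h(1) cr by (metis append_butlast_last_id)
    then have "alice_move \<beta> \<rho> (\<sigma> h)"
      using \<sigma> h(2) cr unfolding alice_winning_strategy_def by (metis snd_conv)
    then have L: "affine_hyperplane (fst (\<sigma> h))" "snd (\<sigma> h) \<le> \<rho> / (28 * real M)"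
      by (simp_all add: alice_move_def \<beta>_def)
    have \<rho>: "0 < \<rho>" using h(2) cr by simp
    have eq: "\<rho> / (28 * real M) = \<beta> * \<rho>" by (simp add: \<beta>_def)
    obtain f where "\<And>n. n < M\<^sup>2 \<Longrightarrow> cball (f n) (\<rho> / (28 * real M)) \<subseteq> cball c \<rho> - hyperplane_nbhd (fst (\<sigma> h)) (snd (\<sigma> h))"
      "\<And>m n x y. m < M\<^sup>2 \<Longrightarrow> n < M\<^sup>2 \<Longrightarrow> m \<noteq> n \<Longrightarrow> x \<in> cball (f m) (\<rho> / (28 * real M)) \<Longrightarrow>
       y \<in> cball (f n) (\<rho> / (28 * real M)) \<Longrightarrow> \<rho> / (28 * real M) \<le> dist x y"
      using many_moves_off_hyperplane[OF L(1) \<rho> M(1) L(2), where c = c] by blast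
    then have "good h f" unfolding good_def Let_def cr eq N_def[symmetric] by auto
    then show ?thesis unfolding F_def using someI[of "good h" f] by blast
  qed
  define step where "step h d = h @ [(F h d, \<beta> * snd (last h))]" for h d
  define hist where "hist t = rec_nat [(c0, \<rho>0)] (\<lambda>n h. step h (digit N t n))" for t
  have hist: "hist t 0 = [(c0, \<rho>0)]" "hist t (Suc n) = step (hist t n) (digit N t n)" for t n
    by (simp_all add: hist_def)
  define B where "B t n = last (hist t n)" for t n
  have ne: "hist t n \<noteq> []" for t n by (cases n) (simp_all add: hist step_def)
  have rad: "snd (B t n) = \<beta> ^ n * \<rho>0" for t n
    by (induction n) (simp_all add: B_def hist step_def)
  \<comment> \<open>The history after \<open>n\<close> moves has \<open>n + 1\<close> balls, which
    is the position that Alice's strategy is given.\<close>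
  have map: "map (B t) [0..<Suc n] = hist t n" for t n
  proof (induction n)
    case (Suc n)
    have "B t (Suc n) = (F (hist t n) (digit N t n), \<beta> * snd (last (hist t n)))"
      by (simp add: B_def hist step_def)
    then show ?case using Suc by (simp add: hist step_def)
  qed (simp add: B_def hist)
  have rpos: "0 < snd (B t n)" for t n using rad \<beta> \<rho>0 by simp
  have goodn: "good (hist t n) (F (hist t n))" for t n
    using good[OF ne] rpos unfolding B_def by blast
  have Bsuc: "B t (Suc n) = (F (hist t n) (digit N t n), \<beta> * snd (B t n))" for t n
    by (simp add: B_def hist step_def)
  have sub: "cball (fst (B t (Suc n))) (snd (B t (Suc n))) \<subseteq>
      cball (fst (B t n)) (snd (B t n)) - hyperplane_nbhd (fst (\<sigma> (hist t n))) (snd (\<sigma> (hist t n)))" for t n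
    using goodn[of t n] digit_less[of N t n] N unfolding Bsuc good_def Let_def B_def[symmetric]
    by (simp add: split_def)
  have play: "bob_play \<beta> U \<sigma> (B t)" for t
    unfolding bob_play_def map
  proof (intro conjI allI)
    show "0 < snd (B t 0)" by (rule rpos)
    show "cball (fst (B t 0)) (snd (B t 0)) \<subseteq> U" using U by (simp add: B_def hist)
    show "\<beta> * snd (B t n) \<le> snd (B t (Suc n))" for n by (simp add: Bsuc)
    show "cball (fst (B t (Suc n))) (snd (B t (Suc n))) \<subseteq> cball (fst (B t n)) (snd (B t n)) -
        (case \<sigma> (hist t n) of (L, r) \<Rightarrow> hyperplane_nbhd L r)" for n
      using sub[of t n] by (simp add: split_def)
  qed
  have lim: "(\<lambda>n. snd (B t n)) \<longlonglongrightarrow> 0" for t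
    unfolding rad using \<beta> by (intro tendsto_mult_left_zero LIMSEQ_realpow_zero) auto
  have "\<exists>x. x \<in> A \<and> (\<forall>n. x \<in> cball (fst (B t n)) (snd (B t n)))" for t
  proof -
    have "\<forall>B. bob_play \<beta> U \<sigma> B \<and> (\<lambda>n. snd (B n)) \<longlonglongrightarrow> 0 \<longrightarrow>
        (\<Inter>n. cball (fst (B n)) (snd (B n))) \<inter> A \<noteq> {}"
      using \<sigma> unfolding alice_winning_strategy_def by (rule conjunct2)
    from this[rule_format, OF conjI[OF play[of t] lim[of t]]] show ?thesis by blast
  qed
  then have "\<exists>x. \<forall>t. x t \<in> A \<and> (\<forall>n. x t \<in> cball (fst (B t n)) (snd (B t n)))"
    by (intro choice allI)
  then obtain x where x: "\<And>t. x t \<in> A" "\<And>t n. x t \<in> cball (fst (B t n)) (snd (B t n))" by auto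
  define C where "C = (1 / (\<beta> * \<rho>0)) powr s"
  show ?thesis
  proof (rule that[of C x])
    show "0 < C" using \<beta> \<rho>0 by (simp add: C_def)
    show "x t \<in> A \<inter> cball c0 \<rho>0" for t using x(1)[of t] x(2)[of t 0] by (simp add: B_def hist)
    show "\<bar>t - t'\<bar> \<le> C * dist (x t) (x t') powr s" if t: "t \<in> {0..<1}" "t' \<in> {0..<1}" for t t'
    proof (cases "t = t'")
      case False
      obtain n where n: "\<And>m. m < n \<Longrightarrow> digit N t m = digit N t' m" "digit N t n \<noteq> digit N t' n"
        "\<bar>t - t'\<bar> \<le> (1 / N) ^ n"
        using first_different_digit[OF N, of t t'] t False by auto
      \<comment> \<open>The two runs agree up to ball \<open>n\<close> and then continue with
        different, hence separated, balls. So \<open>dist (x t) (x t')\<close> is at least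
        \<open>\<beta> ^ Suc n * \<rho>0\<close>, while the parameters differ by at most
        \<open>(1 / N) ^ n\<close>.\<close>
      have "hist t m = hist t' m" if "m \<le> n" for m
        using that by (induction m) (simp_all add: hist n(1))
      then have h: "hist t n = hist t' n" by simp
      have r: "snd (last (hist t n)) = \<beta> ^ n * \<rho>0" using rad[of t n] by (simp add: B_def)
      have "\<beta> * (\<beta> ^ n * \<rho>0) \<le> dist (x t) (x t')"
      proof -
        have g: "\<forall>m<N. \<forall>k<N. \<forall>x y. m \<noteq> k \<and> x \<in> cball (F (hist t n) m) (\<beta> * (\<beta> ^ n * \<rho>0)) \<and>
            y \<in> cball (F (hist t n) k) (\<beta> * (\<beta> ^ n * \<rho>0)) \<longrightarrow> \<beta> * (\<beta> ^ n * \<rho>0) \<le> dist x y"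
          using goodn[of t n] r unfolding good_def Let_def by (simp add: split_def)
        have "x t \<in> cball (F (hist t n) (digit N t n)) (\<beta> * (\<beta> ^ n * \<rho>0))"
          using x(2)[of t "Suc n"] unfolding Bsuc rad by simp
        moreover have "x t' \<in> cball (F (hist t n) (digit N t' n)) (\<beta> * (\<beta> ^ n * \<rho>0))"
          using x(2)[of t' "Suc n"] unfolding Bsuc rad h by simp
        ultimately show ?thesis using g digit_less N n(2) by (meson less_trans zero_less_one)
      qed
      then have "\<beta> ^ n \<le> dist (x t) (x t') * (1 / (\<beta> * \<rho>0))" using \<beta> \<rho>0 by (simp add: field_simps)
      then have "(\<beta> ^ n) powr s \<le> (dist (x t) (x t') * (1 / (\<beta> * \<rho>0))) powr s"
        using s \<beta> by (intro powr_mono2) auto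
      also have "\<dots> = C * dist (x t) (x t') powr s" unfolding C_def powr_mult by simp
      finally have "(\<beta> ^ n) powr s \<le> C * dist (x t) (x t') powr s" .
      moreover have "(\<beta> ^ n) powr s = (\<beta> powr s) ^ n"
      proof -
        have "(\<beta> ^ n) powr s = (\<beta> powr real n) powr s" using \<beta> by (simp add: powr_realpow)
        also have "\<dots> = (\<beta> powr s) powr real n" unfolding powr_powr by (simp only: mult.commute)
        also have "\<dots> = (\<beta> powr s) ^ n" using \<beta> by (simp add: powr_realpow)
        finally show ?thesis .
      qed
      moreover have "(1 / N) ^ n \<le> (\<beta> powr s) ^ n" using \<beta>N by (intro power_mono) auto
      ultimately show ?thesis using n(3) by linarith
    qed simp
  qed
qed

section \<open>Hausdorff measure on the flat torus\<close>

text \<open>A lift of the second point closer to \<open>z\<close> than \<open>w\<close> would differ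
  from \<open>w\<close> by a nonzero integer vector of norm less than 1.\<close>

lemma torus_dist_eq:
  assumes "dist z w < 1 / 2"
  shows "torus_dist (torus_point z) (torus_point w) = dist z w"
proof (rule antisym[OF torus_dist_le], rule ccontr)
  assume "\<not> dist z w \<le> torus_dist (torus_point z) (torus_point w)"
  then obtain w' where w': "torus_point w' = torus_point w" "dist z w' < dist z w"
    using torus_dist_less[of z w "dist z w"] by auto
  have "dist w' w < 1" using w'(2) assms dist_triangle3[of w' w z] by linarith
  then have lt: "\<bar>fst (w' - w)\<bar> < 1" "\<bar>snd (w' - w)\<bar> < 1"
    using dist_fst_le[of w' w] dist_snd_le[of w' w] by (simp_all add: dist_real_def)
  have "w' - w \<in> int_lattice" using w'(1) by (simp only: torus_point_eq_iff)
  then have "fst (w' - w) \<in> \<int>" "snd (w' - w) \<in> \<int>" by (auto simp: int_lattice_def mem_Times_iff)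
  then have "fst (w' - w) = 0" "snd (w' - w) = 0" using lt Ints_nonzero_abs_less1 by blast+
  then have "w' = w" by (simp add: prod_eq_iff)
  then show False using w'(2) by simp
qed

lemma ediam_upper: "x \<in> C \<Longrightarrow> y \<in> C \<Longrightarrow> ennreal (d x y) \<le> ediam d C"
  unfolding ediam_def by (meson SUP_upper2 order_refl)

text \<open>Countable subadditivity of Lebesgue measure, applied to intervals of length
  \<open>2 * l i\<close> around the possibly nonmeasurable sets \<open>T i\<close>.\<close>

lemma unit_interval_cover:
  fixes T :: "nat \<Rightarrow> real set" and l :: "nat \<Rightarrow> real"
  assumes cover: "{0..<1} \<subseteq> (\<Union>i. T i)" and l: "\<And>i. 0 \<le> l i"
    and small: "\<And>i t t'. t \<in> T i \<Longrightarrow> t' \<in> T i \<Longrightarrow> \<bar>t - t'\<bar> \<le> l i"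
  shows "1 \<le> (\<Sum>i. ennreal (2 * l i))"
proof -
  \<comment> \<open>For an empty \<open>T i\<close> the centre is an arbitrary real, which is
    harmless for an upper bound.\<close>
  define I where "I i = {(SOME t. t \<in> T i) - l i .. (SOME t. t \<in> T i) + l i}" for i
  have TI: "T i \<subseteq> I i" for i
  proof
    fix t assume t: "t \<in> T i"
    then have "(SOME t. t \<in> T i) \<in> T i" by (rule someI)
    then show "t \<in> I i" using small[OF t] by (force simp: I_def abs_le_iff)
  qed
  have "(\<Union>i. T i) \<subseteq> (\<Union>i. I i)" by (intro UN_mono TI order_refl)
  with cover have "{0..<1} \<subseteq> (\<Union>i. I i)" by (rule order_trans)
  then have "emeasure lborel {0..<1::real} \<le> emeasure lborel (\<Union>i. I i)"
    by (intro emeasure_mono) (auto simp: I_def)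
  also have "\<dots> \<le> (\<Sum>i. emeasure lborel (I i))"
    by (intro emeasure_subadditive_countably) (auto simp: I_def)
  also have "\<dots> = (\<Sum>i. ennreal (2 * l i))" using l by (simp add: I_def)
  finally show ?thesis by simp
qed

text \<open>A cover of \<open>S\<close> pulls back along \<open>x\<close> to a cover of the unit
  interval, where a set of diameter \<open>e\<close> becomes one of diameter at most
  \<open>C * e powr s\<close>. Thus every cover has \<open>s\<close>-sum at least
  \<open>1 / (2 * C)\<close>.\<close>

lemma hausdorff_measure_pos:
  fixes x :: "real \<Rightarrow> real \<times> real"
  assumes s: "0 < s" and C: "0 < C"
    and x: "\<And>t. torus_point (x t) \<in> S" "\<And>t t'. dist (x t) (x t') < 1 / 2"
    and hoelder: "\<And>t t'. t \<in> {0..<1} \<Longrightarrow> t' \<in> {0..<1} \<Longrightarrow> \<bar>t - t'\<bar> \<le> C * dist (x t) (x t') powr s"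
  shows "hausdorff_measure torus torus_dist s S \<noteq> 0"
proof -
  \<comment> \<open>Taking 1 as bound on the diameters keeps them finite, so that
    \<open>enn2real\<close> loses nothing.\<close>
  have "ennreal (1 / (2 * C)) \<le> hausdorff_premeasure torus torus_dist s 1 S"
    unfolding hausdorff_premeasure_def
  proof (rule INF_greatest)
    fix D :: "nat \<Rightarrow> (real^3^3) set set"
    assume "D \<in> {C. (\<forall>i. C i \<subseteq> torus \<and> ediam torus_dist (C i) \<le> ennreal 1) \<and> S \<subseteq> (\<Union>i. C i)}"
    then have D: "\<And>i. ediam torus_dist (D i) \<le> ennreal 1" "S \<subseteq> (\<Union>i. D i)" by auto
    define e where "e i = enn2real (ediam torus_dist (D i))" for i
    define T where "T i = {t \<in> {0..<1}. torus_point (x t) \<in> D i}" for i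
    have "1 \<le> (\<Sum>i. ennreal (2 * (C * e i powr s)))"
    proof (rule unit_interval_cover[of T])
      show "{0..<1} \<subseteq> (\<Union>i. T i)" using D(2) x(1) by (force simp: T_def)
      show "0 \<le> C * e i powr s" for i using C by simp
      show "\<bar>t - t'\<bar> \<le> C * e i powr s" if t: "t \<in> T i" "t' \<in> T i" for i t t'
      proof -
        have fin: "ediam torus_dist (D i) < top" using D(1)[of i] by (simp add: le_less_trans)
        have "ennreal (dist (x t) (x t')) \<le> ediam torus_dist (D i)"
          using ediam_upper[of "torus_point (x t)" "D i" "torus_point (x t')" torus_dist] t
            torus_dist_eq[OF x(2)] by (simp add: T_def)
        then have "dist (x t) (x t') \<le> e i"
          using enn2real_mono[OF _ fin] unfolding e_def by fastforce
        then have "C * dist (x t) (x t') powr s \<le> C * e i powr s"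
          using C s by (intro mult_left_mono powr_mono2) auto
        then show ?thesis using hoelder[of t t'] t by (simp add: T_def)
      qed
    qed
    also have "(\<Sum>i. ennreal (2 * (C * e i powr s))) = ennreal (2 * C) * (\<Sum>i. ennreal (e i powr s))"
      using C by (simp add: ennreal_mult[symmetric] mult.assoc ennreal_suminf_cmult[symmetric])
    finally have "ennreal (1 / (2 * C)) * 1 \<le> ennreal (1 / (2 * C)) * (ennreal (2 * C) * (\<Sum>i. ennreal (e i powr s)))"
      by (intro mult_left_mono) auto
    also have "\<dots> = (\<Sum>i. ennreal (e i powr s))"
      using C by (simp add: mult.assoc[symmetric] ennreal_mult[symmetric])
    finally show "ennreal (1 / (2 * C)) \<le> (\<Sum>i. ennreal (enn2real (ediam torus_dist (D i)) powr s))"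
      by (simp add: e_def)
  qed
  also have "\<dots> \<le> hausdorff_measure torus torus_dist s S"
    unfolding hausdorff_measure_def by (rule SUP_upper) simp
  finally have "ennreal (1 / (2 * C)) \<le> hausdorff_measure torus torus_dist s S" .
  moreover have "0 < ennreal (1 / (2 * C))" using C by simp
  ultimately show ?thesis by (metis not_le)
qed

text \<open>The cells of side \<open>1 / n\<close> in the fundamental square, numbered by
  \<open>i = a * n + b\<close>. Empty sets follow because covers in
  \<open>hausdorff_premeasure\<close> are infinite sequences.\<close>

lemma grid_cover:
  assumes n: "0 < n"
  obtains D :: "nat \<Rightarrow> (real^3^3) set set" where "\<And>i. D i \<subseteq> torus" "\<And>i. ediam torus_dist (D i) \<le> ennreal (2 / real n)"
    "\<And>i. n\<^sup>2 \<le> i \<Longrightarrow> D i = {}" "torus \<subseteq> (\<Union>i. D i)"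
proof -
  define Q where "Q i = {real (i div n) / n .. (real (i div n) + 1) / n} \<times> {real (i mod n) / n .. (real (i mod n) + 1) / n}" for i
  define D where "D i = (if i < n\<^sup>2 then torus_point ` Q i else {})" for i
  show ?thesis
  proof (rule that[of D])
    show "D i \<subseteq> torus" for i by (auto simp: D_def torus_def)
    show "n\<^sup>2 \<le> i \<Longrightarrow> D i = {}" for i by (simp add: D_def)
    show "ediam torus_dist (D i) \<le> ennreal (2 / real n)" for i
      unfolding ediam_def
    proof (intro SUP_least)
      fix p q assume "p \<in> D i" "q \<in> D i"
      then obtain z w where zw: "p = torus_point z" "q = torus_point w" "z \<in> Q i" "w \<in> Q i"
        by (auto simp: D_def split: if_splits)
      then have "dist (fst z) (fst w) \<le> 1 / n" "dist (snd z) (snd w) \<le> 1 / n"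
        by (auto simp: Q_def dist_real_def abs_le_iff add_divide_distrib)
      moreover have "dist z w \<le> dist (fst z) (fst w) + dist (snd z) (snd w)"
        unfolding dist_prod_def by (rule sqrt_sum_squares_le_sum) auto
      ultimately have "dist z w \<le> 2 / n" by simp
      then have "torus_dist p q \<le> 2 / n" using torus_dist_le[of z w] zw by simp
      then show "ennreal (torus_dist p q) \<le> ennreal (2 / real n)" by (rule ennreal_leI)
    qed
    show "torus \<subseteq> (\<Union>i. D i)"
    proof
      fix p assume "p \<in> torus"
      then obtain z where z: "p = torus_point z" by (auto simp: torus_def)
      define w where "w = (frac (fst z), frac (snd z))"
      have "z - w \<in> int_lattice" by (cases z) (simp add: w_def int_lattice_def frac_def)
      then have p: "p = torus_point w" by (simp add: torus_point_eq_iff z)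
      have cell: "\<exists>a<n. real a / n \<le> frac u \<and> frac u \<le> (real a + 1) / n" for u :: real
      proof (intro exI[of _ "nat \<lfloor>n * frac u\<rfloor>"] conjI)
        have nn: "0 \<le> n * frac u" "n * frac u < n" using n by (simp_all add: frac_ge_0 frac_lt_1)
        then have f: "real (nat \<lfloor>n * frac u\<rfloor>) = of_int \<lfloor>n * frac u\<rfloor>" by simp
        have "\<lfloor>n * frac u\<rfloor> < int n" using nn(2) by (simp add: floor_less_iff)
        then show "nat \<lfloor>n * frac u\<rfloor> < n" using n by linarith
        show "real (nat \<lfloor>n * frac u\<rfloor>) / n \<le> frac u" "frac u \<le> (real (nat \<lfloor>n * frac u\<rfloor>) + 1) / n"
          unfolding f using n of_int_floor_le[of "n * frac u"] real_of_int_floor_add_one_ge[of "n * frac u"]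
          by (simp_all add: field_simps)
      qed
      obtain a where a: "a < n" "real a / n \<le> fst w" "fst w \<le> (real a + 1) / n"
        using cell[of "fst z"] by (auto simp: w_def)
      obtain b where b: "b < n" "real b / n \<le> snd w" "snd w \<le> (real b + 1) / n"
        using cell[of "snd z"] by (auto simp: w_def)
      define i where "i = a * n + b"
      have i: "i div n = a" "i mod n = b" using b(1) by (simp_all add: i_def)
      have "a * n + b < a * n + n" using b(1) by simp
      also have "\<dots> = (a + 1) * n" by simp
      also have "\<dots> \<le> n * n" using a(1) by (intro mult_right_mono) auto
      finally have "i < n\<^sup>2" by (simp add: i_def power2_eq_square)
      moreover have "w \<in> Q i" using a b by (simp add: Q_def i mem_Times_iff)
      ultimately show "p \<in> (\<Union>i. D i)" unfolding p by (auto simp: D_def)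
    qed
  qed
qed

text \<open>The grid of \<open>n\<^sup>2\<close> cells of diameter at most \<open>2 / n\<close> has
  \<open>s\<close>-sum at most \<open>2 powr s * n powr (2 - s)\<close>, which tends to
  zero.\<close>

lemma hausdorff_measure_zero:
  assumes s: "2 < s" and S: "S \<subseteq> torus"
  shows "hausdorff_measure torus torus_dist s S = 0"
proof -
  have "hausdorff_premeasure torus torus_dist s \<delta> S \<le> 0" if \<delta>: "0 < \<delta>" for \<delta>
  proof (rule LIMSEQ_le_const)
    have "(\<lambda>n. 2 powr s * real n powr (2 - s)) \<longlonglongrightarrow> 2 powr s * 0"
      using s by (intro tendsto_mult tendsto_const tendsto_neg_powr filterlim_real_sequentially) auto
    then show "(\<lambda>n. ennreal (2 powr s * real n powr (2 - s))) \<longlonglongrightarrow> 0"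
      using tendsto_ennrealI by fastforce
    obtain n0 :: nat where n0: "max 1 (2 / \<delta>) \<le> real n0" using real_arch_simple by blast
    show "\<exists>N. \<forall>n\<ge>N. hausdorff_premeasure torus torus_dist s \<delta> S \<le> ennreal (2 powr s * real n powr (2 - s))"
    proof (intro exI[of _ n0] allI impI)
      fix n assume "n0 \<le> n"
      then have n: "1 \<le> real n" "2 / \<delta> \<le> real n" using n0 by auto
      then have "2 / real n \<le> \<delta>" using \<delta> by (simp add: field_simps)
      obtain D where D: "\<And>i. D i \<subseteq> torus" "\<And>i. ediam torus_dist (D i) \<le> ennreal (2 / real n)"
        "\<And>i. n\<^sup>2 \<le> i \<Longrightarrow> D i = {}" "torus \<subseteq> (\<Union>i. D i)"
        using grid_cover[of n] n by auto
      \<comment> \<open>The supremum over an empty set is 0 in \<open>ennreal\<close>, and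
        \<open>0 powr s = 0\<close>.\<close>
      have dz: "enn2real (ediam torus_dist (D i)) powr s = 0" if "n\<^sup>2 \<le> i" for i
        using D(3)[OF that] by (simp add: ediam_def bot_ennreal)
      have "hausdorff_premeasure torus torus_dist s \<delta> S \<le>
          (\<Sum>i. ennreal (enn2real (ediam torus_dist (D i)) powr s))"
        unfolding hausdorff_premeasure_def
      proof (rule INF_lower, intro CollectI conjI allI D(1))
        show "ediam torus_dist (D i) \<le> ennreal \<delta>" for i
          using D(2)[of i] ennreal_leI[OF \<open>2 / real n \<le> \<delta>\<close>] by (rule order_trans)
        show "S \<subseteq> (\<Union>i. D i)" using S D(4) by (rule order_trans)
      qed
      also have "\<dots> = (\<Sum>i<n\<^sup>2. ennreal (enn2real (ediam torus_dist (D i)) powr s))"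
        using dz by (intro suminf_finite) auto
      also have "\<dots> \<le> (\<Sum>i<n\<^sup>2. ennreal ((2 / real n) powr s))"
      proof (intro sum_mono ennreal_leI powr_mono2)
        show "enn2real (ediam torus_dist (D i)) \<le> 2 / real n" for i
          using enn2real_mono[OF D(2)[of i]] n by simp
      qed (use s in auto)
      also have "\<dots> = ennreal ((real n)\<^sup>2 * (2 / real n) powr s)"
        by (simp add: ennreal_mult ennreal_of_nat_eq_real_of_nat)
      also have "(real n)\<^sup>2 * (2 / real n) powr s = 2 powr s * real n powr (2 - s)"
        using n by (simp add: powr_divide powr_diff powr_numeral)
      finally show "hausdorff_premeasure torus torus_dist s \<delta> S \<le> ennreal (2 powr s * real n powr (2 - s))" .
    qed
  qed
  then show ?thesis unfolding hausdorff_measure_def by (auto intro!: antisym SUP_least)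
qed

lemma hausdorff_dim_not_fiberwise_divergent:
  "hausdorff_dim torus torus_dist {p \<in> torus. \<not> fiberwise_divergent p} = 2"
  (is "hausdorff_dim _ _ ?S = 2")
proof (rule antisym)
  show "hausdorff_dim torus torus_dist ?S \<le> 2"
  proof (rule ennreal_le_epsilon)
    fix e :: real assume e: "0 < e"
    have "hausdorff_measure torus torus_dist (2 + e) ?S = 0"
      using e by (intro hausdorff_measure_zero) auto
    then have "hausdorff_dim torus torus_dist ?S \<le> ennreal (2 + e)"
      unfolding hausdorff_dim_def using e by (intro INF_lower) auto
    then show "hausdorff_dim torus torus_dist ?S \<le> 2 + ennreal e" using e by simp
  qed
  show "2 \<le> hausdorff_dim torus torus_dist ?S"
    unfolding hausdorff_dim_def
  proof (rule INF_greatest)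
    fix s assume "s \<in> {s. 0 < s \<and> hausdorff_measure torus torus_dist s ?S = 0}"
    then have s: "0 < s" "hausdorff_measure torus torus_dist s ?S = 0" by auto
    have "\<not> s < 2"
    proof
      assume "s < 2"
      let ?U = "UNIV :: (real \<times> real) set"
      let ?G = "{z. \<not> fiberwise_divergent (torus_point z)}"
      \<comment> \<open>Starting in a ball of radius \<open>1 / 8\<close> keeps all outcomes within
        \<open>1 / 4\<close> of each other, where \<open>torus_dist\<close> is the Euclidean
        distance.\<close>
      obtain C and x :: "real \<Rightarrow> real \<times> real" where C: "0 < C"
        and x: "\<And>t. x t \<in> (?U \<inter> ?G) \<inter> cball 0 (1 / 8)"
          "\<And>t t'. t \<in> {0..<1} \<Longrightarrow> t' \<in> {0..<1} \<Longrightarrow> \<bar>t - t'\<bar> \<le> C * dist (x t) (x t') powr s"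
        using HAW_on_inverse_Hoelder[OF HAW_on_not_fiberwise_divergent[of ?U] s(1) \<open>s < 2\<close>, of "1/8" 0] by auto
      have "hausdorff_measure torus torus_dist s ?S \<noteq> 0"
      proof (rule hausdorff_measure_pos[OF s(1) C _ _ x(2)])
        show "torus_point (x t) \<in> ?S" for t using x(1)[of t] by (simp add: torus_def)
        show "dist (x t) (x t') < 1 / 2" for t t'
          using x(1)[of t] x(1)[of t'] dist_triangle3[of "x t" "x t'" 0] by simp
      qed
      then show False using s(2) by simp
    qed
    then have "ennreal 2 \<le> ennreal s" by (intro ennreal_leI) simp
    then show "2 \<le> ennreal s" by simp
  qed
qed

theorem theorem1p9:
  shows "HAW_on_manifold (subtopology X3_topology torus) torus_atlas
           {p \<in> torus. \<not> fiberwise_divergent p} \<and>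
         hausdorff_dim torus torus_dist {p \<in> torus. \<not> fiberwise_divergent p} = 2"
  using HAW_on_torus_not_fiberwise_divergent hausdorff_dim_not_fiberwise_divergent by blast

end
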